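(* Let $\epsilon$ be a primitive central idempotent of $\mathbf u_\zeta$. Then $\epsilon U_\zeta$ is a two-sided ideal of $U_\zeta$ which is an indecomposable algebra (i.e. not a direct product of two nonzero algebras).
   Context: $\Bbbk$ is a field of characteristic $0$ containing a primitive $\ell$-th root of unity $\zeta$, where $\ell>1$ is odd. $U_q$ is the $\mathbb Q(q)$-algebra generated by $E,F,K^{\pm1}$ with $KEK^{-1}=q^2E$, $KFK^{-1}=q^{-2}F$, $EF-FE=\frac{K-K^{-1}}{q-q^{-1}}$; $[n]=\frac{q^n-q^{-n}}{q-q^{-1}}$, $E^{(n)}=E^n/[n]!$, $F^{(n)}=F^n/[n]!$. $U_{\mathcal A}$ is the $\mathcal A=\mathbb Z[q,q^{-1}]$-subalgebra generated by all $E^{(n)},F^{(n)},K^{\pm1}$, $\hat U_\zeta=U_{\mathcal A}\otimes_{\mathcal A}\Bbbk$ with $q\mapsto\zeta$, and $U_\zeta=\hat U_\zeta/(K^\ell-1)$. $\mathbf u_\zeta$ is the (finite-dimensional) subalgebra of $U_\zeta$ generated by $E,F,K$. A primitive central idempotent of $\mathbf u_\zeta$ is a primitive idempotent of the center of $\mathbf u_\zeta$; such idempotents are central in $U_\zeta$. *)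

theory Defs
  imports
    "HOL-Library.Poly_Mapping"
    "HOL-Computational_Algebra.Polynomial"
    "HOL-Computational_Algebra.Fraction_Field"
    "HOL-Algebra.Generated_Rings"
    "HOL-Algebra.Chinese_Remainder"
    "HOL-Algebra.Module"
    "HOL-Algebra.Algebraic_Closure_Type"
begin

section \<open>Associative algebras\<close>

text \<open>The library locale \<^locale>\<open>algebra\<close> only covers commutative algebras.\<close>

locale assoc_algebra = module + ring M +
  assumes smult_mult_left:
      "\<lbrakk>a \<in> carrier R; x \<in> carrier M; y \<in> carrier M\<rbrakk> \<Longrightarrow>
        (a \<odot>\<^bsub>M\<^esub> x) \<otimes>\<^bsub>M\<^esub> y = a \<odot>\<^bsub>M\<^esub> (x \<otimes>\<^bsub>M\<^esub> y)"
    and smult_mult_right: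
      "\<lbrakk>a \<in> carrier R; x \<in> carrier M; y \<in> carrier M\<rbrakk> \<Longrightarrow>
        x \<otimes>\<^bsub>M\<^esub> (a \<odot>\<^bsub>M\<^esub> y) = a \<odot>\<^bsub>M\<^esub> (x \<otimes>\<^bsub>M\<^esub> y)"

definition subalgebra_generated ::
    "('k, 'r) ring_scheme \<Rightarrow> ('k, 'a, 'm) module_scheme \<Rightarrow> 'a set \<Rightarrow> 'a set" where
  "subalgebra_generated R A S =
     generate_ring A ({a \<odot>\<^bsub>A\<^esub> \<one>\<^bsub>A\<^esub> | a. a \<in> carrier R} \<union> S)"

definition algebra_iso ::
    "('k, 'r) ring_scheme \<Rightarrow> ('k, 'a, 'm) module_scheme \<Rightarrow> ('k, 'b, 'n) module_scheme
      \<Rightarrow> ('a \<Rightarrow> 'b) set" where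
  "algebra_iso R A B =
     {h \<in> ring_iso A B. \<forall>a \<in> carrier R. \<forall>x \<in> carrier A. h (a \<odot>\<^bsub>A\<^esub> x) = a \<odot>\<^bsub>B\<^esub> h x}"

definition algebra_prod ::
    "('k, 'a, 'm) module_scheme \<Rightarrow> ('k, 'b, 'n) module_scheme \<Rightarrow> ('k, 'a \<times> 'b) module" where
  "algebra_prod A B =
     ring.extend (RDirProd A B) (module.fields (\<lambda>a (x, y). (a \<odot>\<^bsub>A\<^esub> x, a \<odot>\<^bsub>B\<^esub> y)))"

definition ring_center :: "('a, 'm) ring_scheme \<Rightarrow> ('a, 'm) ring_scheme" where
  "ring_center A =
     A\<lparr>carrier := {z \<in> carrier A. \<forall>x \<in> carrier A. z \<otimes>\<^bsub>A\<^esub> x = x \<otimes>\<^bsub>A\<^esub> z}\<rparr>"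

definition idempotent_in :: "('a, 'm) ring_scheme \<Rightarrow> 'a \<Rightarrow> bool" where
  "idempotent_in A e \<longleftrightarrow> e \<in> carrier A \<and> e \<otimes>\<^bsub>A\<^esub> e = e"

definition primitive_idempotent :: "('a, 'm) ring_scheme \<Rightarrow> 'a \<Rightarrow> bool" where
  "primitive_idempotent A e \<longleftrightarrow>
     idempotent_in A e \<and> e \<noteq> \<zero>\<^bsub>A\<^esub> \<and>
     (\<forall>f g. idempotent_in A f \<and> idempotent_in A g \<and>
            f \<otimes>\<^bsub>A\<^esub> g = \<zero>\<^bsub>A\<^esub> \<and> g \<otimes>\<^bsub>A\<^esub> f = \<zero>\<^bsub>A\<^esub> \<and> e = f \<oplus>\<^bsub>A\<^esub> g
        \<longrightarrow> f = \<zero>\<^bsub>A\<^esub> \<or> g = \<zero>\<^bsub>A\<^esub>)"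

definition primitive_central_idempotent :: "('a, 'm) ring_scheme \<Rightarrow> 'a \<Rightarrow> bool" where
  "primitive_central_idempotent A e \<longleftrightarrow> primitive_idempotent (ring_center A) e"

text \<open>The set \<open>eA\<close> with the operations of \<open>A\<close> and with unit \<open>e\<close>.\<close>

definition cut_algebra :: "'a \<Rightarrow> ('a, 'm) ring_scheme \<Rightarrow> ('a, 'm) ring_scheme" where
  "cut_algebra e A = A\<lparr>carrier := e <#\<^bsub>A\<^esub> carrier A, one := e\<rparr>"

definition primitive_root_of_unity :: "nat \<Rightarrow> 'k::field \<Rightarrow> bool" where
  "primitive_root_of_unity l z \<longleftrightarrow> z ^ l = 1 \<and> (\<forall>m. 0 < m \<and> m < l \<longrightarrow> z ^ m \<noteq> 1)"


section \<open>The quantum group over the rational functions\<close>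

type_synonym ratfun = "rat poly fract"

definition qvar :: ratfun where
  "qvar = Fraction_Field.Fract [:0, 1:] 1"

definition qint :: "nat \<Rightarrow> ratfun" where
  "qint n = (qvar powi int n - qvar powi (- int n)) / (qvar - inverse qvar)"

definition qfact :: "nat \<Rightarrow> ratfun" where
  "qfact n = (\<Prod>i = 1..n. qint i)"

text \<open>
  \<^typ>\<open>'w \<Rightarrow>\<^sub>0 'c\<close> is the monoid algebra of an additively written monoid \<open>'w\<close>. With the
  monoid of words it is the free algebra.
\<close>

datatype 'x word = Word "'x list"

instantiation word :: (type) monoid_add
begin

definition zero_word :: "'a word" where
  "zero_word = Word []"

fun plus_word :: "'a word \<Rightarrow> 'a word \<Rightarrow> 'a word" where
  "plus_word (Word xs) (Word ys) = Word (xs @ ys)"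

instance
proof
  fix a b c :: "'a word"
  show "a + b + c = a + (b + c)" by (cases a; cases b; cases c) simp
  show "0 + a = a" by (cases a) (simp add: zero_word_def)
  show "a + 0 = a" by (cases a) (simp add: zero_word_def)
qed

end

datatype generator = GE | GF | GK | GKinv

type_synonym free_alg = "generator word \<Rightarrow>\<^sub>0 ratfun"

definition gen :: "generator \<Rightarrow> free_alg" where
  "gen g = Poly_Mapping.single (Word [g]) 1"

definition const :: "ratfun \<Rightarrow> free_alg" where
  "const c = Poly_Mapping.single 0 c"

definition Uq_relations :: "free_alg set" where
  "Uq_relations =
    {gen GK * gen GKinv - 1,
     gen GKinv * gen GK - 1,
     gen GK * gen GE * gen GKinv - const (qvar powi 2) * gen GE,
     gen GK * gen GF * gen GKinv - const (qvar powi (-2)) * gen GF,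
     gen GE * gen GF - gen GF * gen GE
       - const (inverse (qvar - inverse qvar)) * (gen GK - gen GKinv)}"

definition Uq_ideal :: "free_alg set" where
  "Uq_ideal = genideal ring_of_type_algebra Uq_relations"

lemma ring_of_type_algebra_simps [simp]:
  "carrier (ring_of_type_algebra :: 'a::ring_1 ring) = UNIV"
  "x \<otimes>\<^bsub>ring_of_type_algebra\<^esub> y = x * (y :: 'a)"
  "x \<oplus>\<^bsub>ring_of_type_algebra\<^esub> y = x + (y :: 'a)"
  "\<one>\<^bsub>ring_of_type_algebra\<^esub> = (1 :: 'a)"
  "\<zero>\<^bsub>ring_of_type_algebra\<^esub> = (0 :: 'a)"
  by (simp_all add: ring_of_type_algebra_def)

lemma ring_ring_of_type_algebra: "ring (ring_of_type_algebra :: 'a::ring_1 ring)"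
proof -
  have "\<exists>y. y + x = 0 \<and> x + y = 0" for x :: 'a
    by (rule exI[of _ "- x"]) simp
  then show ?thesis
    by unfold_locales (auto simp: algebra_simps Units_def)
qed

lemma Uq_ideal: "ideal Uq_ideal ring_of_type_algebra"
  unfolding Uq_ideal_def by (rule ring.genideal_ideal[OF ring_ring_of_type_algebra]) simp

lemma Uq_ideal_zero: "0 \<in> Uq_ideal"
  using additive_subgroup.zero_closed[OF ideal.axioms(1)[OF Uq_ideal]] by simp

lemma Uq_ideal_add: "x \<in> Uq_ideal \<Longrightarrow> y \<in> Uq_ideal \<Longrightarrow> x + y \<in> Uq_ideal"
  using additive_subgroup.a_closed[OF ideal.axioms(1)[OF Uq_ideal]] by simp

lemma Uq_ideal_mult_left: "x \<in> Uq_ideal \<Longrightarrow> y * x \<in> Uq_ideal"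
  using ideal.I_l_closed[OF Uq_ideal, of x y] by simp

lemma Uq_ideal_mult_right: "x \<in> Uq_ideal \<Longrightarrow> x * y \<in> Uq_ideal"
  using ideal.I_r_closed[OF Uq_ideal, of x y] by simp

lemma Uq_ideal_minus: "x \<in> Uq_ideal \<Longrightarrow> - x \<in> Uq_ideal"
  using Uq_ideal_mult_left[of x "- 1"] by simp

definition Uq_rel :: "free_alg \<Rightarrow> free_alg \<Rightarrow> bool" where
  "Uq_rel x y \<longleftrightarrow> x - y \<in> Uq_ideal"

quotient_type Uq = free_alg / Uq_rel
proof (rule equivpI)
  show "reflp Uq_rel"
    by (simp add: reflp_def Uq_rel_def Uq_ideal_zero)
  show "symp Uq_rel"
    unfolding symp_def Uq_rel_def using Uq_ideal_minus by fastforce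
  show "transp Uq_rel"
    unfolding transp_def Uq_rel_def using Uq_ideal_add by fastforce
qed

instantiation Uq :: "{ring, monoid_mult}"
begin

lift_definition zero_Uq :: Uq is 0 .
lift_definition one_Uq :: Uq is 1 .

lift_definition plus_Uq :: "Uq \<Rightarrow> Uq \<Rightarrow> Uq" is "(+)"
  unfolding Uq_rel_def by (metis Uq_ideal_add add_diff_add)

lift_definition uminus_Uq :: "Uq \<Rightarrow> Uq" is uminus
  unfolding Uq_rel_def by (metis Uq_ideal_minus minus_diff_minus)

lift_definition minus_Uq :: "Uq \<Rightarrow> Uq \<Rightarrow> Uq" is "(-)"
proof -
  fix a b c d :: free_alg
  assume "Uq_rel a b" "Uq_rel c d"
  then have "(a - b) + - (c - d) \<in> Uq_ideal"
    unfolding Uq_rel_def by (intro Uq_ideal_add Uq_ideal_minus)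
  then show "Uq_rel (a - c) (b - d)"
    unfolding Uq_rel_def by (simp add: algebra_simps)
qed

lift_definition times_Uq :: "Uq \<Rightarrow> Uq \<Rightarrow> Uq" is "(*)"
proof -
  fix a b c d :: free_alg
  assume "Uq_rel a b" "Uq_rel c d"
  then have "(a - b) * c + b * (c - d) \<in> Uq_ideal"
    unfolding Uq_rel_def by (intro Uq_ideal_add Uq_ideal_mult_left Uq_ideal_mult_right)
  then show "Uq_rel (a * c) (b * d)"
    unfolding Uq_rel_def by (simp add: algebra_simps)
qed

instance
proof
  fix a b c :: Uq
  show "a + b + c = a + (b + c)" by transfer (simp add: Uq_rel_def Uq_ideal_zero add.assoc)
  show "a + b = b + a" by transfer (simp add: Uq_rel_def Uq_ideal_zero add.commute)
  show "0 + a = a" by transfer (simp add: Uq_rel_def Uq_ideal_zero)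
  show "- a + a = 0" by transfer (simp add: Uq_rel_def Uq_ideal_zero)
  show "a - b = a + - b" by transfer (simp add: Uq_rel_def Uq_ideal_zero)
  show "a * b * c = a * (b * c)" by transfer (simp add: Uq_rel_def Uq_ideal_zero mult.assoc)
  show "(a + b) * c = a * c + b * c"
    by transfer (simp add: Uq_rel_def Uq_ideal_zero distrib_right)
  show "a * (b + c) = a * b + a * c"
    by transfer (simp add: Uq_rel_def Uq_ideal_zero distrib_left)
  show "1 * a = a" by transfer (simp add: Uq_rel_def Uq_ideal_zero)
  show "a * 1 = a" by transfer (simp add: Uq_rel_def Uq_ideal_zero)
qed

end

lift_definition Uq_gen :: "generator \<Rightarrow> Uq" is gen .
lift_definition Uq_const :: "ratfun \<Rightarrow> Uq" is const .

definition divided_power :: "Uq \<Rightarrow> nat \<Rightarrow> Uq" where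
  "divided_power x n = Uq_const (inverse (qfact n)) * x ^ n"


section \<open>The integral form\<close>

text \<open>The ring of integral Laurent polynomials, as the monoid algebra of the integers.\<close>

type_synonym laurent = "int \<Rightarrow>\<^sub>0 int"

definition laurent_eval :: "laurent \<Rightarrow> 'k::field \<Rightarrow> 'k" where
  "laurent_eval p x = (\<Sum>n \<in> Poly_Mapping.keys p. of_int (Poly_Mapping.lookup p n) * x powi n)"

inductive_set UA_set :: "Uq set" where
  one: "1 \<in> UA_set"
| divided_E: "divided_power (Uq_gen GE) n \<in> UA_set"
| divided_F: "divided_power (Uq_gen GF) n \<in> UA_set"
| K: "Uq_gen GK \<in> UA_set"
| Kinv: "Uq_gen GKinv \<in> UA_set"
| diff: "x \<in> UA_set \<Longrightarrow> y \<in> UA_set \<Longrightarrow> x - y \<in> UA_set"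
| mult: "x \<in> UA_set \<Longrightarrow> y \<in> UA_set \<Longrightarrow> x * y \<in> UA_set"
| smult: "x \<in> UA_set \<Longrightarrow> Uq_const (laurent_eval p qvar) * x \<in> UA_set"

lemma UA_set_zero: "0 \<in> UA_set"
  using UA_set.diff[OF UA_set.one UA_set.one] by simp

lemma UA_set_uminus: "x \<in> UA_set \<Longrightarrow> - x \<in> UA_set"
  using UA_set.diff[OF UA_set_zero] by simp

lemma UA_set_add: "x \<in> UA_set \<Longrightarrow> y \<in> UA_set \<Longrightarrow> x + y \<in> UA_set"
  using UA_set.diff[OF _ UA_set_uminus] by simp

typedef UA = UA_set
  using UA_set.one by blast

setup_lifting type_definition_UA

instantiation UA :: "{ring, monoid_mult}"
begin

lift_definition zero_UA :: UA is 0 by (rule UA_set_zero)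
lift_definition one_UA :: UA is 1 by (rule UA_set.one)
lift_definition plus_UA :: "UA \<Rightarrow> UA \<Rightarrow> UA" is "(+)" by (rule UA_set_add)
lift_definition uminus_UA :: "UA \<Rightarrow> UA" is uminus by (rule UA_set_uminus)
lift_definition minus_UA :: "UA \<Rightarrow> UA \<Rightarrow> UA" is "(-)" by (rule UA_set.diff)
lift_definition times_UA :: "UA \<Rightarrow> UA \<Rightarrow> UA" is "(*)" by (rule UA_set.mult)

instance
  by standard (transfer; simp add: algebra_simps)+

end

lift_definition UA_smult :: "laurent \<Rightarrow> UA \<Rightarrow> UA" is
  "\<lambda>p x. Uq_const (laurent_eval p qvar) * x"
  by (rule UA_set.smult)

lemma qvar_neq_inverse: "qvar \<noteq> inverse qvar"
  by (simp add: qvar_def eq_fract one_pCons)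

lemma divided_power_1: "divided_power x 1 = x"
proof -
  have "Uq_const 1 = 1"
    by transfer (simp add: const_def Uq_rel_def Uq_ideal_zero)
  moreover have "qfact 1 = 1"
    using qvar_neq_inverse by (simp add: qfact_def qint_def power_int_minus)
  ultimately show ?thesis
    by (simp add: divided_power_def)
qed

lift_definition UA_E :: UA is "Uq_gen GE"
  using UA_set.divided_E[of 1] unfolding divided_power_1 .

lift_definition UA_F :: UA is "Uq_gen GF"
  using UA_set.divided_F[of 1] unfolding divided_power_1 .

lift_definition UA_K :: UA is "Uq_gen GK"
  by (rule UA_set.K)


section \<open>Specialisation at a root of unity\<close>

text \<open>
  The tensor product of two rings over a commutative ring is the monoid ring over the integers of
  the monoid of pairs \<open>(u, c)\<close> with componentwise multiplication, modulo the bilinearity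
  relations. The additive subgroup they generate is already a two-sided ideal, so that passing to
  the generated ideal does not identify anything further.
\<close>

datatype ('u, 'c) pure_tensor = Tensor 'u 'c

instantiation pure_tensor :: (monoid_mult, monoid_mult) monoid_add
begin

definition zero_pure_tensor :: "('a, 'b) pure_tensor" where
  "zero_pure_tensor = Tensor 1 1"

fun plus_pure_tensor ::
    "('a, 'b) pure_tensor \<Rightarrow> ('a, 'b) pure_tensor \<Rightarrow> ('a, 'b) pure_tensor" where
  "plus_pure_tensor (Tensor u c) (Tensor v d) = Tensor (u * v) (c * d)"

instance
proof
  fix a b c :: "('a, 'b) pure_tensor"
  show "a + b + c = a + (b + c)" by (cases a; cases b; cases c) (simp add: mult.assoc)
  show "0 + a = a" by (cases a) (simp add: zero_pure_tensor_def)
  show "a + 0 = a" by (cases a) (simp add: zero_pure_tensor_def)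
qed

end

type_synonym 'k pre_tensor = "(UA, 'k) pure_tensor \<Rightarrow>\<^sub>0 int"

definition pure :: "UA \<Rightarrow> 'k::field \<Rightarrow> 'k pre_tensor" where
  "pure u c = Poly_Mapping.single (Tensor u c) 1"

definition tensor_relations :: "'k::field \<Rightarrow> 'k pre_tensor set" where
  "tensor_relations \<zeta> =
     {pure (u + v) c - pure u c - pure v c | u v c. True} \<union>
     {pure u (c + d) - pure u c - pure u d | u c d. True} \<union>
     {pure (UA_smult p u) c - pure u (laurent_eval p \<zeta> * c) | p u c. True}"

definition tensor_ideal :: "'k::field \<Rightarrow> 'k pre_tensor set" where
  "tensor_ideal \<zeta> = genideal ring_of_type_algebra (tensor_relations \<zeta>)"

definition Uhat :: "'k::field \<Rightarrow> 'k pre_tensor set ring" where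
  "Uhat \<zeta> = ring_of_type_algebra Quot tensor_ideal \<zeta>"

definition Uhat_tensor :: "'k::field \<Rightarrow> UA \<Rightarrow> 'k \<Rightarrow> 'k pre_tensor set" where
  "Uhat_tensor \<zeta> u c = tensor_ideal \<zeta> +>\<^bsub>ring_of_type_algebra\<^esub> pure u c"

definition K_ideal :: "nat \<Rightarrow> 'k::field \<Rightarrow> 'k pre_tensor set set" where
  "K_ideal l \<zeta> =
     genideal (Uhat \<zeta>)
       {Uhat_tensor \<zeta> UA_K 1 [^]\<^bsub>Uhat \<zeta>\<^esub> l \<ominus>\<^bsub>Uhat \<zeta>\<^esub> \<one>\<^bsub>Uhat \<zeta>\<^esub>}"

definition Uzeta_tensor :: "nat \<Rightarrow> 'k::field \<Rightarrow> UA \<Rightarrow> 'k \<Rightarrow> 'k pre_tensor set set" where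
  "Uzeta_tensor l \<zeta> u c = K_ideal l \<zeta> +>\<^bsub>Uhat \<zeta>\<^esub> Uhat_tensor \<zeta> u c"

definition Uzeta :: "nat \<Rightarrow> 'k::field \<Rightarrow> ('k, 'k pre_tensor set set) module" where
  "Uzeta l \<zeta> =
     (let Q = Uhat \<zeta> Quot K_ideal l \<zeta>
      in ring.extend Q (module.fields (\<lambda>c x. Uzeta_tensor l \<zeta> 1 c \<otimes>\<^bsub>Q\<^esub> x)))"

text \<open>The small quantum group, a subalgebra of \<^const>\<open>Uzeta\<close>.\<close>

definition small_u :: "nat \<Rightarrow> 'k::field \<Rightarrow> ('k, 'k pre_tensor set set) module" where
  "small_u l \<zeta> =
     (Uzeta l \<zeta>)\<lparr>carrier := subalgebra_generated ring_of_type_algebra (Uzeta l \<zeta>)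
       {Uzeta_tensor l \<zeta> UA_E 1, Uzeta_tensor l \<zeta> UA_F 1, Uzeta_tensor l \<zeta> UA_K 1}\<rparr>"

end

theory Submission
  imports Defs
begin

text \<open>
  Letting an element of \<open>U\<^sub>q\<close> act on \<open>1\<close> turns it into an array of coefficients at the symbols
  \<open>F\<^sup>(\<^sup>a\<^sup>) 1\<^sub>L E\<^sup>(\<^sup>b\<^sup>)\<close>, and for elements of the integral form these coefficients are Laurent
  polynomials. Their values at \<open>\<zeta>\<close> determine an element of \<open>U\<^sub>\<zeta>\<close>, because the elements
  \<open>F\<^sup>(\<^sup>a\<^sup>) K\<^sup>i H\<^sup>j E\<^sup>(\<^sup>b\<^sup>)\<close>, with \<open>i < l\<close> and \<open>H\<close> the divided power of order \<open>l\<close> in the Cartan part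
  (which acts as \<open>\<lfloor>L / l\<rfloor>\<close>), span \<open>U\<^sub>\<zeta>\<close> and have independent arrays.

  On central elements the entry \<open>\<phi>\<close> at \<open>a = b = 0\<close> is multiplicative in every \<open>L\<close>. For a central
  idempotent \<open>f\<close> of \<open>U\<^sub>\<zeta>\<close> the function \<open>\<phi> f\<close> has values in \<open>{0, 1}\<close> and is a polynomial in
  \<open>\<lfloor>L / l\<rfloor>\<close> on each residue class, hence periodic; comparing \<open>f F\<^sup>(\<^sup>n\<^sup>)\<close> with \<open>F\<^sup>(\<^sup>n\<^sup>) f\<close> shows
  that it is invariant under \<open>L \<mapsto> - L - 2\<close>. So some polynomial in the Casimir element has the same
  \<open>\<phi>\<close>, and lifting it to an idempotent gives a central idempotent in \<open>u\<^sub>\<zeta>\<close> which agrees with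
  \<open>f\<close>, since a central idempotent with \<open>\<phi> = 0\<close> lies in every step of a separated filtration. Thus all
  central idempotents of \<open>U\<^sub>\<zeta>\<close> lie in \<open>u\<^sub>\<zeta>\<close>. Conversely those of \<open>u\<^sub>\<zeta>\<close> are central in
  \<open>U\<^sub>\<zeta>\<close>: the commutators with \<open>E\<^sup>(\<^sup>l\<^sup>)\<close> and \<open>F\<^sup>(\<^sup>l\<^sup>)\<close> are derivations of \<open>u\<^sub>\<zeta>\<close>.
\<close>

section \<open>Laurent polynomials and quantum integers\<close>

text \<open>A tensor product given by generators and relations needs a map out of it before anything
  in it can be shown to be nonzero; the arrays supply this map. They are computed over Q(q), where
  division by \<open>[n]\<close> is allowed, and specialised only once integrality is known.
  \<open>L\<close> runs over all integers and not over residues modulo \<open>l\<close>, since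
  \<open>K\<close> alone does not determine \<open>H\<close>.

  The function \<open>\<phi>\<close> is the Harish-Chandra map; it is multiplicative because a
  central element can be moved past \<open>F^(a)\<close>. Its symmetry comes from the singular
  vector of weight \<open>- n - 1\<close> in the Verma module of highest weight
  \<open>n - 1\<close>. Lifting stops after finitely many steps since arrays of the small algebra
  live on \<open>a, b < l\<close>.

  Oddness of \<open>l\<close> makes \<open>\<zeta>^2\<close> of order \<open>l\<close>.
  Characteristic 0 makes the coefficient \<open>s + 1\<close> in
  \<open>E^(ls) E^(l) = (s + 1) E^(ls + l)\<close> invertible, and lets integer values determine a
  polynomial.

  A decomposition of \<open>\<epsilon> U\<close> would split \<open>\<epsilon>\<close> into two
  nonzero idempotents that are central in U_zeta, hence lie in the centre of the small algebra,
  against primitivity.\<close>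

lemma poly_mapping_sum_single:
  "p = (\<Sum>k\<in>Poly_Mapping.keys p. Poly_Mapping.single k (Poly_Mapping.lookup p k))"
proof (rule poly_mapping_eqI)
  fix k
  have "(\<Sum>j\<in>Poly_Mapping.keys p. Poly_Mapping.lookup (Poly_Mapping.single j (Poly_Mapping.lookup p j)) k)
      = (\<Sum>j\<in>Poly_Mapping.keys p. if j = k then Poly_Mapping.lookup p k else 0)"
    by (rule sum.cong) (auto simp: lookup_single when_def)
  then show "Poly_Mapping.lookup p k = Poly_Mapping.lookup
      (\<Sum>k\<in>Poly_Mapping.keys p. Poly_Mapping.single k (Poly_Mapping.lookup p k)) k"
    by (simp add: lookup_sum in_keys_iff)
qed

lemma poly_mapping_add_induct [case_names zero single add]:
  fixes p :: "'a \<Rightarrow>\<^sub>0 'b::comm_monoid_add"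
  assumes "P 0" and s: "\<And>k c. P (Poly_Mapping.single k c)"
    and a: "\<And>p q. P p \<Longrightarrow> P q \<Longrightarrow> P (p + q)"
  shows "P p"
proof -
  have "P (\<Sum>k\<in>S. Poly_Mapping.single k (Poly_Mapping.lookup p k))" if "finite S" for S
    using that by induction (auto intro: assms)
  from this[OF finite_keys] show ?thesis
    by (metis poly_mapping_sum_single)
qed

section \<open>Linear extension from monomials, and evaluation of Laurent polynomials\<close>

definition pm_sum :: "('a \<Rightarrow> 'b \<Rightarrow> 'c) \<Rightarrow> ('a \<Rightarrow>\<^sub>0 'b::zero) \<Rightarrow> 'c::comm_monoid_add" where
  "pm_sum f p = (\<Sum>k\<in>Poly_Mapping.keys p. f k (Poly_Mapping.lookup p k))"

lemma pm_sum_0 [simp]: "pm_sum f 0 = 0"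
  by (simp add: pm_sum_def)

lemma pm_sum_single: "f k 0 = 0 \<Longrightarrow> pm_sum f (Poly_Mapping.single k c) = f k c"
  by (simp add: pm_sum_def)

lemma pm_sum_add:
  assumes "\<And>k. f k 0 = 0" "\<And>k b c. f k (b + c) = f k b + f k c"
  shows "pm_sum f (p + q) = pm_sum f p + pm_sum f q"
proof -
  let ?S = "Poly_Mapping.keys p \<union> Poly_Mapping.keys q"
  have sub: "pm_sum f r = (\<Sum>k\<in>?S. f k (Poly_Mapping.lookup r k))"
    if "Poly_Mapping.keys r \<subseteq> ?S" for r
    unfolding pm_sum_def using that
    by (intro sum.mono_neutral_left) (auto simp: in_keys_iff assms)
  show ?thesis
    by (simp add: sub keys_add lookup_add assms sum.distrib)
qed

lemma laurent_eval_pm_sum: "laurent_eval p x = pm_sum (\<lambda>n c. of_int c * x powi n) p"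
  by (simp add: laurent_eval_def pm_sum_def)

lemma laurent_eval_0 [simp]: "laurent_eval 0 x = 0"
  by (simp add: laurent_eval_def)

lemma laurent_eval_single [simp]:
  "laurent_eval (Poly_Mapping.single n c) x = of_int c * x powi n"
  by (simp add: laurent_eval_pm_sum pm_sum_single)

lemma laurent_eval_1 [simp]: "laurent_eval 1 x = 1"
  using laurent_eval_single[of 0 1 x] by simp

lemma laurent_eval_add: "laurent_eval (p + q) x = laurent_eval p x + laurent_eval q x"
  unfolding laurent_eval_pm_sum by (rule pm_sum_add) (auto simp: algebra_simps)

lemma laurent_eval_uminus: "laurent_eval (- p) x = - laurent_eval p x"
  using laurent_eval_add[of p "- p" x] by (simp add: eq_neg_iff_add_eq_0 add.commute)

lemma laurent_eval_diff: "laurent_eval (p - q) x = laurent_eval p x - laurent_eval q x"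
  using laurent_eval_add[of p "- q" x] by (simp add: laurent_eval_uminus)

lemma laurent_eval_mult:
  assumes "x \<noteq> 0"
  shows "laurent_eval (p * q) x = laurent_eval p x * laurent_eval q x"
proof (induction p rule: poly_mapping_add_induct)
  case (single k c)
  show ?case
  proof (induction q rule: poly_mapping_add_induct)
    case (single j d)
    show ?case using assms by (simp add: mult_single power_int_add)
  qed (simp_all add: algebra_simps laurent_eval_add)
qed (simp_all add: algebra_simps laurent_eval_add)

lemma powi_cancel: "x \<noteq> 0 \<Longrightarrow> x powi n * (x powi (- n) * y) = (y :: 'a::field)"
  by (simp add: power_int_minus)

lemma qvar_power: "qvar ^ n = Fraction_Field.Fract (monom 1 n) 1"
proof (induction n)
  case 0
  then show ?case by (simp add: One_fract_def)
next
  case (Suc n)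
  then show ?case by (simp add: qvar_def mult_monom monom_Suc)
qed

lemma of_int_ratfun: "(of_int c :: ratfun) = Fraction_Field.Fract [:of_int c:] 1"
proof -
  have n: "(of_nat n :: ratfun) = Fraction_Field.Fract [:of_nat n:] 1" for n
    by (induction n) (auto simp: One_fract_def Zero_fract_def one_pCons)
  have u: "(of_int (- int k) :: ratfun) = Fraction_Field.Fract [:of_int (- int k):] 1" for k
    unfolding of_int_minus of_int_of_nat_eq n minus_fract by simp
  show ?thesis
    by (cases c rule: int_cases2) (simp_all only: n u of_int_of_nat_eq)
qed

lemma qvar_nonzero [simp]: "qvar \<noteq> 0"
  by (simp add: qvar_def eq_fract Zero_fract_def)

text \<open>Multiplying by \<open>qvar powi (- N)\<close>, with \<open>N\<close> the least exponent,
  clears the negative powers. The constant coefficient of the resulting polynomial is the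
  coefficient of \<open>p\<close> at \<open>N\<close>, nonzero by the choice of
  \<open>N\<close>.\<close>

lemma laurent_eval_qvar_eq_0:
  assumes "laurent_eval p qvar = 0"
  shows "p = 0"
proof (rule ccontr)
  assume "p \<noteq> 0"
  let ?K = "Poly_Mapping.keys p" and ?c = "Poly_Mapping.lookup p"
  define N where "N = Min ?K"
  have fin: "finite ?K" and ne: "?K \<noteq> {}" using \<open>p \<noteq> 0\<close> by auto
  have N: "N \<in> ?K" "\<And>n. n \<in> ?K \<Longrightarrow> N \<le> n"
    using fin ne by (auto simp: N_def)
  define P :: "rat poly" where "P = (\<Sum>n\<in>?K. monom (of_int (?c n)) (nat (n - N)))"
  have sumF: "(\<Sum>n\<in>S. Fraction_Field.Fract (g n) 1) = Fraction_Field.Fract (\<Sum>n\<in>S. g n) 1" if "finite S"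
    for S and g :: "int \<Rightarrow> rat poly"
    using that by induction (auto simp: Zero_fract_def)
  have "0 = laurent_eval p qvar * qvar powi (- N)" using assms by simp
  also have "\<dots> = (\<Sum>n\<in>?K. of_int (?c n) * qvar powi (n - N))"
    unfolding laurent_eval_def sum_distrib_right
    by (rule sum.cong) (auto simp: mult.assoc simp flip: power_int_add)
  also have "\<dots> = (\<Sum>n\<in>?K. Fraction_Field.Fract (monom (of_int (?c n)) (nat (n - N))) 1)"
  proof (rule sum.cong)
    fix n assume "n \<in> ?K"
    then have "qvar powi (n - N) = qvar ^ nat (n - N)"
      using N(2)[of n] by (simp add: power_int_def)
    then show "of_int (?c n) * qvar powi (n - N)
        = Fraction_Field.Fract (monom (of_int (?c n)) (nat (n - N))) 1"
      by (simp add: qvar_power of_int_ratfun smult_monom)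
  qed simp
  also have "\<dots> = Fraction_Field.Fract P 1" by (simp add: P_def sumF fin)
  finally have "P = 0" by (simp add: Zero_fract_def eq_fract)
  then have "coeff P 0 = 0" by simp
  moreover have "coeff P 0 = (\<Sum>n\<in>?K. if n = N then of_int (?c n) else 0)"
    unfolding P_def coeff_sum by (rule sum.cong) (auto dest: N(2))
  ultimately have "?c N = 0" using N(1) fin by simp
  then show False using N(1) by (simp add: in_keys_iff)
qed

lemma laurent_eval_qvar_inj: "laurent_eval p qvar = laurent_eval r qvar \<longleftrightarrow> p = r"
  using laurent_eval_qvar_eq_0[of "p - r"] by (auto simp: laurent_eval_diff)

lemma qvar_powi_eq_1_iff: "qvar powi n = 1 \<longleftrightarrow> n = 0"
proof
  assume "qvar powi n = 1"
  then have "laurent_eval (Poly_Mapping.single n 1) qvar = laurent_eval 1 qvar" by simp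
  then show "n = 0"
    unfolding laurent_eval_qvar_inj by (metis single_one inj_single inj_eq keys_single keys_one zero_neq_one singleton_inject)
qed simp

section \<open>Integral elements of the function field and their values at a point\<close>

definition integral_ratfun :: "ratfun set" where
  "integral_ratfun = range (\<lambda>p. laurent_eval p qvar)"

text \<open>A Laurent polynomial is determined by its value at \<open>qvar\<close>, so on
  \<open>integral_ratfun\<close> this is, for nonzero \<open>z\<close>, the ring homomorphism q ->
  z. Elsewhere the value is arbitrary, which is why integrality is carried along as a side
  condition.\<close>

definition sp :: "'k::field \<Rightarrow> ratfun \<Rightarrow> 'k" where
  "sp z x = laurent_eval (THE p. laurent_eval p qvar = x) z"

lemma sp_laurent_eval [simp]: "sp z (laurent_eval p qvar) = laurent_eval p z"
  by (simp add: sp_def laurent_eval_qvar_inj)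

lemma integral_laurent_eval [simp]: "laurent_eval p qvar \<in> integral_ratfun"
  by (simp add: integral_ratfun_def)

lemma integral_closed:
  assumes "x \<in> integral_ratfun" "y \<in> integral_ratfun"
  shows integral_add: "x + y \<in> integral_ratfun" and integral_diff: "x - y \<in> integral_ratfun"
    and integral_mult: "x * y \<in> integral_ratfun"
proof -
  obtain p r where *: "x = laurent_eval p qvar" "y = laurent_eval r qvar"
    using assms by (auto simp: integral_ratfun_def)
  show "x + y \<in> integral_ratfun" unfolding * by (simp flip: laurent_eval_add)
  show "x - y \<in> integral_ratfun" unfolding * by (simp flip: laurent_eval_diff)
  show "x * y \<in> integral_ratfun" unfolding * by (simp flip: laurent_eval_mult)
qed

lemma integral_uminus: "x \<in> integral_ratfun \<Longrightarrow> - x \<in> integral_ratfun"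
  unfolding integral_ratfun_def by (auto simp flip: laurent_eval_uminus)

lemma integral_powi [simp]: "qvar powi n \<in> integral_ratfun"
  using integral_laurent_eval[of "Poly_Mapping.single n 1"] by (simp del: integral_laurent_eval)

lemma integral_0 [simp]: "0 \<in> integral_ratfun"
  using integral_laurent_eval[of 0] by (simp del: integral_laurent_eval)

lemma integral_1 [simp]: "1 \<in> integral_ratfun"
  using integral_laurent_eval[of 1] by (simp del: integral_laurent_eval)

lemma sp_closed:
  assumes "x \<in> integral_ratfun" "y \<in> integral_ratfun"
  shows sp_add: "sp z (x + y) = sp z x + sp z y" and sp_diff: "sp z (x - y) = sp z x - sp z y"
    and sp_mult: "z \<noteq> 0 \<Longrightarrow> sp z (x * y) = sp z x * sp z y"
proof -
  obtain p r where *: "x = laurent_eval p qvar" "y = laurent_eval r qvar"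
    using assms by (auto simp: integral_ratfun_def)
  show "sp z (x + y) = sp z x + sp z y"
    unfolding * by (metis laurent_eval_add sp_laurent_eval)
  show "sp z (x - y) = sp z x - sp z y"
    unfolding * by (metis laurent_eval_diff sp_laurent_eval)
  assume "z \<noteq> 0"
  then show "sp z (x * y) = sp z x * sp z y"
    unfolding * by (metis laurent_eval_mult qvar_nonzero sp_laurent_eval)
qed

lemma sp_powi [simp]: "sp z (qvar powi n) = z powi n"
  using sp_laurent_eval[of z "Poly_Mapping.single n 1"] by (simp del: sp_laurent_eval)

lemma sp_0 [simp]: "sp z 0 = 0"
  using sp_laurent_eval[of z 0] by (simp del: sp_laurent_eval)

lemma sp_1 [simp]: "sp z 1 = 1"
  using sp_laurent_eval[of z 1] by (simp del: sp_laurent_eval)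

text \<open>The quantum integer over any field, so that \<open>qi qvar\<close> and
  \<open>qi \<zeta>\<close> obey the same identities. The argument is an integer because weights can
  be negative.\<close>

definition qi :: "'a::field \<Rightarrow> int \<Rightarrow> 'a" where
  "qi x n = (x powi n - x powi (- n)) / (x - inverse x)"

lemma qi_0 [simp]: "qi x 0 = 0"
  by (simp add: qi_def)

lemma qi_uminus: "qi x (- n) = - qi x n"
  unfolding qi_def minus_divide_left by simp

lemma qi_1 [simp]: "x \<noteq> inverse x \<Longrightarrow> qi x 1 = 1"
  by (simp add: qi_def power_int_minus)

lemma qi_mult: "x \<noteq> inverse x \<Longrightarrow> qi x n * (x - inverse x) = x powi n - x powi (- n)"
  by (simp add: qi_def)

lemma qi_add:
  assumes "x \<noteq> 0" "x \<noteq> inverse x"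
  shows "qi x (m + n) = x powi n * qi x m + x powi (- m) * qi x n"
proof -
  have "qi x (m + n) * (x - inverse x)
      = (x powi n * qi x m + x powi (- m) * qi x n) * (x - inverse x)"
    using assms by (simp add: distrib_right mult.assoc qi_mult)
       (simp add: algebra_simps assms power_int_add power_int_diff power_int_minus divide_inverse)
  with assms show ?thesis by simp
qed

lemma qi_eq_0_iff:
  assumes "x \<noteq> 0" "x \<noteq> inverse x"
  shows "qi x n = 0 \<longleftrightarrow> x powi (2 * n) = 1"
proof -
  have "qi x n = 0 \<longleftrightarrow> x powi n = x powi (- n)"
    using assms by (simp add: qi_def)
  also have "\<dots> \<longleftrightarrow> x powi n * x powi n = 1"
    using assms by (auto simp: power_int_minus field_simps)
  finally show ?thesis by (simp add: power_int_add[symmetric] assms)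
qed

lemma qint_eq: "qint n = qi qvar (int n)"
  by (simp add: qint_def qi_def)

lemma qi_qvar_eq_0_iff: "qi qvar n = 0 \<longleftrightarrow> n = 0"
  using qi_eq_0_iff[OF qvar_nonzero qvar_neq_inverse, of n] by (simp add: qvar_powi_eq_1_iff)

lemma integral_qi [simp]: "qi qvar n \<in> integral_ratfun"
proof -
  have nat: "qi qvar (int m) \<in> integral_ratfun" for m
  proof (induction m)
    case (Suc m)
    have "qi qvar (int (Suc m)) = qvar powi 1 * qi qvar (int m) + qvar powi (- int m) * qi qvar 1"
      using qi_add[OF qvar_nonzero qvar_neq_inverse, of "int m" 1] by (simp add: add.commute)
    then show ?case
      using Suc qi_1[OF qvar_neq_inverse] by (auto intro!: integral_closed simp del: power_int_1_right)
  qed simp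
  show ?thesis
    by (cases n rule: int_cases2) (auto simp: nat qi_uminus intro: integral_uminus)
qed

text \<open>\<open>qi qvar n\<close> is a quotient, while \<open>sp\<close> is only known to respect
  sums, differences and products. So its defining equation is multiplied by q - 1/q, specialised,
  and divided by z - 1/z again.\<close>

lemma sp_qi:
  assumes "z \<noteq> 0" "z \<noteq> inverse z"
  shows "sp z (qi qvar n) = qi z n"
proof -
  let ?d = "qvar powi 1 - qvar powi (-1)"
  have "qi qvar n * ?d = qvar powi n - qvar powi (- n)"
    using qi_mult[OF qvar_neq_inverse, of n] by (simp only: power_int_minus power_int_1_right)
  then have "sp z (qi qvar n) * sp z ?d = sp z (qvar powi n - qvar powi (- n))"
    using sp_mult[of "qi qvar n" ?d z] assms(1)
    by (simp only: integral_qi integral_diff integral_powi simp_thms)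
  moreover have "sp z (qvar powi m - qvar powi (- m)) = z powi m - z powi (- m)" for m
    by (simp only: sp_diff integral_powi sp_powi)
  moreover have "qi z n * (z powi 1 - z powi (-1)) = z powi n - z powi (- n)"
    using qi_mult[OF assms(2), of n] by (simp only: power_int_minus power_int_1_right)
  ultimately have "sp z (qi qvar n) * (z powi 1 - z powi (-1)) = qi z n * (z powi 1 - z powi (-1))"
    by metis
  then show ?thesis using assms(2) by (simp add: power_int_minus)
qed

text \<open>The Gaussian binomial with an arbitrary integer on top, since weights may be negative.
  The quotients hide that it is a Laurent polynomial; see \<open>integral_qb\<close>.\<close>

definition qb :: "int \<Rightarrow> nat \<Rightarrow> ratfun" where
  "qb L t = (\<Prod>i<t. qi qvar (L - int i) / qi qvar (int (Suc i)))"

lemma qb_0 [simp]: "qb L 0 = 1"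
  by (simp add: qb_def)

lemma qb_Suc: "qb L (Suc t) * qi qvar (int (Suc t)) = qb L t * qi qvar (L - int t)"
  by (simp add: qb_def qi_qvar_eq_0_iff del: of_nat_Suc)

lemma qb_Suc_shift: "qb (L + 1) (Suc t) * qi qvar (int (Suc t)) = qi qvar (L + 1) * qb L t"
proof (induction t)
  case 0
  then show ?case by (simp add: qb_def qi_1[OF qvar_neq_inverse])
next
  case (Suc t)
  have nz: "qi qvar (int (Suc t)) \<noteq> 0" by (simp add: qi_qvar_eq_0_iff)
  have step: "qb (L + 1) (Suc (Suc t)) * qi qvar (int (Suc (Suc t))) = qb (L + 1) (Suc t) * qi qvar (L - int t)"
    using qb_Suc[of "L + 1" "Suc t"] by (simp add: algebra_simps)
  have "qb (L + 1) (Suc (Suc t)) * qi qvar (int (Suc (Suc t))) * qi qvar (int (Suc t))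
      = (qb (L + 1) (Suc t) * qi qvar (int (Suc t))) * qi qvar (L - int t)"
    unfolding step by (simp only: mult_ac)
  also have "\<dots> = qi qvar (L + 1) * (qb L t * qi qvar (L - int t))"
    unfolding Suc by (simp only: mult_ac)
  also have "\<dots> = qi qvar (L + 1) * qb L (Suc t) * qi qvar (int (Suc t))"
    unfolding qb_Suc[symmetric] by (simp only: mult_ac)
  finally show ?case using nz by simp
qed

text \<open>After multiplication by \<open>[t + 1]\<close> what remains is \<open>qi_add\<close> for
  the splitting L + 1 = (t + 1) + (L - t).\<close>

lemma qb_Pascal:
  "qb (L + 1) (Suc t) = qvar powi (- int (Suc t)) * qb L (Suc t) + qvar powi (L - int t) * qb L t"
proof -
  have nz: "qi qvar (int (Suc t)) \<noteq> 0" by (simp add: qi_qvar_eq_0_iff)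
  have "(qvar powi (- int (Suc t)) * qb L (Suc t) + qvar powi (L - int t) * qb L t) * qi qvar (int (Suc t))
     = qb L t * (qvar powi (- int (Suc t)) * qi qvar (L - int t) + qvar powi (L - int t) * qi qvar (int (Suc t)))"
    unfolding distrib_right mult.assoc qb_Suc by (simp add: algebra_simps)
  also have "\<dots> = qb L t * qi qvar (L + 1)"
    using qi_add[OF qvar_nonzero qvar_neq_inverse, of "int (Suc t)" "L - int t"] 
    by (simp add: algebra_simps)
  also have "\<dots> = qb (L + 1) (Suc t) * qi qvar (int (Suc t))"
    unfolding qb_Suc_shift by simp
  finally show ?thesis using nz by simp
qed

lemma qb_zero_left [simp]: "qb 0 (Suc t) = 0"
  by (simp add: qb_def prod.lessThan_Suc_shift del: prod.lessThan_Suc)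

lemma qb_eq_0: "n < t \<Longrightarrow> qb (int n) t = 0"
  unfolding qb_def by (rule prod_zero) (auto intro!: bexI[of _ n])

lemma qb_diag [simp]: "qb (int n) n = 1"
proof (induction n)
  case (Suc n)
  then show ?case using qb_Pascal[of "int n" n] by (simp add: qb_eq_0 add.commute)
qed simp

text \<open>Pascal's rule has integral coefficients and a unit in front of
  \<open>qb L (Suc t)\<close>, so it carries integrality from L = 0, where the value is 0, both
  upwards and downwards.\<close>

lemma integral_qb [simp]: "qb L t \<in> integral_ratfun"
proof (induction t arbitrary: L)
  case (Suc t)
  show ?case
  proof (induction L rule: int_induct[of _ 0])
    case (step1 i)
    then show ?case unfolding qb_Pascal by (auto intro!: integral_closed Suc)
  next
    case (step2 i)
    have "qb (i - 1) (Suc t) = qvar powi (int (Suc t)) *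
        (qb (i - 1 + 1) (Suc t) - qvar powi (i - 1 - int t) * qb (i - 1) t)"
      unfolding qb_Pascal by (simp only: add_diff_cancel_right' powi_cancel qvar_nonzero not_False_eq_True)
    with step2 show ?case by (auto intro!: integral_closed Suc)
  qed simp
qed simp

lemma qfact_0 [simp]: "qfact 0 = 1"
  by (simp add: qfact_def)

lemma qfact_Suc: "qfact (Suc n) = qi qvar (int (Suc n)) * qfact n"
  by (simp add: qfact_def qint_eq del: of_nat_Suc)

lemma qfact_nonzero [simp]: "qfact n \<noteq> 0"
  by (induction n) (auto simp: qfact_Suc qi_qvar_eq_0_iff)

lemma qb_add_qfact: "qb (int (m + n)) n * qfact m * qfact n = qfact (m + n)"
proof (induction n)
  case (Suc n)
  have "qb (int (m + Suc n)) (Suc n) * qfact m * qfact (Suc n)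
     = (qb (int (m + n) + 1) (Suc n) * qi qvar (int (Suc n))) * qfact m * qfact n"
    by (simp add: qfact_Suc add.commute mult_ac)
  also have "\<dots> = qi qvar (int (m + n) + 1) * (qb (int (m + n)) n * qfact m * qfact n)"
    unfolding qb_Suc_shift by (simp add: mult_ac)
  also have "\<dots> = qfact (m + Suc n)"
    unfolding Suc by (simp add: qfact_Suc add.commute)
  finally show ?case .
qed simp

section \<open>Commutation relations in the quantum group\<close>

abbreviation uE where "uE \<equiv> Uq_gen GE"
abbreviation uF where "uF \<equiv> Uq_gen GF"
abbreviation uK where "uK \<equiv> Uq_gen GK"
abbreviation uKi where "uKi \<equiv> Uq_gen GKinv"
abbreviation dE where "dE \<equiv> divided_power uE"
abbreviation dF where "dF \<equiv> divided_power uF"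

section \<open>Scalars and divided powers\<close>

lemma const_commute: "const c * x = x * const c"
proof (induction x rule: poly_mapping_add_induct)
  case (single k d)
  then show ?case by (simp add: const_def mult_single mult.commute)
qed (simp_all add: algebra_simps)

lemma Uq_const_add: "Uq_const (c + d) = Uq_const c + Uq_const d"
  by transfer (simp add: const_def single_add Uq_rel_def Uq_ideal_zero)

lemma Uq_const_mult: "Uq_const (c * d) = Uq_const c * Uq_const d"
  by transfer (simp add: const_def mult_single Uq_rel_def Uq_ideal_zero)

lemma Uq_const_1: "Uq_const 1 = 1"
  by transfer (simp add: const_def Uq_rel_def Uq_ideal_zero)

lemma Uq_const_commute: "x * Uq_const c = Uq_const c * x"
  by transfer (simp add: const_commute Uq_rel_def Uq_ideal_zero)

definition scl :: "ratfun \<Rightarrow> Uq \<Rightarrow> Uq" where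
  "scl c x = Uq_const c * x"

interpretation scl: vector_space scl
  by unfold_locales
    (simp_all add: scl_def distrib_left distrib_right Uq_const_add Uq_const_mult Uq_const_1 mult.assoc)

lemma scl_mult_left [simp]: "scl c x * y = scl c (x * y)"
  by (simp add: scl_def mult.assoc)

lemma scl_mult_right [simp]: "x * scl c y = scl c (x * y)"
  by (metis mult.assoc scl_def Uq_const_commute)

declare scl.scale_scale [simp]

lemma divided_power_scl: "divided_power x n = scl (inverse (qfact n)) (x ^ n)"
  by (simp add: divided_power_def scl_def)

lemma divided_power_0 [simp]: "divided_power x 0 = 1"
  by (simp add: divided_power_scl)

lemma divided_power_Suc_left:
  "x * divided_power x n = scl (qi qvar (int (Suc n))) (divided_power x (Suc n))"
  by (simp add: divided_power_scl qfact_Suc qi_qvar_eq_0_iff del: of_nat_Suc)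

lemma divided_power_Suc_right:
  "divided_power x n * x = scl (qi qvar (int (Suc n))) (divided_power x (Suc n))"
  by (simp add: divided_power_scl qfact_Suc qi_qvar_eq_0_iff power_commutes del: of_nat_Suc)

lemma divided_power_mult:
  "divided_power x m * divided_power x n = scl (qb (int (m + n)) n) (divided_power x (m + n))"
proof -
  have "qb (int (m + n)) n * inverse (qfact (m + n)) = inverse (qfact m) * inverse (qfact n)"
    using qb_add_qfact[of m n] by (simp add: field_simps)
  then show ?thesis
    by (simp add: divided_power_scl power_add mult.commute)
qed

section \<open>Commutation of the generators and the Cartan binomials\<close>

lemma Uq_relationI: "x - y \<in> Uq_relations \<Longrightarrow> Uq_rel x y"
proof -
  have "Uq_relations \<subseteq> Uq_ideal"
    unfolding Uq_ideal_def by (rule ring.genideal_self[OF ring_ring_of_type_algebra]) simp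
  then show "x - y \<in> Uq_relations \<Longrightarrow> Uq_rel x y" by (auto simp: Uq_rel_def)
qed

lemma K_Kinv [simp]: "uK * uKi = 1" "uKi * uK = 1"
  by (transfer, rule Uq_relationI, simp add: Uq_relations_def)+

lemma K_Kinv_left [simp]: "uK * (uKi * x) = x" "uKi * (uK * x) = x"
  by (simp_all flip: mult.assoc)

lemma KE: "uK * uE = scl (qvar powi 2) (uE * uK)"
proof -
  have "uK * uE * uKi = scl (qvar powi 2) uE"
    unfolding scl_def by (transfer, rule Uq_relationI, simp add: Uq_relations_def)
  then have "uK * uE * uKi * uK = scl (qvar powi 2) uE * uK" by simp
  then show ?thesis by (simp add: mult.assoc)
qed

lemma KF: "uK * uF = scl (qvar powi (-2)) (uF * uK)"
proof -
  have "uK * uF * uKi = scl (qvar powi (-2)) uF"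
    unfolding scl_def by (transfer, rule Uq_relationI, simp add: Uq_relations_def)
  then have "uK * uF * uKi * uK = scl (qvar powi (-2)) uF * uK" by simp
  then show ?thesis by (simp add: mult.assoc)
qed

lemma KiE: "uKi * uE = scl (qvar powi (-2)) (uE * uKi)"
proof -
  have "uKi * (uK * uE) * uKi = uKi * scl (qvar powi 2) (uE * uK) * uKi" by (simp add: KE)
  then have "uE * uKi = scl (qvar powi 2) (uKi * uE)" by (simp add: mult.assoc)
  then show ?thesis by (simp add: power_int_minus)
qed

lemma KiF: "uKi * uF = scl (qvar powi 2) (uF * uKi)"
proof -
  have "uKi * (uK * uF) * uKi = uKi * scl (qvar powi (-2)) (uF * uK) * uKi" by (simp add: KF)
  then have "uF * uKi = scl (qvar powi (-2)) (uKi * uF)" by (simp add: mult.assoc)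
  then show ?thesis by (simp add: power_int_minus)
qed

text \<open>Lusztig's \<open>[K; c]\<close>; it acts on weight \<open>L\<close> as the quantum
  integer \<open>[L + c]\<close>.\<close>

definition Kb :: "int \<Rightarrow> Uq" where
  "Kb c = scl (inverse (qvar - inverse qvar)) (scl (qvar powi c) uK - scl (qvar powi (- c)) uKi)"

lemma EF: "uE * uF = uF * uE + Kb 0"
proof -
  have "uE * uF - uF * uE = Uq_const (inverse (qvar - inverse qvar)) * (uK - uKi)"
    by (transfer, rule Uq_relationI, simp add: Uq_relations_def)
  then show ?thesis by (simp add: Kb_def scl_def[symmetric] diff_eq_eq add.commute)
qed

lemma powi_shift: "x \<noteq> 0 \<Longrightarrow> x powi a * x powi b = (x::'a::field) powi (a + b)"
  by (simp add: power_int_add)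

lemma Kb_E: "Kb c * uE = uE * Kb (c + 2)"
  by (simp only: Kb_def left_diff_distrib right_diff_distrib scl_mult_left scl_mult_right
      scl.scale_right_diff_distrib scl.scale_scale KE KiE mult.assoc powi_shift[OF qvar_nonzero])
    (simp add: algebra_simps)

lemma Kb_F: "Kb c * uF = uF * Kb (c - 2)"
  by (simp only: Kb_def left_diff_distrib right_diff_distrib scl_mult_left scl_mult_right
      scl.scale_right_diff_distrib scl.scale_scale KF KiF mult.assoc powi_shift[OF qvar_nonzero])
    (simp add: algebra_simps)

lemma Kb_commute: "Kb a * Kb b = Kb b * Kb a"
  by (simp add: Kb_def left_diff_distrib right_diff_distrib scl.scale_right_diff_distrib mult.commute)

lemma K_Kb: "uK * Kb b = Kb b * uK"
  by (simp add: Kb_def left_diff_distrib right_diff_distrib)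

text \<open>This is \<open>[N][M] = [N - t][M - t] + [t][M + N - t]\<close> with \<open>K q\<^sup>M\<close> in the place of \<open>q\<^sup>M\<close>.\<close>

lemma Kb_split:
  "scl (qi qvar N) (Kb M) = scl (qi qvar (N - t)) (Kb (M - t)) + scl (qi qvar t) (Kb (M + N - t))"
proof -
  let ?d = "qvar - inverse qvar"
  have d: "?d \<noteq> 0" using qvar_neq_inverse by simp
  have 1: "qi qvar N * qvar powi M = qi qvar (N - t) * qvar powi (M - t) + qi qvar t * qvar powi (M + N - t)" for M N t
  proof -
    have "qi qvar N = qvar powi (N - t) * qi qvar t + qvar powi (- t) * qi qvar (N - t)"
      using qi_add[OF qvar_nonzero qvar_neq_inverse, of t "N - t"] by simp
    then have "qi qvar N * qvar powi M
        = (qvar powi (N - t) * qvar powi M) * qi qvar t + (qvar powi (- t) * qvar powi M) * qi qvar (N - t)"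
      by (simp add: algebra_simps)
    then show ?thesis by (simp add: powi_shift algebra_simps)
  qed
  have 2: "qi qvar N * qvar powi (- M) = qi qvar (N - t) * qvar powi (- (M - t)) + qi qvar t * qvar powi (- (M + N - t))"
    using 1[of "- N" "- M" "- t"] qi_uminus[of qvar "N - t"] by (simp add: qi_uminus algebra_simps)
  have "scl (qi qvar N) (Kb M) = scl (inverse ?d) (scl (qi qvar N * qvar powi M) uK - scl (qi qvar N * qvar powi (- M)) uKi)"
    by (simp add: Kb_def scl.scale_right_diff_distrib mult_ac)
  also have "\<dots> = scl (qi qvar (N - t)) (Kb (M - t)) + scl (qi qvar t) (Kb (M + N - t))"
    unfolding 1[of N M t] 2
    by (simp only: Kb_def scl.scale_right_diff_distrib scl.scale_right_distrib scl.scale_left_distrib scl.scale_scale)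
      (simp add: mult_ac)
  finally show ?thesis .
qed

text \<open>Lusztig's binomial \<open>[K; c choose t]\<close>. It lies in the integral form in spite
  of the division in each step; this is \<open>kb_UA\<close>.\<close>

primrec kb :: "int \<Rightarrow> nat \<Rightarrow> Uq" where
  "kb c 0 = 1"
| "kb c (Suc t) = scl (inverse (qi qvar (int (Suc t)))) (kb c t * Kb (c - int t))"

lemma kb_Suc_scl: "scl (qi qvar (int (Suc t))) (kb c (Suc t)) = kb c t * Kb (c - int t)"
  by (simp add: qi_qvar_eq_0_iff del: of_nat_Suc)

declare kb.simps(2) [simp del]

lemma kb_E: "kb c t * uE = uE * kb (c + 2) t"
proof (induction t)
  case (Suc t)
  have "kb c t * Kb (c - int t) * uE = kb c t * uE * Kb (c - int t + 2)"
    by (simp add: mult.assoc Kb_E)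
  then show ?case unfolding kb.simps(2) scl_mult_left scl_mult_right Suc
    by (simp add: mult.assoc algebra_simps)
qed simp

lemma kb_F: "kb c t * uF = uF * kb (c - 2) t"
proof (induction t)
  case (Suc t)
  have "kb c t * Kb (c - int t) * uF = kb c t * uF * Kb (c - int t - 2)"
    by (simp add: mult.assoc Kb_F)
  then show ?case unfolding kb.simps(2) scl_mult_left scl_mult_right Suc
    by (simp add: mult.assoc algebra_simps)
qed simp

lemma kb_Kb: "kb c t * Kb b = Kb b * kb c t"
proof (induction t)
  case (Suc t)
  have "kb c t * Kb (c - int t) * Kb b = Kb b * (kb c t * Kb (c - int t))"
    by (metis Kb_commute Suc mult.assoc)
  then show ?case by (simp add: kb.simps(2) del: of_nat_Suc)
qed simp

lemma K_kb: "uK * kb c t = kb c t * uK"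
proof (induction t)
  case (Suc t)
  have "uK * (kb c t * Kb (c - int t)) = kb c t * Kb (c - int t) * uK"
    by (metis K_Kb Suc mult.assoc)
  then show ?case by (simp add: kb.simps(2) del: of_nat_Suc)
qed simp

lemma scl_cancel: "c \<noteq> 0 \<Longrightarrow> scl c x = scl c y \<longleftrightarrow> x = y"
  by simp

lemma qi_Suc_nonzero [simp]: "qi qvar (int (Suc t)) \<noteq> 0"
  by (simp add: qi_qvar_eq_0_iff)

lemma kb_Suc_shift: "scl (qi qvar (int (Suc t))) (kb (c + 1) (Suc t)) = Kb (c + 1) * kb c t"
proof (induction t)
  case 0
  then show ?case using kb_Suc_scl[of 0 "c + 1"] by simp
next
  case (Suc t)
  have "scl (qi qvar (int (Suc t))) (scl (qi qvar (int (Suc (Suc t)))) (kb (c + 1) (Suc (Suc t))))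
     = scl (qi qvar (int (Suc t))) (kb (c + 1) (Suc t)) * Kb (c - int t)"
    using kb_Suc_scl[of "Suc t" "c + 1"] by simp
  also have "\<dots> = Kb (c + 1) * (kb c t * Kb (c - int t))"
    unfolding Suc by (simp only: mult.assoc)
  also have "\<dots> = scl (qi qvar (int (Suc t))) (Kb (c + 1) * kb c (Suc t))"
    unfolding kb_Suc_scl[symmetric] by simp
  finally show ?case by (simp only: scl_cancel qi_Suc_nonzero not_False_eq_True)
qed

text \<open>\<open>qb_Pascal\<close> with \<open>K\<close> times q^c in the place of q^L, whence the
  extra factor \<open>K\<close> in the second term.\<close>

lemma kb_Pascal:
  "kb (c + 1) (Suc t) = scl (qvar powi (- int (Suc t))) (kb c (Suc t)) + scl (qvar powi (c - int t)) (uK * kb c t)"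
proof -
  let ?i = "inverse (qvar - inverse qvar)"
  \<comment> \<open>Cancelling \<open>[t + 1]\<close> and the common factor \<open>kb c t\<close>
    leaves this linear relation between \<open>K\<close> and its inverse.\<close>
  have e: "scl (qvar powi (- int (Suc t))) (Kb (c - int t)) + scl (qi qvar (int (Suc t)) * qvar powi (c - int t)) uK
     = Kb (c + 1)"
  proof -
    have "qvar powi (- int (Suc t)) * qvar powi (c - int t) * ?i + qi qvar (int (Suc t)) * qvar powi (c - int t)
      = (qvar powi (- int (Suc t)) * qvar powi (c - int t) + qvar powi (int (Suc t)) * qvar powi (c - int t)
        - qvar powi (- int (Suc t)) * qvar powi (c - int t)) * ?i"
      unfolding qi_def divide_inverse by (simp add: algebra_simps)
    also have "\<dots> = qvar powi (c + 1) * ?i" by (simp add: powi_shift add.commute)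
    finally have k: "qvar powi (- int (Suc t)) * qvar powi (c - int t) * ?i + qi qvar (int (Suc t)) * qvar powi (c - int t)
        = qvar powi (c + 1) * ?i" .
    have ki: "qvar powi (- int (Suc t)) * qvar powi (- (c - int t)) * ?i = qvar powi (- (c + 1)) * ?i"
      by (simp add: powi_shift algebra_simps)
    have "scl (qvar powi (- int (Suc t))) (Kb (c - int t)) + scl (qi qvar (int (Suc t)) * qvar powi (c - int t)) uK
      = scl (qvar powi (- int (Suc t)) * qvar powi (c - int t) * ?i + qi qvar (int (Suc t)) * qvar powi (c - int t)) uK
       - scl (qvar powi (- int (Suc t)) * qvar powi (- (c - int t)) * ?i) uKi"
      by (simp only: Kb_def scl.scale_right_diff_distrib scl.scale_left_distrib scl.scale_scale)
        (simp add: mult_ac del: of_nat_Suc)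
    also have "\<dots> = Kb (c + 1)"
      unfolding k ki by (simp add: Kb_def scl.scale_right_diff_distrib mult.commute)
    finally show ?thesis .
  qed
  have "scl (qi qvar (int (Suc t))) (scl (qvar powi (- int (Suc t))) (kb c (Suc t)) + scl (qvar powi (c - int t)) (uK * kb c t))
     = scl (qvar powi (- int (Suc t))) (scl (qi qvar (int (Suc t))) (kb c (Suc t))) + scl (qi qvar (int (Suc t)) * qvar powi (c - int t)) (uK * kb c t)"
    by (simp only: scl.scale_right_distrib scl.scale_scale mult.commute)
  also have "\<dots> = kb c t * (scl (qvar powi (- int (Suc t))) (Kb (c - int t)) + scl (qi qvar (int (Suc t)) * qvar powi (c - int t)) uK)"
    unfolding kb_Suc_scl by (simp add: K_kb distrib_left del: of_nat_Suc)
  also have "\<dots> = scl (qi qvar (int (Suc t))) (kb (c + 1) (Suc t))"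
    unfolding e kb_Suc_shift by (rule kb_Kb)
  finally show ?thesis by (simp only: scl_cancel qi_Suc_nonzero not_False_eq_True)
qed

text \<open>Made for the induction in \<open>dE_dF\<close>: in the step from n to N = n + 1 the term
  with index \<open>t + 1\<close> collects one contribution from \<open>E\<close> reaching the right
  end and one from \<open>E\<close> consuming an \<open>F\<close>.\<close>

lemma kb_Kac:
  "scl (qi qvar N) (kb (c + 1) (Suc t))
    = scl (qi qvar (N - int (Suc t))) (kb c (Suc t)) + Kb (c + N - int t) * kb c t"
proof -
  have "scl (qi qvar (int (Suc t))) (scl (qi qvar N) (kb (c + 1) (Suc t)))
    = scl (qi qvar N) (Kb (c + 1)) * kb c t"
    unfolding scl.scale_left_commute[of "qi qvar (int (Suc t))"] kb_Suc_shift by simp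
  also have "\<dots> = scl (qi qvar (N - int (Suc t))) (Kb (c - int t) * kb c t)
     + scl (qi qvar (int (Suc t))) (Kb (c + N - int t) * kb c t)"
    unfolding Kb_split[of N "c + 1" "int (Suc t)"] distrib_right scl_mult_left by (simp add: algebra_simps)
  also have "Kb (c - int t) * kb c t = scl (qi qvar (int (Suc t))) (kb c (Suc t))"
    unfolding kb_Suc_scl by (simp add: kb_Kb)
  finally have "scl (qi qvar (int (Suc t))) (scl (qi qvar N) (kb (c + 1) (Suc t)))
    = scl (qi qvar (int (Suc t))) (scl (qi qvar (N - int (Suc t))) (kb c (Suc t)) + Kb (c + N - int t) * kb c t)"
    by (simp only: scl.scale_right_distrib scl.scale_scale mult.commute)
  then show ?thesis by (simp only: scl_cancel qi_Suc_nonzero not_False_eq_True)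
qed

text \<open>Zero for negative exponents, so that the sum in \<open>dE_dF\<close> has no cut-off at
  the exponent of \<open>F\<close>.\<close>

definition dFi :: "int \<Rightarrow> Uq" where
  "dFi i = (if i < 0 then 0 else dF (nat i))"

lemma dFi_int [simp]: "dFi (int n) = dF n"
  by (simp add: dFi_def)

lemma E_dF: "uE * dF (Suc n) = dF (Suc n) * uE + dF n * Kb (- int n)"
proof (induction n)
  case 0
  show ?case using EF divided_power_1[of uF] by simp
next
  case (Suc n)
  have "scl (qi qvar (int (Suc (Suc n)))) (uE * dF (Suc (Suc n))) = uE * dF (Suc n) * uF"
    unfolding mult.assoc divided_power_Suc_right by simp
  also have "\<dots> = dF (Suc n) * (uE * uF) + dF n * (Kb (- int n) * uF)"
    unfolding Suc by (simp only: distrib_right mult.assoc)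
  also have "\<dots> = dF (Suc n) * uF * uE + (dF (Suc n) * Kb 0 + dF n * uF * Kb (- int n - 2))"
    unfolding Kb_F EF by (simp only: distrib_left mult.assoc add.assoc)
  also have "\<dots> = scl (qi qvar (int (Suc (Suc n)))) (dF (Suc (Suc n)) * uE)
      + dF (Suc n) * (Kb 0 + scl (qi qvar (int (Suc n))) (Kb (- int n - 2)))"
    unfolding divided_power_Suc_right by (simp add: distrib_left del: of_nat_Suc)
  also have "Kb 0 + scl (qi qvar (int (Suc n))) (Kb (- int n - 2))
     = scl (qi qvar (int (Suc (Suc n)))) (Kb (- int (Suc n)))"
    using Kb_split[of "int (Suc (Suc n))" "- int (Suc n)" 1] by (simp add: qi_1[OF qvar_neq_inverse] add.commute)
  finally have "scl (qi qvar (int (Suc (Suc n)))) (uE * dF (Suc (Suc n)))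
     = scl (qi qvar (int (Suc (Suc n)))) (dF (Suc (Suc n)) * uE + dF (Suc n) * Kb (- int (Suc n)))"
    by (simp only: scl.scale_right_distrib scl_mult_right)
  then show ?case by (simp only: scl_cancel qi_Suc_nonzero not_False_eq_True)
qed

lemma E_dFi: "uE * dFi i = dFi i * uE + dFi (i - 1) * Kb (1 - i)"
proof -
  consider "i < 0" | "i = 0" | n where "i = int (Suc n)"
    by (metis int_cases3 not0_implies_Suc of_nat_0_less_iff neg_less_0_iff_less less_numeral_extra(3))
  then show ?thesis
  proof cases
    case 3
    have "i - 1 = int n" using 3 by simp
    then show ?thesis using E_dF[of n] unfolding 3 by (simp only: dFi_int) simp
  qed (simp_all add: dFi_def)
qed

text \<open>Kac's commutation formula for divided powers. Multiply by \<open>E\<close> on the left,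
  move it through \<open>dFi\<close> and the Cartan factor, and cancel
  \<open>[n + 1]\<close>.\<close>

lemma dE_dF:
  "dE n * dF m = (\<Sum>t\<le>n. dFi (int m - int t) * kb (2 * int t - int n - int m) t * dE (n - t))"
proof (induction n)
  case (Suc n)
  let ?N = "int (Suc n)"
  have E_kb: "uE * kb c t = kb (c - 2) t * uE" for c t
    using kb_E[of "c - 2" t] by simp
  let ?f1 = "\<lambda>t. scl (qi qvar (?N - int t)) (dFi (int m - int t) * kb (2 * int t - int n - int m - 2) t * dE (Suc n - t))"
  let ?f2 = "\<lambda>t. dFi (int m - int (Suc t)) * (Kb (int (Suc t) - int m) * kb (2 * int t - int n - int m) t) * dE (n - t)"
  have "scl (qi qvar ?N) (dE (Suc n) * dF m) = uE * (dE n * dF m)"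
    unfolding mult.assoc[symmetric] divided_power_Suc_left by simp
  also have "\<dots> = (\<Sum>t\<le>n. uE * dFi (int m - int t) * kb (2 * int t - int n - int m) t * dE (n - t))"
    unfolding Suc sum_distrib_left by (simp only: mult.assoc)
  also have "\<dots> = (\<Sum>t\<le>n. ?f1 t + ?f2 t)"
  proof (rule sum.cong)
    fix t assume "t \<in> {..n}"
    then have nt: "Suc n - t = Suc (n - t)" "int (Suc (n - t)) = ?N - int t" by auto
    have "uE * dFi (int m - int t) * kb (2 * int t - int n - int m) t * dE (n - t)
      = dFi (int m - int t) * (uE * kb (2 * int t - int n - int m) t) * dE (n - t)
      + dFi (int m - int t - 1) * (Kb (1 - (int m - int t)) * kb (2 * int t - int n - int m) t) * dE (n - t)"
      unfolding E_dFi by (simp only: distrib_right mult.assoc)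
    also have "dFi (int m - int t) * (uE * kb (2 * int t - int n - int m) t) * dE (n - t) = ?f1 t"
      unfolding E_kb nt(1) nt(2)[symmetric] 
      by (simp only: mult.assoc divided_power_Suc_left scl_mult_right)
    also have "dFi (int m - int t - 1) * (Kb (1 - (int m - int t)) * kb (2 * int t - int n - int m) t) * dE (n - t) = ?f2 t"
      by (simp add: algebra_simps)
    finally show "uE * dFi (int m - int t) * kb (2 * int t - int n - int m) t * dE (n - t) = ?f1 t + ?f2 t" .
  qed simp
  \<comment> \<open>The new term at \<open>t = Suc n\<close> has the factor \<open>[0]\<close>; it
    is added so that the two sums can be shifted against each other.\<close>
  also have "\<dots> = (\<Sum>t\<le>Suc n. ?f1 t) + (\<Sum>t\<le>n. ?f2 t)"
    by (simp add: sum.distrib)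
  also have "\<dots> = ?f1 0 + (\<Sum>t\<le>n. ?f1 (Suc t) + ?f2 t)"
    unfolding sum.atMost_Suc_shift sum.distrib by (simp only: add.assoc)
  also have "(\<Sum>t\<le>n. ?f1 (Suc t) + ?f2 t) = (\<Sum>t\<le>n. scl (qi qvar ?N) (dFi (int m - int (Suc t)) *
      kb (2 * int (Suc t) - ?N - int m) (Suc t) * dE (Suc n - Suc t)))"
  proof (rule sum.cong)
    fix t
    define c where "c = 2 * int t - int n - int m"
    have c: "2 * int (Suc t) - int n - int m - 2 = c" "2 * int (Suc t) - ?N - int m = c + 1"
      "int (Suc t) - int m = c + ?N - int t"
      by (auto simp: c_def)
    show "?f1 (Suc t) + ?f2 t = scl (qi qvar ?N) (dFi (int m - int (Suc t)) *
      kb (2 * int (Suc t) - ?N - int m) (Suc t) * dE (Suc n - Suc t))"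
      unfolding c c_def[symmetric] diff_Suc_Suc
      using arg_cong[OF kb_Kac[of ?N c t], of "\<lambda>x. dFi (int m - int (Suc t)) * x * dE (n - t)"]
      by (simp only: distrib_left distrib_right scl_mult_left scl_mult_right)
  qed simp
  also have "?f1 0 + \<dots> = (\<Sum>t\<le>Suc n. scl (qi qvar ?N) (dFi (int m - int t) *
      kb (2 * int t - ?N - int m) t * dE (Suc n - t)))"
    unfolding sum.atMost_Suc_shift by simp
  finally show ?case
    unfolding scl.scale_sum_right[symmetric] by (simp only: scl_cancel qi_Suc_nonzero not_False_eq_True)
qed simp

section \<open>A triangular spanning set of the integral form\<close>

text \<open>Products only: sums are formed in \<open>UA_span\<close>. Commuting with
  \<open>E\<close> or \<open>F\<close> then turns one such element into one such element.\<close>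

inductive_set cartan :: "Uq set" where
  one: "1 \<in> cartan"
| K: "z \<in> cartan \<Longrightarrow> uK * z \<in> cartan"
| Kinv: "z \<in> cartan \<Longrightarrow> uKi * z \<in> cartan"
| kb: "z \<in> cartan \<Longrightarrow> kb c t * z \<in> cartan"
| scl: "c \<in> integral_ratfun \<Longrightarrow> z \<in> cartan \<Longrightarrow> scl c z \<in> cartan"

lemma cartan_mult: "x \<in> cartan \<Longrightarrow> y \<in> cartan \<Longrightarrow> x * y \<in> cartan"
  by (induction rule: cartan.induct) (simp_all add: mult.assoc cartan.intros)

lemma E_cartan: "z \<in> cartan \<Longrightarrow> \<exists>z'\<in>cartan. uE * z = z' * uE"
proof (induction rule: cartan.induct)
  case one
  show ?case by (auto intro!: bexI[of _ 1] cartan.one)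
next
  case (K z)
  then obtain z' where z': "z' \<in> cartan" "uE * z = z' * uE" by blast
  have "uE * uK = scl (qvar powi (-2)) (uK * uE)"
    by (simp only: KE scl.scale_scale powi_shift[OF qvar_nonzero]) simp
  then have "uE * (uK * z) = scl (qvar powi (-2)) (uK * (uE * z))"
    by (simp flip: mult.assoc)
  then show ?case
    using z' by (intro bexI[of _ "scl (qvar powi (-2)) (uK * z')"]) (auto intro!: cartan.intros simp: mult.assoc)
next
  case (Kinv z)
  then obtain z' where z': "z' \<in> cartan" "uE * z = z' * uE" by blast
  have "uE * uKi = scl (qvar powi 2) (uKi * uE)"
    by (simp only: KiE scl.scale_scale powi_shift[OF qvar_nonzero]) simp
  then have "uE * (uKi * z) = scl (qvar powi 2) (uKi * (uE * z))"
    by (simp flip: mult.assoc)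
  then show ?case
    using z' by (intro bexI[of _ "scl (qvar powi 2) (uKi * z')"])
      (auto intro!: cartan.intros simp: mult.assoc simp del: power_int_numeral)
next
  case (kb z c t)
  then obtain z' where z': "z' \<in> cartan" "uE * z = z' * uE" by blast
  have "uE * kb c t * z = kb (c - 2) t * uE * z"
    using kb_E[of "c - 2" t] by simp
  then show ?case
    using z' by (intro bexI[of _ "kb (c - 2) t * z'"]) (auto intro!: cartan.intros simp: mult.assoc)
next
  case (scl c z)
  then obtain z' where "z' \<in> cartan" "uE * z = z' * uE" by blast
  then show ?case using scl.hyps by (intro bexI[of _ "scl c z'"]) (auto intro!: cartan.intros)
qed

lemma cartan_F: "z \<in> cartan \<Longrightarrow> \<exists>z'\<in>cartan. z * uF = uF * z'"
proof (induction rule: cartan.induct)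
  case one
  show ?case by (auto intro!: bexI[of _ 1] cartan.one)
next
  case (K z)
  then obtain z' where z': "z' \<in> cartan" "z * uF = uF * z'" by blast
  then have "uK * z * uF = scl (qvar powi (-2)) (uF * (uK * z'))"
    by (metis KF mult.assoc scl_mult_left)
  then show ?case
    using z' by (intro bexI[of _ "scl (qvar powi (-2)) (uK * z')"]) (auto intro!: cartan.intros simp: mult.assoc)
next
  case (Kinv z)
  then obtain z' where z': "z' \<in> cartan" "z * uF = uF * z'" by blast
  then have "uKi * z * uF = scl (qvar powi 2) (uF * (uKi * z'))"
    by (metis KiF mult.assoc scl_mult_left)
  then show ?case
    using z' by (intro bexI[of _ "scl (qvar powi 2) (uKi * z')"])
      (auto intro!: cartan.intros simp: mult.assoc simp del: power_int_numeral)
next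
  case (kb z c t)
  then obtain z' where z': "z' \<in> cartan" "z * uF = uF * z'" by blast
  then have "kb c t * z * uF = uF * (kb (c - 2) t * z')"
    by (metis kb_F mult.assoc)
  then show ?case
    using z' by (intro bexI[of _ "kb (c - 2) t * z'"]) (auto intro!: cartan.intros simp: mult.assoc)
next
  case (scl c z)
  then obtain z' where "z' \<in> cartan" "z * uF = uF * z'" by blast
  then show ?case using scl.hyps by (intro bexI[of _ "scl c z'"]) (auto intro!: cartan.intros)
qed

lemma dE_cartan:
  assumes "z \<in> cartan"
  shows "\<exists>z'\<in>cartan. dE n * z = z' * dE n"
proof -
  have "\<exists>z'\<in>cartan. uE ^ n * z = z' * uE ^ n"
  proof (induction n)
    case (Suc n)
    then obtain z' where z': "z' \<in> cartan" "uE ^ n * z = z' * uE ^ n" by blast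
    obtain z'' where "z'' \<in> cartan" "uE * z' = z'' * uE" using E_cartan[OF z'(1)] by blast
    then show ?case using z' by (intro bexI[of _ z'']) (auto simp: mult.assoc, metis mult.assoc)
  qed (use assms in auto)
  then show ?thesis by (auto simp: divided_power_scl intro!: bexI)
qed

lemma cartan_dF:
  assumes "z \<in> cartan"
  shows "\<exists>z'\<in>cartan. z * dF n = dF n * z'"
proof -
  have "\<exists>z'\<in>cartan. z * uF ^ n = uF ^ n * z'"
  proof (induction n)
    case (Suc n)
    then obtain z' where z': "z' \<in> cartan" "z * uF ^ n = uF ^ n * z'" by blast
    obtain z'' where z2: "z'' \<in> cartan" "z' * uF = uF * z''" using cartan_F[OF z'(1)] by blast
    have "z * uF ^ Suc n = uF ^ Suc n * z''"
      unfolding power_Suc2 using z' z2 by (metis mult.assoc)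
    then show ?case using z2(1) by blast
  qed (use assms in auto)
  then show ?thesis by (auto simp: divided_power_scl intro!: bexI)
qed

inductive_set UA_span :: "Uq set" where
  base: "z \<in> cartan \<Longrightarrow> dF a * z * dE b \<in> UA_span"
| add: "x \<in> UA_span \<Longrightarrow> y \<in> UA_span \<Longrightarrow> x + y \<in> UA_span"
| scl: "c \<in> integral_ratfun \<Longrightarrow> x \<in> UA_span \<Longrightarrow> scl c x \<in> UA_span"

lemma UA_span_0 [simp]: "0 \<in> UA_span"
  using UA_span.scl[OF integral_0 UA_span.base[OF cartan.one, of 0 0]] by simp

lemma UA_span_uminus: "x \<in> UA_span \<Longrightarrow> - x \<in> UA_span"
  using UA_span.scl[OF integral_uminus[OF integral_1]] by simp

lemma UA_span_sum: "(\<And>i. i \<in> A \<Longrightarrow> f i \<in> UA_span) \<Longrightarrow> sum f A \<in> UA_span"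
  by (induction A rule: infinite_finite_induct) (auto intro: UA_span.add)

lemma dF_UA_span: "y \<in> UA_span \<Longrightarrow> dF n * y \<in> UA_span"
proof (induction rule: UA_span.induct)
  case (base z a b)
  have "dF n * (dF a * z * dE b) = scl (qb (int (n + a)) a) (dF (n + a) * z * dE b)"
    by (simp add: divided_power_mult flip: mult.assoc)
  then show ?case using base by (auto intro: UA_span.intros)
qed (auto simp: distrib_left intro: UA_span.intros)

lemma cartan_UA_span: "y \<in> UA_span \<Longrightarrow> x \<in> cartan \<Longrightarrow> x * y \<in> UA_span"
proof (induction rule: UA_span.induct)
  case (base z a b)
  obtain x' where x': "x' \<in> cartan" "x * dF a = dF a * x'" using cartan_dF base by blast
  then have "x * (dF a * z * dE b) = dF a * (x' * z) * dE b" by (metis mult.assoc)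
  then show ?case using base x' by (auto intro: UA_span.intros cartan_mult)
qed (auto simp: distrib_left intro: UA_span.intros)

lemma dE_UA_span: "y \<in> UA_span \<Longrightarrow> dE n * y \<in> UA_span"
proof (induction rule: UA_span.induct)
  case (base z a b)
  have "dE n * (dF a * z * dE b)
     = (\<Sum>t\<le>n. dFi (int a - int t) * kb (2 * int t - int n - int a) t * dE (n - t) * (z * dE b))"
    by (simp add: dE_dF sum_distrib_right flip: mult.assoc)
  moreover have "dFi (int a - int t) * kb (2 * int t - int n - int a) t * dE (n - t) * (z * dE b) \<in> UA_span" for t
  proof -
    obtain z' where z': "z' \<in> cartan" "dE (n - t) * z = z' * dE (n - t)" using dE_cartan base by blast
    let ?c = "2 * int t - int n - int a"
    have "dFi (int a - int t) * kb ?c t * dE (n - t) * (z * dE b)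
      = scl (qb (int (n - t + b)) b) (dFi (int a - int t) * (kb ?c t * z') * dE (n - t + b))"
      by (metis z'(2) mult.assoc divided_power_mult scl_mult_right)
    then show ?thesis
      using z' by (auto simp: dFi_def intro!: UA_span.intros cartan.intros)
  qed
  ultimately show ?case by (auto intro: UA_span_sum)
qed (auto simp: distrib_left intro: UA_span.intros)

text \<open>Closure under left multiplication by the generators is enough because 1 lies in the
  span; no product of two elements of the span has to be straightened.\<close>

lemma UA_set_mult_UA_span: "x \<in> UA_set \<Longrightarrow> y \<in> UA_span \<Longrightarrow> x * y \<in> UA_span"
proof (induction arbitrary: y rule: UA_set.induct)
  case K
  then show ?case using cartan_UA_span[OF K cartan.K[OF cartan.one]] by simp
next
  case Kinv
  then show ?case using cartan_UA_span[OF Kinv cartan.Kinv[OF cartan.one]] by simp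
next
  case (diff x x')
  have "x * y + - (x' * y) \<in> UA_span" using diff by (intro UA_span.add UA_span_uminus) auto
  then show ?case by (simp add: left_diff_distrib)
next
  case (smult x p)
  then show ?case by (simp add: UA_span.scl flip: scl_def)
qed (auto simp: mult.assoc dE_UA_span dF_UA_span)

lemma UA_set_span: "x \<in> UA_set \<Longrightarrow> x \<in> UA_span"
  using UA_set_mult_UA_span[OF _ UA_span.base[OF cartan.one, of 0 0]] by simp

lemma UA_set_scl: "c \<in> integral_ratfun \<Longrightarrow> x \<in> UA_set \<Longrightarrow> scl c x \<in> UA_set"
  by (auto simp: integral_ratfun_def scl_def intro: UA_set.smult)

lemma UA_set_sum: "(\<And>i. i \<in> A \<Longrightarrow> f i \<in> UA_set) \<Longrightarrow> sum f A \<in> UA_set"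
  by (induction A rule: infinite_finite_induct) (auto intro: UA_set_add UA_set_zero)

lemma dFi_UA [simp]: "dFi i \<in> UA_set"
  by (auto simp: dFi_def intro: UA_set_zero UA_set.divided_F)

text \<open>In \<open>dE_dF\<close> for \<open>dE t * dF t\<close> the last term is
  \<open>kb 0 t\<close> and all other Cartan binomials have smaller order, so \<open>kb 0 t\<close>
  is a difference of integral elements. Pascal's rule then reaches every other first
  argument.\<close>

lemma kb_UA: "kb c t \<in> UA_set"
proof (induction t arbitrary: c rule: less_induct)
  case (less t)
  show ?case
  proof (cases t)
    case 0
    then show ?thesis by (simp add: UA_set.one)
  next
    case (Suc s)
    have "dE t * dF t = (\<Sum>i\<le>t. dFi (int t - int i) * kb (2 * int i - int t - int t) i * dE (t - i))"
      by (rule dE_dF)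
    also have "\<dots> = (\<Sum>i\<le>s. dFi (int t - int i) * kb (2 * int i - int t - int t) i * dE (t - i)) + kb 0 t"
      unfolding Suc using dFi_int[of 0] by simp
    finally have "kb 0 t = dE t * dF t
        - (\<Sum>i\<le>s. dFi (int t - int i) * kb (2 * int i - int t - int t) i * dE (t - i))"
      by simp
    moreover have "\<dots> \<in> UA_set"
      by (intro UA_set.intros UA_set_sum dFi_UA less) (auto simp: Suc)
    ultimately have 0: "kb 0 (Suc s) \<in> UA_set" by (simp add: Suc)
    have IH: "kb c s \<in> UA_set" for c using less Suc by simp
    have "kb c (Suc s) \<in> UA_set"
    proof (induction c rule: int_induct[of _ 0])
      case (step1 i)
      then show ?case
        unfolding kb_Pascal by (intro UA_set_add UA_set_scl UA_set.mult IH UA_set.K integral_powi)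
    next
      case (step2 i)
      have "scl (qvar powi (int (Suc s))) (scl (qvar powi (- int (Suc s))) x) = x" for x
        by (simp only: scl.scale_scale powi_shift[OF qvar_nonzero]) simp
      then have "kb (i - 1) (Suc s) = scl (qvar powi (int (Suc s)))
          (kb (i - 1 + 1) (Suc s) - scl (qvar powi (i - 1 - int s)) (uK * kb (i - 1) s))"
        unfolding kb_Pascal by (simp only: add_diff_cancel_right')
      also have "\<dots> \<in> UA_set"
        using step2 by (intro UA_set.diff UA_set_scl UA_set.mult IH UA_set.K integral_powi) simp
      finally show ?case .
    qed (use 0 in auto)
    then show ?thesis by (simp add: Suc)
  qed
qed

lemma cartan_UA: "z \<in> cartan \<Longrightarrow> z \<in> UA_set"
  by (induction rule: cartan.induct) (auto intro: UA_set.intros kb_UA UA_set_scl)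


section \<open>The action on arrays of coefficients\<close>

lemma ideal_of_type_algebra:
  fixes I :: "'a::ring_1 set"
  assumes "0 \<in> I" "\<And>x y. x \<in> I \<Longrightarrow> y \<in> I \<Longrightarrow> x + y \<in> I"
    and l: "\<And>x y. x \<in> I \<Longrightarrow> y * x \<in> I" and "\<And>x y. x \<in> I \<Longrightarrow> x * y \<in> I"
  shows "ideal I ring_of_type_algebra"
proof (rule idealI[OF ring_ring_of_type_algebra])
  interpret R: ring "ring_of_type_algebra :: 'a ring" by (rule ring_ring_of_type_algebra)
  have "\<ominus>\<^bsub>ring_of_type_algebra\<^esub> x = - x" for x :: 'a
    by (rule R.minus_equality) auto
  moreover have "- x \<in> I" if "x \<in> I" for x using l[OF that, of "- 1"] by simp
  ultimately have "inv\<^bsub>add_monoid ring_of_type_algebra\<^esub> x \<in> I" if "x \<in> I" for x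
    using that by (simp only: a_inv_def[symmetric])
  then show "subgroup I (add_monoid ring_of_type_algebra)"
    by (intro subgroup.intro) (use assms in auto)
qed (use assms in auto)

text \<open>
  The entry of an array at \<open>(a, b, L)\<close> is the coefficient of \<open>F\<^sup>(\<^sup>a\<^sup>) 1\<^sub>L E\<^sup>(\<^sup>b\<^sup>)\<close>,
  where \<open>1\<^sub>L\<close> stands for the projection to weight \<open>L\<close>.
\<close>

type_synonym arr = "nat \<Rightarrow> nat \<Rightarrow> int \<Rightarrow> ratfun"

text \<open>Left multiplication on the symbols. \<open>E\<close> either passes to the right, where
  it raises the weight from \<open>L - 2\<close> to \<open>L\<close> and turns
  \<open>E^(b-1)\<close> into \<open>[b] E^(b)\<close>, or it consumes one \<open>F\<close> and
  leaves the factor \<open>[L - a]\<close>. At \<open>a = 0\<close> or \<open>b = 0\<close> the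
  truncated subtraction is harmless because of the factor \<open>[0]\<close>.\<close>

primrec gact :: "generator \<Rightarrow> arr \<Rightarrow> arr" where
  "gact GF w = (\<lambda>a b L. qi qvar (int a) * w (a - 1) b L)"
| "gact GK w = (\<lambda>a b L. qvar powi (L - 2 * int a) * w a b L)"
| "gact GKinv w = (\<lambda>a b L. qvar powi (- (L - 2 * int a)) * w a b L)"
| "gact GE w = (\<lambda>a b L. qi qvar (int b) * w a (b - 1) (L - 2) + qi qvar (L - int a) * w (Suc a) b L)"

definition ascl :: "ratfun \<Rightarrow> arr \<Rightarrow> arr" where
  "ascl c w = (\<lambda>a b L. c * w a b L)"

definition aadd :: "arr \<Rightarrow> arr \<Rightarrow> arr" where
  "aadd v w = (\<lambda>a b L. v a b L + w a b L)"

definition adiff :: "arr \<Rightarrow> arr \<Rightarrow> arr" where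
  "adiff v w = (\<lambda>a b L. v a b L - w a b L)"

definition azero :: arr where
  "azero = (\<lambda>a b L. 0)"

lemmas arr_ops = ascl_def aadd_def adiff_def azero_def fun_eq_iff

lemma arr_simps [simp]: "ascl 0 w = azero" "ascl c azero = azero" "ascl 1 w = w"
    "ascl c (ascl d w) = ascl (c * d) w" "aadd azero w = w" "aadd w azero = w"
  by (auto simp: arr_ops)

lemma adiff_self [simp]: "adiff w w = azero"
  by (auto simp: arr_ops)

lemma gact_add: "gact g (aadd v w) = aadd (gact g v) (gact g w)"
  by (cases g) (auto simp: arr_ops algebra_simps)

lemma gact_ascl: "gact g (ascl c w) = ascl c (gact g w)"
  by (cases g) (auto simp: arr_ops algebra_simps)

fun wact :: "generator word \<Rightarrow> arr \<Rightarrow> arr" where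
  "wact (Word gs) w = foldr gact gs w"

lemma wact_add: "wact k (aadd v w) = aadd (wact k v) (wact k w)"
proof (cases k)
  case (Word gs)
  then show ?thesis by (induction gs arbitrary: k) (auto simp: gact_add)
qed

lemma wact_ascl: "wact k (ascl c w) = ascl c (wact k w)"
proof (cases k)
  case (Word gs)
  then show ?thesis by (induction gs arbitrary: k) (auto simp: gact_ascl)
qed

lemma wact_plus: "wact (k + j) w = wact k (wact j w)"
  by (cases k; cases j) simp

lemma wact_0: "wact 0 w = w"
  by (simp add: zero_word_def)

definition act :: "free_alg \<Rightarrow> arr \<Rightarrow> arr" where
  "act p w = (\<lambda>a b L. pm_sum (\<lambda>k c. c * wact k w a b L) p)"

lemma act_single: "act (Poly_Mapping.single k c) w = ascl c (wact k w)"
  by (simp add: act_def pm_sum_single ascl_def)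

lemma act_0 [simp]: "act 0 w = azero"
  by (simp add: act_def azero_def)

lemma act_add: "act (p + q) w = aadd (act p w) (act q w)"
  unfolding act_def aadd_def by (intro ext pm_sum_add) (auto simp: algebra_simps)

lemma act_diff: "act (p - q) w = adiff (act p w) (act q w)"
  using act_add[of "p - q" q w] by (simp add: arr_ops)

lemma act_add_right: "act p (aadd v w) = aadd (act p v) (act p w)"
  by (simp add: act_def pm_sum_def wact_add) (simp add: aadd_def distrib_left sum.distrib)

lemma act_ascl: "act p (ascl c w) = ascl c (act p w)"
  by (simp add: act_def pm_sum_def wact_ascl) (simp add: ascl_def sum_distrib_left mult.left_commute)

lemma act_mult: "act (p * q) w = act p (act q w)"
proof (induction p rule: poly_mapping_add_induct)
  case (single k c)
  show ?case
  proof (induction q rule: poly_mapping_add_induct)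
    case zero
    then show ?case using act_ascl[of "Poly_Mapping.single k c" 0 azero] by simp
  next
    case (single j d)
    then show ?case by (simp add: mult_single act_single wact_plus wact_ascl)
  next
    case (add p q)
    then show ?case by (simp add: distrib_left act_add act_add_right)
  qed
qed (simp_all add: distrib_right act_add)

lemma act_gen: "act (gen g) w = gact g w"
  by (simp add: gen_def act_single)

lemma act_const: "act (const c) w = ascl c w"
  by (simp add: const_def act_single wact_0)

lemma act_1: "act 1 w = w"
  using act_const[of 1 w] by (simp add: const_def)

lemma qi_EF: "qi qvar (L - a) * qi qvar (a + 1) - qi qvar a * qi qvar (L - a + 1) = qi qvar (L - 2 * a)"
proof -
  have 1: "qi qvar (a + 1) = qvar powi 1 * qi qvar a + qvar powi (- a)"
    using qi_add[OF qvar_nonzero qvar_neq_inverse, of a 1] qi_1[OF qvar_neq_inverse] by (simp del: power_int_1_right)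
  have 2: "qi qvar (L - a + 1) = qvar powi 1 * qi qvar (L - a) + qvar powi (- (L - a))"
    using qi_add[OF qvar_nonzero qvar_neq_inverse, of "L - a" 1] qi_1[OF qvar_neq_inverse] by (simp del: power_int_1_right)
  have 3: "qi qvar (L - 2 * a) = qvar powi (- a) * qi qvar (L - a) + qvar powi (- (L - a)) * qi qvar (- a)"
    using qi_add[OF qvar_nonzero qvar_neq_inverse, of "L - a" "- a"] by (simp add: algebra_simps)
  show ?thesis unfolding 1 2 3 by (simp add: qi_uminus algebra_simps)
qed

text \<open>Only the relation between \<open>E\<close> and \<open>F\<close> is more than a
  comparison of weights; on each entry it becomes \<open>qi_EF\<close>.\<close>

lemma act_relation: "r \<in> Uq_relations \<Longrightarrow> act r w = azero"
proof -
  have EF: "adiff (gact GE (gact GF w)) (gact GF (gact GE w)) = ascl (inverse (qvar - inverse qvar)) (adiff (gact GK w) (gact GKinv w))"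
  proof (intro ext)
    fix a b L
    have "adiff (gact GE (gact GF w)) (gact GF (gact GE w)) a b L
       = (qi qvar (L - int a) * qi qvar (int a + 1) - qi qvar (int a) * qi qvar (L - int a + 1)) * w a b L"
      by (cases a) (auto simp: adiff_def algebra_simps)
    also have "\<dots> = ascl (inverse (qvar - inverse qvar)) (adiff (gact GK w) (gact GKinv w)) a b L"
      unfolding qi_EF by (simp add: ascl_def adiff_def qi_def divide_inverse algebra_simps)
    finally show "adiff (gact GE (gact GF w)) (gact GF (gact GE w)) a b L
       = ascl (inverse (qvar - inverse qvar)) (adiff (gact GK w) (gact GKinv w)) a b L" .
  qed
  have pw: "qvar powi m * (qvar powi n * x) = qvar powi (m + n) * x" for m n x
    by (simp add: power_int_add)
  have K: "gact GK (gact GKinv w) = w" "gact GKinv (gact GK w) = w"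
    by (auto simp: fun_eq_iff pw)
  have pw2: "qvar powi m * (y * (qvar powi n * x)) = qvar powi (m + n) * (y * x)" for m n x y
    by (simp add: power_int_add mult_ac)
  have KE: "gact GK (gact GE (gact GKinv w)) = ascl (qvar powi 2) (gact GE w)"
    by (intro ext) (simp add: ascl_def distrib_left pw2 del: power_int_numeral)
  have KF: "gact GK (gact GF (gact GKinv w)) = ascl (qvar powi (-2)) (gact GF w)"
  proof (intro ext)
    fix a b L show "gact GK (gact GF (gact GKinv w)) a b L = ascl (qvar powi (-2)) (gact GF w) a b L"
      by (cases a) (simp_all add: ascl_def pw2)
  qed
  show "r \<in> Uq_relations \<Longrightarrow> act r w = azero"
    by (auto simp: Uq_relations_def act_diff act_mult act_gen act_const act_1 K KE KF EF
        adiff_self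
        simp del: gact.simps power_int_numeral)
qed

text \<open>The elements annihilating every array form a two-sided ideal, and it contains the
  relations.\<close>

lemma act_cong: "Uq_rel x y \<Longrightarrow> act x w = act y w"
proof -
  let ?I = "{p. \<forall>w. act p w = azero}"
  have z: "act p azero = azero" for p using act_ascl[of p 0 azero] by simp
  have "ideal ?I ring_of_type_algebra"
    by (rule ideal_of_type_algebra) (auto simp: act_add act_mult z)
  then have "Uq_ideal \<subseteq> ?I"
    unfolding Uq_ideal_def
    by (intro ring.genideal_minimal[OF ring_ring_of_type_algebra]) (auto simp: act_relation)
  then show "Uq_rel x y \<Longrightarrow> act x w = act y w"
    unfolding Uq_rel_def by (auto simp: act_diff arr_ops dest!: subsetD)
qed

lift_definition uact :: "Uq \<Rightarrow> arr \<Rightarrow> arr" is act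
  by (rule ext) (rule act_cong)

lemma uact_add: "uact (x + y) w = aadd (uact x w) (uact y w)"
  by transfer (rule act_add)

lemma uact_diff: "uact (x - y) w = adiff (uact x w) (uact y w)"
  by transfer (rule act_diff)

lemma uact_mult: "uact (x * y) w = uact x (uact y w)"
  by transfer (rule act_mult)

lemma uact_1 [simp]: "uact 1 w = w"
  by transfer (rule act_1)

lemma uact_scl [simp]: "uact (scl c x) w = ascl c (uact x w)"
  unfolding scl_def by transfer (simp add: act_mult act_const)

lemma uact_gen: "uact (Uq_gen g) w = gact g w"
  by transfer (rule act_gen)

text \<open>Meant for right multiplications \<open>T\<close>: commuting with the generators is
  enough to commute with the whole left action.\<close>

lemma act_commute:
  assumes "\<And>v w. T (aadd v w) = aadd (T v) (T w)" "\<And>c w. T (ascl c w) = ascl c (T w)"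
    and "\<And>g w. T (gact g w) = gact g (T w)"
  shows "T (act x w) = act x (T w)"
proof -
  have wd: "T (wact k w) = wact k (T w)" for k
  proof (cases k)
    case (Word gs)
    then show ?thesis by (induction gs arbitrary: k) (auto simp: assms)
  qed
  show "T (act x w) = act x (T w)"
  proof (induction x rule: poly_mapping_add_induct)
    case zero
    then show ?case using assms(2)[of 0 azero] by simp
  next
    case (single k c)
    then show ?case by (simp add: act_single assms wd)
  qed (simp add: act_add assms)
qed

lemma uact_commute:
  assumes "\<And>v w. T (aadd v w) = aadd (T v) (T w)" "\<And>c w. T (ascl c w) = ascl c (T w)"
    and "\<And>g w. T (gact g w) = gact g (T w)"
  shows "T (uact x w) = uact x (T w)"
  using act_commute[of T, OF assms] by transfer

lemma ascl_cancel: "c \<noteq> 0 \<Longrightarrow> ascl c v = ascl c w \<longleftrightarrow> v = w"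
  by (auto simp: ascl_def fun_eq_iff)

lemma qb_shift: "qi qvar (int a) * qb (int (a - 1)) n = qi qvar (int (Suc n)) * qb (int a) (Suc n)"
proof (cases a)
  case (Suc m)
  then show ?thesis using qb_Suc_shift[of "int m" n] by (simp add: algebra_simps)
qed simp

lemma uact_dF: "uact (dF n) w = (\<lambda>a b L. qb (int a) n * w (a - n) b L)"
proof (induction n)
  case (Suc n)
  have "ascl (qi qvar (int (Suc n))) (uact (dF (Suc n)) w) = gact GF (uact (dF n) w)"
    unfolding uact_scl[symmetric] divided_power_Suc_left[symmetric] by (simp only: uact_mult uact_gen)
  also have "\<dots> = ascl (qi qvar (int (Suc n))) (\<lambda>a b L. qb (int a) (Suc n) * w (a - Suc n) b L)"
    unfolding Suc ascl_def gact.simps mult.assoc[symmetric] qb_shift by simp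
  finally show ?case by (simp only: ascl_cancel qi_Suc_nonzero not_False_eq_True)
qed simp

lemma uact_Kb: "uact (Kb c) w = (\<lambda>a b L. qi qvar (L - 2 * int a + c) * w a b L)"
proof (intro ext)
  fix a b L
  have pw: "qvar powi m * (qvar powi n * x) = qvar powi (n + m) * x" for m n x
    by (simp add: power_int_add)
  have "uact (Kb c) w a b L = inverse (qvar - inverse qvar) *
     (qvar powi c * (qvar powi (L - 2 * int a) * w a b L) - qvar powi (- c) * (qvar powi (- (L - 2 * int a)) * w a b L))"
    by (simp add: Kb_def uact_diff uact_gen ascl_def adiff_def)
  also have "\<dots> = inverse (qvar - inverse qvar) *
     (qvar powi (L - 2 * int a + c) * w a b L - qvar powi (- (L - 2 * int a + c)) * w a b L)"
    unfolding pw minus_add_distrib by simp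
  also have "\<dots> = qi qvar (L - 2 * int a + c) * w a b L"
    unfolding qi_def divide_inverse by (simp add: algebra_simps del: minus_diff_eq)
  finally show "uact (Kb c) w a b L = qi qvar (L - 2 * int a + c) * w a b L" .
qed

lemma uact_kb: "uact (kb c t) w = (\<lambda>a b L. qb (L - 2 * int a + c) t * w a b L)"
proof (induction t arbitrary: w)
  case (Suc t)
  have "ascl (qi qvar (int (Suc t))) (uact (kb c (Suc t)) w) = uact (kb c t) (uact (Kb (c - int t)) w)"
    unfolding uact_scl[symmetric] kb_Suc_scl by (simp only: uact_mult)
  also have "\<dots> = (\<lambda>a b L. (qb (L - 2 * int a + c) t * qi qvar (L - 2 * int a + c - int t)) * w a b L)"
    unfolding Suc uact_Kb by (simp add: algebra_simps)
  also have "\<dots> = ascl (qi qvar (int (Suc t))) (\<lambda>a b L. qb (L - 2 * int a + c) (Suc t) * w a b L)"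
    unfolding qb_Suc[symmetric] ascl_def by (simp only: mult_ac)
  finally show ?case by (simp only: ascl_cancel qi_Suc_nonzero not_False_eq_True)
qed simp

text \<open>The unit, written as the sum of all weight projections \<open>1_L\<close>.\<close>

definition arr_one :: arr where
  "arr_one = (\<lambda>a b L. if a = 0 \<and> b = 0 then 1 else 0)"

definition coords :: "Uq \<Rightarrow> arr" where
  "coords u = uact u arr_one"

lemma coords_add: "coords (x + y) = aadd (coords x) (coords y)"
  by (simp add: coords_def uact_add)

lemma coords_diff: "coords (x - y) = adiff (coords x) (coords y)"
  by (simp add: coords_def uact_diff)

lemma coords_scl: "coords (scl c x) = ascl c (coords x)"
  by (simp add: coords_def)

lemma coords_mult: "coords (x * y) = uact x (coords y)"
  by (simp add: coords_def uact_mult)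

lemma coords_1: "coords 1 = arr_one"
  by (simp add: coords_def)

text \<open>\<open>?T\<close> is right multiplication by \<open>E\<close>. It commutes with the left
  action, and on the unit \<open>arr_one\<close> it agrees with left multiplication by
  \<open>E\<close>.\<close>

lemma coords_mult_E: "coords (x * uE) = (\<lambda>a b L. qi qvar (int b) * coords x a (b - 1) L)"
proof -
  let ?T = "\<lambda>(w :: arr) a b L. qi qvar (int b) * w a (b - 1) L"
  have comm: "?T (gact g w) = gact g (?T w)" for g w
  proof (intro ext)
    fix a b L show "?T (gact g w) a b L = gact g (?T w) a b L"
      by (cases g; cases b) (auto simp: algebra_simps)
  qed
  have one: "gact GE arr_one = ?T arr_one"
    by (auto simp: arr_one_def fun_eq_iff)
  have "coords (x * uE) = uact x (?T arr_one)"
    by (simp only: coords_def uact_mult uact_gen one)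
  also have "\<dots> = ?T (uact x arr_one)"
    by (rule uact_commute[symmetric, OF _ _ comm]) (auto simp: arr_ops algebra_simps)
  finally show ?thesis by (simp add: coords_def)
qed

lemma coords_mult_K: "coords (x * uK) = (\<lambda>a b L. qvar powi (L - 2 * int b) * coords x a b L)"
proof -
  let ?T = "\<lambda>(w :: arr) a b L. qvar powi (L - 2 * int b) * w a b L"
  have comm: "?T (gact g w) = gact g (?T w)" for g w
  proof (intro ext)
    fix a b L show "?T (gact g w) a b L = gact g (?T w) a b L"
      by (cases g; cases b) (auto simp: algebra_simps)
  qed
  have one: "gact GK arr_one = ?T arr_one"
    by (auto simp: arr_one_def fun_eq_iff)
  have "coords (x * uK) = uact x (?T arr_one)"
    by (simp only: coords_def uact_mult uact_gen one)
  also have "\<dots> = ?T (uact x arr_one)"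
    by (rule uact_commute[symmetric, OF _ _ comm]) (auto simp: arr_ops algebra_simps)
  finally show ?thesis by (simp add: coords_def)
qed

lemma coords_mult_dE: "coords (x * dE n) = (\<lambda>a b L. qb (int b) n * coords x a (b - n) L)"
proof (induction n)
  case (Suc n)
  have "ascl (qi qvar (int (Suc n))) (coords (x * dE (Suc n))) = coords (x * dE n * uE)"
    unfolding mult.assoc divided_power_Suc_right scl_mult_right coords_scl ..
  also have "\<dots> = ascl (qi qvar (int (Suc n))) (\<lambda>a b L. qb (int b) (Suc n) * coords x a (b - Suc n) L)"
    unfolding coords_mult_E Suc ascl_def mult.assoc[symmetric] qb_shift by simp
  finally show ?case by (simp only: ascl_cancel qi_Suc_nonzero not_False_eq_True)
qed simp

lemma cartan_coords: "z \<in> cartan \<Longrightarrow> coords z a b L \<in> integral_ratfun"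
  by (induction rule: cartan.induct)
    (auto simp: coords_mult coords_1 arr_one_def uact_gen uact_kb coords_scl ascl_def
      simp del: minus_diff_eq intro!: integral_mult)

text \<open>On triangular products the coordinates are Gaussian binomials times values of the Cartan
  part, all integral; this is the purpose of \<open>UA_span\<close>.\<close>

lemma coords_integral: "x \<in> UA_set \<Longrightarrow> coords x a b L \<in> integral_ratfun"
proof (drule UA_set_span, induction arbitrary: a b L rule: UA_span.induct)
  case (base z m n)
  then show ?case
    by (simp add: coords_mult_dE coords_mult[of "dF m"] uact_dF integral_mult cartan_coords)
qed (auto simp: coords_add coords_scl ascl_def aadd_def intro: integral_closed)

section \<open>Specialised coordinates\<close>

locale root_of_unity =
  fixes \<zeta> :: "'k::field_char_0" and l :: nat
  assumes l_gt_1: "l > 1" and l_odd: "odd l" and prim: "primitive_root_of_unity l \<zeta>"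
begin

section \<open>Powers of \<open>\<zeta>\<close> and quantum integers at
  \<open>\<zeta>\<close>\<close>

lemma zeta_power_l: "\<zeta> ^ l = 1"
  using prim by (simp add: primitive_root_of_unity_def)

lemma zeta_nonzero [simp]: "\<zeta> \<noteq> 0"
  using zeta_power_l l_gt_1 by (auto simp: power_0_left)

lemma zeta_powi_l: "\<zeta> powi (int l * n) = 1"
  by (simp add: power_int_mult zeta_power_l)

lemma zeta_powi_mod: "\<zeta> powi n = \<zeta> powi (n mod int l)"
proof -
  have "\<zeta> powi n = \<zeta> powi (int l * (n div int l) + n mod int l)" by simp
  also have "\<dots> = \<zeta> powi (n mod int l)" by (simp only: power_int_add[OF disjI1[OF zeta_nonzero]] zeta_powi_l mult_1_left)
  finally show ?thesis .
qed

lemma zeta_powi_eq_1_iff: "\<zeta> powi n = 1 \<longleftrightarrow> int l dvd n"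
proof -
  define m where "m = nat (n mod int l)"
  have m: "int m = n mod int l" "m < l" using l_gt_1 by (auto simp: m_def nat_less_iff)
  have "\<zeta> powi n = \<zeta> ^ m" by (subst zeta_powi_mod) (simp flip: m(1))
  moreover have "\<zeta> ^ m = 1 \<longleftrightarrow> m = 0"
    using prim m(2) by (auto simp: primitive_root_of_unity_def)
  ultimately show ?thesis using m(1) by (auto simp: dvd_eq_mod_eq_0)
qed

lemma zeta_cong: "int l dvd m - n \<Longrightarrow> \<zeta> powi m = \<zeta> powi n"
  by (metis mod_eq_dvd_iff zeta_powi_mod)

lemma zeta_neq_inverse [simp]: "\<zeta> \<noteq> inverse \<zeta>"
proof
  assume "\<zeta> = inverse \<zeta>"
  then have "\<zeta> * \<zeta> = 1" by (metis right_inverse zeta_nonzero)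
  then have "\<zeta> powi 2 = 1" by (simp add: power2_eq_square)
  then have "int l dvd 2" by (simp only: zeta_powi_eq_1_iff)
  then have "l dvd 2" by (metis int_dvd_int_iff of_nat_numeral)
  then have "l = 2" using l_gt_1 by (metis dvd_imp_le le_antisym less_iff_succ_less_eq zero_less_numeral Suc_1 Suc_leI)
  then show False using l_odd by simp
qed

lemma sp_qi_zeta: "sp \<zeta> (qi qvar n) = qi \<zeta> n"
  by (simp add: sp_qi)

text \<open>\<open>[n]\<close> vanishes if and only if l divides 2 n; for odd l this means that l
  divides n.\<close>

lemma qi_zeta_eq_0_iff: "qi \<zeta> n = 0 \<longleftrightarrow> int l dvd n"
proof -
  have "coprime (int l) 2" using l_odd by simp
  then show ?thesis
    by (simp add: qi_eq_0_iff zeta_powi_eq_1_iff coprime_dvd_mult_right_iff)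
qed

lemma qi_zeta_cong: "int l dvd m - n \<Longrightarrow> qi \<zeta> m = qi \<zeta> n"
  using zeta_cong[of m n] zeta_cong[of "- m" "- n"] by (simp add: qi_def dvd_diff_commute)

section \<open>Gaussian binomials at \<open>\<zeta>\<close>\<close>

abbreviation zb :: "int \<Rightarrow> nat \<Rightarrow> 'k" where
  "zb L t \<equiv> sp \<zeta> (qb L t)"

lemma zb_Suc: "zb L (Suc t) * qi \<zeta> (int (Suc t)) = zb L t * qi \<zeta> (L - int t)"
  using arg_cong[OF qb_Suc[of L t], of "sp \<zeta>"] by (simp add: sp_mult sp_qi_zeta del: of_nat_Suc)

lemma zb_Pascal:
  "zb (L + 1) (Suc t) = \<zeta> powi (- int (Suc t)) * zb L (Suc t) + \<zeta> powi (L - int t) * zb L t"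
  unfolding qb_Pascal by (simp add: sp_add sp_mult integral_mult del: of_nat_Suc)

lemma zb_prod: "t < l \<Longrightarrow> zb L t = (\<Prod>i<t. qi \<zeta> (L - int i) / qi \<zeta> (int (Suc i)))"
proof (induction t)
  case (Suc t)
  have "\<not> int l dvd int (Suc t)" using Suc.prems by (auto dest: zdvd_imp_le)
  then have "qi \<zeta> (int (Suc t)) \<noteq> 0" by (simp only: qi_zeta_eq_0_iff not_False_eq_True)
  then show ?case using Suc zb_Suc[of L t] by (simp add: field_simps del: of_nat_Suc)
qed simp

text \<open>If l divides L + 1, each of the \<open>l - 1\<close> quotients is -1, and
  \<open>l - 1\<close> is even. Otherwise the residue of \<open>L\<close> is one of 0, ..., l - 2
  and a numerator vanishes.\<close>

lemma zb_pred_l: "zb L (l - 1) = (if int l dvd L + 1 then 1 else 0)"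
proof (cases "int l dvd L + 1")
  case True
  have nz: "qi \<zeta> (int (Suc i)) \<noteq> 0" if "i < l - 1" for i
    using that by (auto simp: qi_zeta_eq_0_iff dest: zdvd_imp_le)
  have "qi \<zeta> (L - int i) = - qi \<zeta> (int (Suc i))" for i
    using qi_zeta_cong[of "L - int i" "- int (Suc i)"] True by (simp add: qi_uminus del: of_nat_Suc) 
      (simp add: algebra_simps)
  then have "zb L (l - 1) = (\<Prod>i<l - 1. - 1)"
    using l_gt_1 nz by (simp add: zb_prod)
  also have "\<dots> = 1" using l_odd by simp
  finally show ?thesis using True by simp
next
  case False
  define i where "i = nat (L mod int l)"
  have i: "int i = L mod int l" using l_gt_1 by (simp add: i_def)
  have "i < l" using i l_gt_1 by (metis of_nat_less_iff pos_mod_bound of_nat_0_less_iff zero_less_one less_trans)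
  have "i \<noteq> l - 1"
  proof
    assume "i = l - 1"
    then have "(L + 1) mod int l = 0"
      using i l_gt_1 by (metis mod_add_left_eq of_nat_diff diff_add_cancel mod_self less_imp_le of_nat_1)
    then show False using False by (simp add: dvd_eq_mod_eq_0)
  qed
  then have "i < l - 1" using \<open>i < l\<close> by simp
  moreover have "qi \<zeta> (L - int i) = 0"
    unfolding qi_zeta_eq_0_iff i by (simp add: minus_mod_eq_mult_div)
  ultimately show ?thesis using False l_gt_1 by (auto simp: zb_prod intro!: bexI[of _ i])
qed

lemma div_l_Suc: "(L + 1) div int l = L div int l + (if int l dvd L + 1 then 1 else 0)"
proof -
  define m r where "m = L div int l" and "r = L mod int l"
  have L: "L = int l * m + r" and r: "0 \<le> r" "r < int l"
    using l_gt_1 by (simp_all add: m_def r_def)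
  have dvd: "int l dvd L + 1 \<longleftrightarrow> int l dvd r + 1"
    unfolding L add.assoc by (rule dvd_add_right_iff) simp
  show ?thesis
  proof (cases "r + 1 = int l")
    case True
    then have "L + 1 = int l * (m + 1) + 0" by (simp add: L algebra_simps)
    then have "(L + 1) div int l = m + 1" by (rule int_div_pos_eq) (use l_gt_1 in auto)
    then show ?thesis using True dvd by (simp add: m_def)
  next
    case False
    have "(L + 1) div int l = m" by (rule int_div_pos_eq[of _ _ _ "r + 1"]) (use L r False in auto)
    moreover have "\<not> int l dvd r + 1" using r False by (auto dest: zdvd_imp_le)
    ultimately show ?thesis using dvd by (simp add: m_def)
  qed
qed

text \<open>At \<open>\<zeta>\<close> Pascal's rule for order \<open>l\<close> adds 1 exactly when l
  divides L + 1, and so does the floor of L / l; both start with 0 at L = 0.\<close>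

lemma zb_l: "zb L l = of_int (L div int l)"
proof -
  have step: "zb (L + 1) l = zb L l + (if int l dvd L + 1 then 1 else 0)" for L
  proof -
    have l: "l = Suc (l - 1)" using l_gt_1 by simp
    have "zb (L + 1) l = \<zeta> powi (- int l) * zb L l + \<zeta> powi (L - int (l - 1)) * zb L (l - 1)"
      using zb_Pascal[of L "l - 1"] l by simp
    moreover have "\<zeta> powi (- int l) = 1" using zeta_powi_l[of "- 1"] by simp
    moreover have "\<zeta> powi (L - int (l - 1)) = 1" if "int l dvd L + 1"
    proof -
      have e: "L - int (l - 1) = L + 1 - int l" using l_gt_1 by simp
      show ?thesis unfolding e zeta_powi_eq_1_iff using that by (rule dvd_diff) simp
    qed
    ultimately show ?thesis using zb_pred_l[of L] by simp
  qed
  show ?thesis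
  proof (induction L rule: int_induct[of _ 0])
    case base
    show ?case using qb_zero_left[of "l - 1"] l_gt_1 by simp
  next
    case (step1 i)
    then show ?case by (simp add: step div_l_Suc)
  next
    case (step2 i)
    then show ?case using step[of "i - 1"] div_l_Suc[of "i - 1"] by (auto split: if_splits)
  qed
qed

end

section \<open>Pure tensors and their specialised coordinates\<close>

lemma pure_mult: "pure u c * pure v d = pure (u * v) (c * d)"
  by (simp add: pure_def mult_single)

lemma pure_one: "pure 1 1 = 1"
  by (simp add: pure_def flip: zero_pure_tensor_def)

lemma pure_power: "pure u c ^ n = pure (u ^ n) (c ^ n)"
  by (induction n) (simp_all add: pure_one pure_mult)

lemma pre_tensor_induct [case_names zero pure add uminus]:
  fixes x :: "'k::field pre_tensor"
  assumes "P 0" and p: "\<And>u c. P (pure u c)"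
    and a: "\<And>x y. P x \<Longrightarrow> P y \<Longrightarrow> P (x + y)" and m: "\<And>x. P x \<Longrightarrow> P (- x)"
  shows "P x"
proof (induction x rule: poly_mapping_add_induct)
  case (single t n)
  obtain u c where t: "t = Tensor u c" by (cases t)
  have nat: "P (Poly_Mapping.single t (int k))" for k
  proof (induction k)
    case (Suc k)
    have "Poly_Mapping.single t (int (Suc k)) = pure u c + Poly_Mapping.single t (int k)"
      by (simp add: t pure_def flip: single_add)
    then show ?case using Suc p a by simp
  qed (simp add: assms)
  show ?case
    by (cases n rule: int_cases2) (auto simp: single_uminus nat m)
qed (use assms in auto)

lift_definition UA_dE :: "nat \<Rightarrow> UA" is dE by (rule UA_set.divided_E)
lift_definition UA_dF :: "nat \<Rightarrow> UA" is dF by (rule UA_set.divided_F)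
lift_definition UA_kb :: "int \<Rightarrow> nat \<Rightarrow> UA" is kb by (rule kb_UA)
lift_definition UA_Ki :: UA is uKi by (rule UA_set.Kinv)

text \<open>The specialised coordinates, extended linearly to formal sums of tensors. That they
  depend only on the class in U_zeta is \<open>nul_th_radical\<close>.\<close>

definition theta :: "'k::field \<Rightarrow> 'k pre_tensor \<Rightarrow> nat \<Rightarrow> nat \<Rightarrow> int \<Rightarrow> 'k" where
  "theta z x a b L = pm_sum (\<lambda>t n. case t of Tensor u c \<Rightarrow>
     of_int n * c * sp z (coords (Rep_UA u) a b L)) x"

lemma theta_0 [simp]: "theta z 0 a b L = 0"
  by (simp add: theta_def)

lemma theta_pure: "theta z (pure u c) a b L = c * sp z (coords (Rep_UA u) a b L)"
  by (simp add: theta_def pure_def pm_sum_single)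

lemma theta_add: "theta z (x + y) a b L = theta z x a b L + theta z y a b L"
  unfolding theta_def by (rule pm_sum_add) (auto simp: algebra_simps split: pure_tensor.split)

lemma theta_uminus: "theta z (- x) a b L = - theta z x a b L"
  using theta_add[of z x "- x" a b L] by (simp add: eq_neg_iff_add_eq_0 add.commute)

lemma theta_diff: "theta z (x - y) a b L = theta z x a b L - theta z y a b L"
  using theta_add[of z x "- y" a b L] by (simp add: theta_uminus)

lemma theta_sum: "theta z (sum f A) a b L = (\<Sum>i\<in>A. theta z (f i) a b L)"
  by (induction A rule: infinite_finite_induct) (simp_all add: theta_add)

abbreviation pF :: "nat \<Rightarrow> 'k::field pre_tensor" where "pF n \<equiv> pure (UA_dF n) 1"
abbreviation pE :: "nat \<Rightarrow> 'k::field pre_tensor" where "pE n \<equiv> pure (UA_dE n) 1"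
abbreviation pK :: "'k::field pre_tensor" where "pK \<equiv> pure UA_K 1"
abbreviation pKi :: "'k::field pre_tensor" where "pKi \<equiv> pure UA_Ki 1"
abbreviation pkb :: "int \<Rightarrow> nat \<Rightarrow> 'k::field pre_tensor" where "pkb c t \<equiv> pure (UA_kb c t) 1"
abbreviation pc :: "'k::field \<Rightarrow> 'k pre_tensor" where "pc c \<equiv> pure 1 c"

lemma coords_Rep_integral [simp]: "coords (Rep_UA u) a b L \<in> integral_ratfun"
  by (simp add: coords_integral Rep_UA)

lemma uact_coords_integral [simp]: "uact (Rep_UA u) (coords (Rep_UA v)) a b L \<in> integral_ratfun"
  using coords_Rep_integral[of "u * v"] by (simp add: times_UA.rep_eq coords_mult)

lemma K_power_commute:
  assumes "uK * x = scl c (x * uK)"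
  shows "uK ^ m * x ^ n = scl (c ^ (m * n)) (x ^ n * uK ^ m)"
proof -
  have 1: "uK * x ^ n = scl (c ^ n) (x ^ n * uK)" for n
  proof (induction n)
    case (Suc n)
    have "uK * x ^ Suc n = scl c (x * (uK * x ^ n))"
      unfolding power_Suc mult.assoc[symmetric] assms by simp
    also have "\<dots> = scl (c ^ Suc n) (x ^ Suc n * uK)"
      unfolding Suc by (simp add: mult.assoc)
    finally show ?case .
  qed simp
  show ?thesis
  proof (induction m)
    case (Suc m)
    have "uK ^ Suc m * x ^ n = uK * (uK ^ m * x ^ n)" by (simp add: mult.assoc)
    also have "\<dots> = scl (c ^ (m * n)) (uK * x ^ n * uK ^ m)" unfolding Suc by (simp add: mult.assoc)
    also have "\<dots> = scl (c ^ (Suc m * n)) (x ^ n * uK ^ Suc m)"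
      unfolding 1 by (simp add: mult.assoc power_add mult.commute)
    finally show ?case .
  qed simp
qed

context root_of_unity
begin

abbreviation th :: "'k pre_tensor \<Rightarrow> nat \<Rightarrow> nat \<Rightarrow> int \<Rightarrow> 'k" where
  "th \<equiv> theta \<zeta>"

lemma th_pF: "th (pF n * x) a b L = zb (int a) n * th x (a - n) b L"
  by (induction x rule: pre_tensor_induct)
    (simp_all add: pure_mult theta_pure theta_add theta_uminus distrib_left times_UA.rep_eq UA_dF.rep_eq
      coords_mult uact_dF sp_mult mult.left_commute)

lemma th_pK: "th (pK * x) a b L = \<zeta> powi (L - 2 * int a) * th x a b L"
  by (induction x rule: pre_tensor_induct)
    (simp_all add: pure_mult theta_pure theta_add theta_uminus distrib_left times_UA.rep_eq UA_K.rep_eq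
      coords_mult uact_gen sp_mult mult.left_commute)

lemma th_pkb: "th (pkb c t * x) a b L = zb (L - 2 * int a + c) t * th x a b L"
  by (induction x rule: pre_tensor_induct)
    (simp_all add: pure_mult theta_pure theta_add theta_uminus distrib_left times_UA.rep_eq UA_kb.rep_eq
      coords_mult uact_kb sp_mult mult.left_commute)

lemma th_pc: "th (pc c * x) a b L = c * th x a b L"
  by (induction x rule: pre_tensor_induct)
    (simp_all add: pure_mult theta_pure theta_add theta_uminus distrib_left)

lemma th_pE1: "th (pure UA_E 1 * x) a b L
    = qi \<zeta> (int b) * th x a (b - 1) (L - 2) + qi \<zeta> (L - int a) * th x (Suc a) b L"
  by (induction x rule: pre_tensor_induct)
    (simp_all add: pure_mult theta_pure theta_add theta_uminus distrib_left times_UA.rep_eq UA_E.rep_eq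
      coords_mult uact_gen sp_mult sp_add integral_mult sp_qi_zeta mult.left_commute)

lemma th_mult_pE: "th (x * pE n) a b L = zb (int b) n * th x a (b - n) L"
  by (induction x rule: pre_tensor_induct)
    (simp_all add: pure_mult theta_pure theta_add theta_uminus distrib_left distrib_right times_UA.rep_eq UA_dE.rep_eq
      coords_mult_dE sp_mult mult.left_commute)

lemma th_1: "th 1 a b L = (if a = 0 \<and> b = 0 then 1 else 0)"
  by (simp add: theta_pure one_UA.rep_eq coords_1 arr_one_def flip: pure_one)

lemma sp_scl_powi: "x \<in> UA_set \<Longrightarrow>
    sp \<zeta> (coords (scl (qvar powi n) x) a b L) = \<zeta> powi n * sp \<zeta> (coords x a b L)"
  by (simp add: coords_scl ascl_def sp_mult coords_integral)

lemma UA_set_power: "x \<in> UA_set \<Longrightarrow> x ^ n \<in> UA_set"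
  by (induction n) (auto intro: UA_set.intros)

lemma K_power_divided_power:
  assumes "uK * x = scl (qvar powi c) (x * uK)"
  shows "uK ^ m * divided_power x n = scl (qvar powi (int m * int n * c)) (divided_power x n * uK ^ m)"
proof -
  have "(qvar powi c) ^ (m * n) = qvar powi (int m * int n * c)"
    by (metis power_int_mult power_int_of_nat mult.commute of_nat_mult)
  then show ?thesis
    using K_power_commute[OF assms, of m n] by (simp add: divided_power_scl mult.commute)
qed

text \<open>\<open>K^l\<close> passes a divided power at the price of a power of q whose exponent is
  a multiple of \<open>l\<close>, and this specialises to 1. The outer factors \<open>v\<close> and
  \<open>x\<close> let the induction pass through products.\<close>

lemma sp_K_power_l_commute:
  assumes "w \<in> UA_set" "v \<in> UA_set" "x \<in> UA_set"
  shows "sp \<zeta> (coords (v * uK ^ l * w * x) a b L) = sp \<zeta> (coords (v * w * uK ^ l * x) a b L)"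
  using assms
proof (induction arbitrary: v x rule: UA_set.induct)
  case (divided_E n)
  have "v * uK ^ l * dE n * x = scl (qvar powi (int l * int n * 2)) (v * dE n * uK ^ l * x)"
    unfolding mult.assoc[of v "uK ^ l"] K_power_divided_power[OF KE] by (simp add: mult.assoc)
  moreover have "v * dE n * uK ^ l * x \<in> UA_set"
    using divided_E by (intro UA_set.intros UA_set_power)
  ultimately show ?case by (simp only: sp_scl_powi mult.assoc[of "int l"] zeta_powi_l mult_1_left)
next
  case (divided_F n)
  have "v * uK ^ l * dF n * x = scl (qvar powi (int l * int n * (-2))) (v * dF n * uK ^ l * x)"
    unfolding mult.assoc[of v "uK ^ l"] K_power_divided_power[OF KF] by (simp add: mult.assoc)
  moreover have "v * dF n * uK ^ l * x \<in> UA_set"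
    using divided_F by (intro UA_set.intros UA_set_power)
  ultimately show ?case by (simp only: sp_scl_powi mult.assoc[of "int l"] zeta_powi_l mult_1_left)
next
  case K
  have "uK ^ l * uK = uK * uK ^ l" by (rule power_commutes)
  then show ?case by (metis mult.assoc)
next
  case Kinv
  have "uK ^ l * uKi = uKi * uK ^ l"
  proof (induction l)
    case (Suc n)
    have "uK ^ Suc n * uKi = uK * (uKi * uK ^ n)" using Suc by (simp add: mult.assoc)
    then show ?case by simp
  qed simp
  then show ?case by (metis mult.assoc)
next
  case (diff w w')
  have in_UA: "v * uK ^ l * y * x \<in> UA_set" "v * y * uK ^ l * x \<in> UA_set" if "y \<in> UA_set" for y
    using diff that by (auto intro!: UA_set.intros UA_set_power)
  show ?case
    using diff in_UA
    by (simp add: left_diff_distrib right_diff_distrib coords_diff adiff_def sp_diff coords_integral)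
next
  case (mult w w')
  have "sp \<zeta> (coords (v * uK ^ l * w * (w' * x)) a b L) = sp \<zeta> (coords (v * w * uK ^ l * (w' * x)) a b L)"
    using mult by (intro mult.IH(1)) (auto intro: UA_set.mult)
  moreover have "sp \<zeta> (coords ((v * w) * uK ^ l * w' * x) a b L) = sp \<zeta> (coords ((v * w) * w' * uK ^ l * x) a b L)"
    using mult by (intro mult.IH(2)) (auto intro: UA_set.mult)
  ultimately show ?case by (simp add: mult.assoc)
next
  case (smult w p)
  have in_UA: "v * uK ^ l * w * x \<in> UA_set" "v * w * uK ^ l * x \<in> UA_set"
    using smult by (auto intro!: UA_set.intros UA_set_power)
  show ?case
    using smult.IH[OF smult.prems] in_UA
    by (simp add: coords_scl ascl_def sp_mult coords_integral flip: scl_def)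
qed simp

lemma coords_mult_K_power:
  "coords (x * uK ^ n) a b L = qvar powi (int n * (L - 2 * int b)) * coords x a b L"
proof (induction n arbitrary: x)
  case (Suc n)
  have "coords (x * uK ^ Suc n) a b L = coords ((x * uK) * uK ^ n) a b L" by (simp add: mult.assoc)
  also have "\<dots> = qvar powi (int (Suc n) * (L - 2 * int b)) * coords x a b L"
    unfolding Suc coords_mult_K mult.assoc[symmetric] powi_shift[OF qvar_nonzero] by (simp add: algebra_simps)
  finally show ?case .
qed simp

text \<open>The largest two-sided ideal on which all coordinates vanish. A generated ideal lies in
  it as soon as the generators do.\<close>

definition th_radical :: "'k pre_tensor set" where
  "th_radical = {x. \<forall>y w a b L. th (y * x * w) a b L = 0}"

lemma ideal_th_radical: "ideal th_radical ring_of_type_algebra"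
  by (rule ideal_of_type_algebra)
    (auto simp: th_radical_def distrib_left distrib_right theta_add, (metis mult.assoc)+)

lemma th_radicalI:
  assumes "\<And>v d w e a b L. th (pure v d * x * pure w e) a b L = 0"
  shows "x \<in> th_radical"
proof -
  have "th (pure v d * x * w) a b L = 0" for v d w a b L
    by (induction w rule: pre_tensor_induct)
      (simp_all add: assms distrib_left theta_add theta_uminus)
  then have "th (y * x * w) a b L = 0" for y w a b L
    by (induction y rule: pre_tensor_induct)
      (simp_all add: distrib_right theta_add theta_uminus)
  then show ?thesis by (simp add: th_radical_def)
qed

lemma th_radical_0: "x \<in> th_radical \<Longrightarrow> th x a b L = 0"
proof -
  assume "x \<in> th_radical"
  then have "th (1 * x * 1) a b L = 0" unfolding th_radical_def by blast
  then show ?thesis by simp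
qed

lemma tensor_relations_th_radical: "tensor_relations \<zeta> \<subseteq> th_radical"
proof
  fix x assume "x \<in> tensor_relations \<zeta>"
  then consider u v c where "x = pure (u + v) c - pure u c - pure v c"
    | u c d where "x = pure u (c + d) - pure u c - pure u d"
    | p u c where "x = pure (UA_smult p u) c - pure u (laurent_eval p \<zeta> * c)"
    by (auto simp: tensor_relations_def)
  then show "x \<in> th_radical"
  proof cases
    case 1
    have i: "coords (Rep_UA v' * (Rep_UA u' * Rep_UA w)) a b L \<in> integral_ratfun" for v' u' w a b L
      using coords_Rep_integral[of "v' * (u' * w)"] by (simp add: times_UA.rep_eq)
    show ?thesis unfolding 1
      by (rule th_radicalI, simp add: left_diff_distrib right_diff_distrib pure_mult theta_diff
          theta_pure times_UA.rep_eq plus_UA.rep_eq distrib_left distrib_right coords_add aadd_def mult.assoc)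
        (simp add: sp_add i algebra_simps)
  next
    case 2
    show ?thesis unfolding 2
      by (rule th_radicalI, simp add: left_diff_distrib right_diff_distrib pure_mult theta_diff theta_pure)
        (simp add: algebra_simps)
  next
    case 3
    have i: "coords (Rep_UA v' * (Rep_UA u' * Rep_UA w)) a b L \<in> integral_ratfun" for v' u' w a b L
      using coords_Rep_integral[of "v' * (u' * w)"] by (simp add: times_UA.rep_eq)
    show ?thesis unfolding 3
      by (rule th_radicalI)
        (simp add: left_diff_distrib right_diff_distrib pure_mult theta_diff theta_pure times_UA.rep_eq
          UA_smult.rep_eq coords_scl ascl_def sp_mult i mult.assoc flip: scl_def)
  qed
qed

lemma Rep_UA_power: "Rep_UA (u ^ n) = Rep_UA u ^ n"
  by (induction n) (simp_all add: one_UA.rep_eq times_UA.rep_eq)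

text \<open>Once moved to the right end, \<open>K^l\<close> multiplies the coordinate at
  \<open>(a, b, L)\<close> by \<open>\<zeta>\<close> to the power \<open>l * (L - 2 * b)\<close>,
  which is 1.\<close>

lemma K_power_l_th_radical: "pK ^ l - 1 \<in> th_radical"
proof (rule th_radicalI)
  fix v d w e a b L
  let ?v = "Rep_UA v" and ?w = "Rep_UA w"
  have "sp \<zeta> (coords (?v * uK ^ l * ?w * 1) a b L) = sp \<zeta> (coords (?v * ?w * uK ^ l * 1) a b L)"
    by (rule sp_K_power_l_commute) (auto simp: Rep_UA UA_set.one)
  also have "\<dots> = sp \<zeta> (coords (?v * ?w) a b L)"
    using coords_Rep_integral[of "v * w"]
    by (simp add: coords_mult_K_power sp_mult zeta_powi_l times_UA.rep_eq)
  finally show "th (pure v d * (pK ^ l - 1) * pure w e) a b L = 0"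
    by (simp add: pure_power left_diff_distrib right_diff_distrib pure_mult theta_diff theta_pure
        times_UA.rep_eq Rep_UA_power UA_K.rep_eq)
qed

end

section \<open>The projection onto the specialised algebra\<close>

lemma (in ring_hom_ring) hom_minus: "x \<in> carrier R \<Longrightarrow> y \<in> carrier R \<Longrightarrow> h (x \<ominus> y) = h x \<ominus>\<^bsub>S\<^esub> h y"
  by (simp add: a_minus_def)

lemma carrier_FactRing: "carrier (R Quot I) = (\<lambda>x. I +>\<^bsub>R\<^esub> x) ` carrier R"
  unfolding FactRing_def using A_RCOSETS_def'[of R I] by auto

lemma zero_FactRing: "\<zero>\<^bsub>R Quot I\<^esub> = I"
  by (simp add: FactRing_def)

lemma (in ideal) rcos_eq_iff:
  assumes "x \<in> carrier R" "y \<in> carrier R"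
  shows "I +> x = I +> y \<longleftrightarrow> x \<ominus> y \<in> I"
proof -
  interpret h: ring_hom_ring R "R Quot I" "(+>) I" by (rule rcos_ring_hom_ring)
  have mem: "I +> z = I \<longleftrightarrow> z \<in> I" if "z \<in> carrier R" for z
    using that a_rcos_zero[OF ideal_axioms] rcos_const_imp_mem by blast
  have "I +> (x \<ominus> y) = (I +> x) \<ominus>\<^bsub>R Quot I\<^esub> (I +> y)"
    using assms by (rule h.hom_minus)
  moreover have "(I +> x) \<ominus>\<^bsub>R Quot I\<^esub> (I +> y) = \<zero>\<^bsub>R Quot I\<^esub> \<longleftrightarrow> I +> x = I +> y"
    using h.S.r_right_minus_eq[OF h.hom_closed[OF assms(1)] h.hom_closed[OF assms(2)]] .
  ultimately show ?thesis using mem[of "x \<ominus> y"] assms by (simp only: zero_FactRing minus_closed)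
qed

lemma nat_pow_type_algebra: "x [^]\<^bsub>ring_of_type_algebra\<^esub> (n::nat) = (x :: 'a::ring_1) ^ n"
proof -
  interpret R: ring "ring_of_type_algebra :: 'a ring" by (rule ring_ring_of_type_algebra)
  show ?thesis by (induction n) (simp_all add: power_commutes)
qed

lemma minus_type_algebra: "x \<ominus>\<^bsub>ring_of_type_algebra\<^esub> y = (x - y :: 'a::ring_1)"
proof -
  interpret R: ring "ring_of_type_algebra :: 'a ring" by (rule ring_ring_of_type_algebra)
  have "\<ominus>\<^bsub>ring_of_type_algebra\<^esub> y = - y" by (rule R.minus_equality) auto
  then show ?thesis by (simp add: a_minus_def)
qed

lemma (in ring_hom_ring) hom_nat_pow_ring: "x \<in> carrier R \<Longrightarrow> h (x [^] (n::nat)) = h x [^]\<^bsub>S\<^esub> n"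
  by (induction n) simp_all

context root_of_unity
begin

abbreviation PR :: "'k pre_tensor ring" where "PR \<equiv> ring_of_type_algebra"
abbreviation U where "U \<equiv> Uzeta l \<zeta>"

lemma ideal_tensor_ideal: "ideal (tensor_ideal \<zeta>) PR"
  unfolding tensor_ideal_def by (rule ring.genideal_ideal[OF ring_ring_of_type_algebra]) simp

lemma tensor_relations_ideal: "tensor_relations \<zeta> \<subseteq> tensor_ideal \<zeta>"
  unfolding tensor_ideal_def by (rule ring.genideal_self[OF ring_ring_of_type_algebra]) simp

lemma hom_Uhat: "ring_hom_ring PR (Uhat \<zeta>) (\<lambda>x. tensor_ideal \<zeta> +>\<^bsub>PR\<^esub> x)"
  unfolding Uhat_def by (rule ideal.rcos_ring_hom_ring[OF ideal_tensor_ideal])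

lemma ring_Uhat: "ring (Uhat \<zeta>)"
  unfolding Uhat_def by (rule ideal.quotient_is_ring[OF ideal_tensor_ideal])

lemma carrier_Uhat: "carrier (Uhat \<zeta>) = range (\<lambda>x. tensor_ideal \<zeta> +>\<^bsub>PR\<^esub> x)"
  by (simp add: Uhat_def carrier_FactRing)

definition K_rel where
  "K_rel = Uhat_tensor \<zeta> UA_K 1 [^]\<^bsub>Uhat \<zeta>\<^esub> l \<ominus>\<^bsub>Uhat \<zeta>\<^esub> \<one>\<^bsub>Uhat \<zeta>\<^esub>"

lemma K_rel_eq: "K_rel = tensor_ideal \<zeta> +>\<^bsub>PR\<^esub> (pK ^ l - 1)"
proof -
  interpret h: ring_hom_ring PR "Uhat \<zeta>" "\<lambda>x. tensor_ideal \<zeta> +>\<^bsub>PR\<^esub> x" by (rule hom_Uhat)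
  have "tensor_ideal \<zeta> +>\<^bsub>PR\<^esub> (pK [^]\<^bsub>PR\<^esub> l \<ominus>\<^bsub>PR\<^esub> \<one>\<^bsub>PR\<^esub>) = K_rel"
    by (simp only: h.hom_minus h.hom_nat_pow_ring h.R.nat_pow_closed h.R.one_closed h.hom_one
        ring_of_type_algebra_simps(1) UNIV_I K_rel_def Uhat_tensor_def)
  then show ?thesis by (simp add: nat_pow_type_algebra minus_type_algebra)
qed

lemma ideal_K_ideal: "ideal (K_ideal l \<zeta>) (Uhat \<zeta>)"
  unfolding K_ideal_def K_rel_def[symmetric]
  by (rule ring.genideal_ideal[OF ring_Uhat]) (auto simp: K_rel_eq carrier_Uhat)

lemma K_rel_in: "K_rel \<in> K_ideal l \<zeta>"
  unfolding K_ideal_def K_rel_def[symmetric]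
  by (rule ring.genideal_self'[OF ring_Uhat]) (auto simp: K_rel_eq carrier_Uhat)

text \<open>Elements of U_zeta are cosets of cosets. The proof works with representatives in a
  type-class ring and with equations between their images, which replaces coset arithmetic.\<close>

definition proj :: "'k pre_tensor \<Rightarrow> 'k pre_tensor set set" where
  "proj x = K_ideal l \<zeta> +>\<^bsub>Uhat \<zeta>\<^esub> (tensor_ideal \<zeta> +>\<^bsub>PR\<^esub> x)"

lemma Uzeta_tensor_eq: "Uzeta_tensor l \<zeta> u c = proj (pure u c)"
  by (simp add: Uzeta_tensor_def Uhat_tensor_def proj_def)

abbreviation U0 where "U0 \<equiv> Uhat \<zeta> Quot K_ideal l \<zeta>"

lemma U_simps [simp]:
  "carrier U = carrier U0" "monoid.mult U = monoid.mult U0" "one U = one U0" "zero U = zero U0" "add U = add U0"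
  by (simp_all add: Uzeta_def Let_def ring.defs)

lemma smult_U: "module.smult U c x = proj (pc c) \<otimes>\<^bsub>U0\<^esub> x"
  by (simp add: Uzeta_def Let_def ring.defs module.defs Uzeta_tensor_eq)

lemma hom_proj0: "ring_hom_ring PR U0 proj"
proof -
  interpret h: ring_hom_ring PR "Uhat \<zeta>" "\<lambda>x. tensor_ideal \<zeta> +>\<^bsub>PR\<^esub> x" by (rule hom_Uhat)
  interpret g: ring_hom_ring "Uhat \<zeta>" U0 "\<lambda>x. K_ideal l \<zeta> +>\<^bsub>Uhat \<zeta>\<^esub> x"
    by (rule ideal.rcos_ring_hom_ring[OF ideal_K_ideal])
  have c: "tensor_ideal \<zeta> +>\<^bsub>PR\<^esub> x \<in> carrier (Uhat \<zeta>)" for x by (simp add: carrier_Uhat)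
  show ?thesis
    unfolding proj_def
    by (rule ring_hom_ringI[OF ring_ring_of_type_algebra g.S.ring_axioms])
      (simp_all only: h.hom_mult h.hom_add h.hom_one g.hom_mult g.hom_add g.hom_one
        g.hom_closed c ring_of_type_algebra_simps(1) UNIV_I)
qed

lemma proj_hom: "proj (x + y) = proj x \<oplus>\<^bsub>U\<^esub> proj y" "proj (x * y) = proj x \<otimes>\<^bsub>U\<^esub> proj y"
    "proj 1 = \<one>\<^bsub>U\<^esub>" "proj 0 = \<zero>\<^bsub>U\<^esub>"
proof -
  interpret h: ring_hom_ring PR U0 proj by (rule hom_proj0)
  show "proj (x + y) = proj x \<oplus>\<^bsub>U\<^esub> proj y" using h.hom_add[of x y] by simp
  show "proj (x * y) = proj x \<otimes>\<^bsub>U\<^esub> proj y" using h.hom_mult[of x y] by simp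
  show "proj 1 = \<one>\<^bsub>U\<^esub>" using h.hom_one by simp
  show "proj 0 = \<zero>\<^bsub>U\<^esub>" using h.hom_zero by simp
qed

lemma carrier_U: "carrier U = range proj"
proof -
  have "carrier U0 = (\<lambda>x. K_ideal l \<zeta> +>\<^bsub>Uhat \<zeta>\<^esub> x) ` carrier (Uhat \<zeta>)"
    by (rule carrier_FactRing)
  then show ?thesis by (auto simp: carrier_Uhat proj_def image_image)
qed

lemma smult_proj: "c \<odot>\<^bsub>U\<^esub> proj x = proj (pc c * x)"
  by (simp add: smult_U proj_hom)

lemma ring_U: "ring U"
proof -
  interpret U0: ring U0 by (rule ideal.quotient_is_ring[OF ideal_K_ideal])
  show ?thesis
  proof (rule ringI)
    have "\<exists>y\<in>carrier U. y \<oplus>\<^bsub>U\<^esub> x = \<zero>\<^bsub>U\<^esub>" if "x \<in> carrier U" for x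
      using that U0.l_neg[of x] U0.a_inv_closed[of x] by auto
    then show "abelian_group U"
      by (intro abelian_groupI) (simp_all add: U0.a_ac)
    show "Group.monoid U"
      by (rule monoidI) (simp_all add: U0.m_assoc)
  qed (simp_all add: U0.l_distr U0.r_distr)
qed

definition nul :: "'k pre_tensor set" where
  "nul = {x. proj x = \<zero>\<^bsub>U\<^esub>}"

lemma proj_diff: "proj (x - y) = proj x \<ominus>\<^bsub>U\<^esub> proj y" and proj_uminus: "proj (- y) = \<ominus>\<^bsub>U\<^esub> proj y"
proof -
  interpret U: ring U by (rule ring_U)
  have m: "\<ominus>\<^bsub>U\<^esub> proj y = proj (- y)" for y
    by (rule U.minus_equality) (simp_all only: carrier_U rangeI proj_hom(1,4)[symmetric] left_minus)
  then show "proj (- y) = \<ominus>\<^bsub>U\<^esub> proj y" by simp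
  have "proj (x - y) = proj (x + - y)" by simp
  then show "proj (x - y) = proj x \<ominus>\<^bsub>U\<^esub> proj y"
    unfolding proj_hom(1) by (simp only: m[symmetric] a_minus_def)
qed

lemma proj_eq_iff: "proj x = proj y \<longleftrightarrow> x - y \<in> nul"
proof -
  interpret U: ring U by (rule ring_U)
  have "proj x \<in> carrier U" "proj y \<in> carrier U" by (simp_all only: carrier_U rangeI)
  then show ?thesis
    unfolding nul_def by (simp only: mem_Collect_eq proj_diff U.r_right_minus_eq)
qed

lemma nul_iff: "x \<in> nul \<longleftrightarrow> tensor_ideal \<zeta> +>\<^bsub>PR\<^esub> x \<in> K_ideal l \<zeta>"
proof -
  interpret I: ideal "K_ideal l \<zeta>" "Uhat \<zeta>" by (rule ideal_K_ideal)
  have "\<zero>\<^bsub>U\<^esub> = K_ideal l \<zeta>" by (simp add: zero_FactRing)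
  moreover have "tensor_ideal \<zeta> +>\<^bsub>PR\<^esub> x \<in> carrier (Uhat \<zeta>)" by (simp add: carrier_Uhat)
  ultimately show ?thesis
    unfolding nul_def proj_def using I.a_rcos_zero[OF ideal_K_ideal] I.rcos_const_imp_mem by auto
qed

lemma tensor_ideal_nul: "tensor_ideal \<zeta> \<subseteq> nul"
proof
  fix x assume "x \<in> tensor_ideal \<zeta>"
  then have "tensor_ideal \<zeta> +>\<^bsub>PR\<^esub> x = tensor_ideal \<zeta> +>\<^bsub>PR\<^esub> 0"
    using ring.a_rcos_zero[OF ring_ring_of_type_algebra ideal_tensor_ideal]
      additive_subgroup.zero_closed[OF ideal.axioms(1)[OF ideal_tensor_ideal]] by auto
  then have "proj x = proj 0" by (simp add: proj_def)
  then show "x \<in> nul" by (simp only: nul_def mem_Collect_eq proj_hom(4))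
qed

lemma K_nul: "pK ^ l - 1 \<in> nul"
  using K_rel_in by (simp add: nul_iff K_rel_eq)

text \<open>This makes the coordinates functions on U_zeta. The tensor ideal lies in
  \<open>th_radical\<close>, whose image in the first quotient is an ideal containing
  \<open>K_rel\<close> and thus contains \<open>K_ideal\<close>.\<close>

lemma nul_th_radical: "nul \<subseteq> th_radical"
proof
  fix x assume "x \<in> nul"
  interpret R: ring PR by (rule ring_ring_of_type_algebra)
  let ?J = "(\<lambda>x. tensor_ideal \<zeta> +>\<^bsub>PR\<^esub> x) ` th_radical"
  have sub: "tensor_ideal \<zeta> \<subseteq> th_radical"
    unfolding tensor_ideal_def by (rule R.genideal_minimal[OF ideal_th_radical tensor_relations_th_radical])
  have J: "ideal ?J (Uhat \<zeta>)"
    unfolding Uhat_def by (rule R.ring_ideal_imp_quot_ideal[OF ideal_tensor_ideal ideal_th_radical])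
  have "K_rel \<in> ?J" unfolding K_rel_eq using K_power_l_th_radical by blast
  then have "K_ideal l \<zeta> \<subseteq> ?J"
    unfolding K_ideal_def K_rel_def[symmetric] by (intro ring.genideal_minimal[OF ring_Uhat J]) simp
  then obtain y where y: "y \<in> th_radical" "tensor_ideal \<zeta> +>\<^bsub>PR\<^esub> x = tensor_ideal \<zeta> +>\<^bsub>PR\<^esub> y"
    using \<open>x \<in> nul\<close> unfolding nul_iff by blast
  then have "x - y \<in> tensor_ideal \<zeta>"
    using ideal.rcos_eq_iff[OF ideal_tensor_ideal, of x y] by (simp add: minus_type_algebra)
  then have "x - y \<in> th_radical" using sub by blast
  then have "(x - y) + y \<in> th_radical"
    using y(1) additive_subgroup.a_closed[OF ideal.axioms(1)[OF ideal_th_radical], of "x - y" y] by simp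
  then show "x \<in> th_radical" by simp
qed

end

section \<open>A basis of the specialised algebra\<close>

text \<open>At \<open>\<zeta>\<close> this makes the product of binomials of orders l r and l a
  nonzero multiple of the one of order l (r + 1).\<close>

lemma kb_add: "scl (qb (int (m + n)) n) (kb c (m + n)) = kb c m * kb (c - int m) n"
proof (induction n)
  case (Suc n)
  have "scl (qi qvar (int (Suc n))) (scl (qb (int (m + Suc n)) (Suc n)) (kb c (m + Suc n)))
    = scl (qb (int (m + n) + 1) (Suc n) * qi qvar (int (Suc n))) (kb c (Suc (m + n)))"
    by (simp add: mult.commute add.commute)
  also have "\<dots> = scl (qb (int (m + n)) n) (scl (qi qvar (int (Suc (m + n)))) (kb c (Suc (m + n))))"
    unfolding qb_Suc_shift by (simp add: mult.commute add.commute)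
  also have "\<dots> = scl (qb (int (m + n)) n) (kb c (m + n)) * Kb (c - int (m + n))"
    unfolding kb_Suc_scl by simp
  also have "\<dots> = kb c m * (kb (c - int m) n * Kb (c - int m - int n))"
    unfolding Suc by (simp add: mult.assoc algebra_simps)
  also have "\<dots> = scl (qi qvar (int (Suc n))) (kb c m * kb (c - int m) (Suc n))"
    unfolding kb_Suc_scl[symmetric] by simp
  finally show ?case by (simp only: scl_cancel qi_Suc_nonzero not_False_eq_True)
qed simp

lemma kb_1: "kb c 1 = Kb c"
  using kb_Suc_scl[of 0 c] qi_1[OF qvar_neq_inverse] by simp

lemma finite_degree_roots:
  fixes p :: "'a::idom poly"
  assumes "finite A" "card A = n" "\<And>x. x \<in> A \<Longrightarrow> poly p x = 0" "\<And>i. i \<ge> n \<Longrightarrow> coeff p i = 0"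
  shows "p = 0"
proof (rule ccontr)
  assume "p \<noteq> 0"
  then have "coeff p (degree p) \<noteq> 0" by simp
  then have "degree p < n" using assms(4) by (meson not_le)
  moreover have "A \<subseteq> {x. poly p x = 0}" using assms(3) by blast
  then have "card A \<le> card {x. poly p x = 0}" using poly_roots_finite[OF \<open>p \<noteq> 0\<close>] by (rule card_mono[rotated])
  moreover have "card {x. poly p x = 0} \<le> degree p" using \<open>p \<noteq> 0\<close> by (rule card_poly_roots_bound)
  ultimately show False using assms(2) by simp
qed

text \<open>Independence of monomials on \<open>N\<close> points, as for a Vandermonde matrix: a
  polynomial of degree below \<open>N\<close> with \<open>N\<close> roots is 0.\<close>

lemma sum_monomials_eq_0:
  fixes d :: "nat \<Rightarrow> 'a::idom"
  assumes "finite A" "card A \<ge> N" "\<And>x. x \<in> A \<Longrightarrow> (\<Sum>j<N. d j * x ^ j) = 0" "j < N"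
  shows "d j = 0"
proof -
  obtain B where B: "B \<subseteq> A" "card B = N" "finite B" using assms(1,2) by (metis obtain_subset_with_card_n)
  define p where "p = (\<Sum>j<N. monom (d j) j)"
  have c: "coeff p i = (if i < N then d i else 0)" for i
  proof -
    have "coeff p i = (\<Sum>j<N. if j = i then d j else 0)"
      unfolding p_def coeff_sum by (rule sum.cong) auto
    then show ?thesis by simp
  qed
  have "p = 0"
  proof (rule finite_degree_roots[OF B(3,2)])
    show "poly p x = 0" if "x \<in> B" for x
      using assms(3)[of x] that B(1) by (auto simp: p_def poly_sum poly_monom)
  qed (simp add: c)
  then show ?thesis using c[of j] assms(4) by simp
qed

context root_of_unity
begin

lemma proj_add_cong: "proj x = proj x' \<Longrightarrow> proj y = proj y' \<Longrightarrow> proj (x + y) = proj (x' + y')"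
  by (simp only: proj_hom)

lemma proj_mult_cong: "proj x = proj x' \<Longrightarrow> proj y = proj y' \<Longrightarrow> proj (x * y) = proj (x' * y')"
  by (simp only: proj_hom)

lemma proj_uminus_cong: "proj x = proj x' \<Longrightarrow> proj (- x) = proj (- x')"
  by (simp only: proj_uminus)

lemma proj_diff_cong: "proj x = proj x' \<Longrightarrow> proj y = proj y' \<Longrightarrow> proj (x - y) = proj (x' - y')"
  by (simp only: proj_diff)

lemma proj_power_cong: "proj x = proj y \<Longrightarrow> proj (x ^ n) = proj (y ^ n)"
  by (induction n) (simp_all only: power_0 power_Suc proj_hom)

lemma proj_sum_cong: "(\<And>i. i \<in> A \<Longrightarrow> proj (f i) = proj (g i)) \<Longrightarrow> proj (sum f A) = proj (sum g A)"
proof (induction A rule: infinite_finite_induct)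
  case (insert i A)
  have "proj (f i + sum f A) = proj (g i + sum g A)"
    using insert by (intro proj_add_cong) auto
  then show ?case using insert by simp
qed simp_all

lemma th_cong: "proj x = proj y \<Longrightarrow> th x a b L = th y a b L"
  using nul_th_radical th_radical_0[of "x - y" a b L] unfolding proj_eq_iff by (auto simp: theta_diff)

section \<open>Tensor calculus in U_zeta\<close>

lemma proj_tensor: "x - y \<in> tensor_relations \<zeta> \<Longrightarrow> proj x = proj y"
  unfolding proj_eq_iff using tensor_relations_ideal tensor_ideal_nul by blast

lemma proj_pure_add_left: "proj (pure (u + v) c) = proj (pure u c + pure v c)"
  by (rule proj_tensor) (unfold tensor_relations_def diff_diff_eq[symmetric], blast)

lemma proj_pure_add_right: "proj (pure u (c + d)) = proj (pure u c + pure u d)"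
  by (rule proj_tensor) (unfold tensor_relations_def diff_diff_eq[symmetric], blast)

lemma proj_pure_smult: "proj (pure (UA_smult p u) c) = proj (pure u (laurent_eval p \<zeta> * c))"
  by (rule proj_tensor) (unfold tensor_relations_def, blast)

lemma proj_cancel: "proj (x + z) = proj (y + z) \<Longrightarrow> proj x = proj y"
  unfolding proj_eq_iff by simp

lemma proj_pure_0: "proj (pure u 0) = proj 0" "proj (pure 0 c) = proj 0"
proof -
  have "proj (0 + pure u 0) = proj (pure u 0 + pure u 0)" using proj_pure_add_right[of u 0 0] by simp
  then show "proj (pure u 0) = proj 0" by (metis proj_cancel)
  have "proj (0 + pure 0 c) = proj (pure 0 c + pure 0 c)" using proj_pure_add_left[of 0 0 c] by simp
  then show "proj (pure 0 c) = proj 0" by (metis proj_cancel)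
qed

lemma proj_pure_uminus: "proj (pure u (- c)) = proj (- pure u c)" "proj (pure (- u) c) = proj (- pure u c)"
proof -
  have "proj (pure u (- c) + pure u c) = proj (- pure u c + pure u c)"
    using proj_pure_add_right[of u "- c" c] by (simp add: proj_pure_0)
  then show "proj (pure u (- c)) = proj (- pure u c)" by (rule proj_cancel)
  have "proj (pure (- u) c + pure u c) = proj (- pure u c + pure u c)"
    using proj_pure_add_left[of "- u" u c] by (simp add: proj_pure_0)
  then show "proj (pure (- u) c) = proj (- pure u c)" by (rule proj_cancel)
qed

lemma pc_pure: "pc c * pure u d = pure u (c * d)"
  by (simp add: pure_mult)

lemma pc_commute: "x * pc c = pc c * x"
  by (induction x rule: pre_tensor_induct)
    (simp_all add: pure_mult mult.commute distrib_left distrib_right)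

lemma pc_pc: "pc c * (pc d * x) = pc (c * d) * x"
  by (simp add: pure_mult flip: mult.assoc)

lemma pc_1 [simp]: "pc 1 = 1"
  by (rule pure_one)

lemma proj_pc_add: "proj (pc (c + d) * x) = proj (pc c * x + pc d * x)"
  unfolding distrib_right[symmetric] by (intro proj_mult_cong proj_pure_add_right refl)

lemma proj_pc_0: "proj (pc 0 * x) = proj 0"
  using proj_mult_cong[OF proj_pure_0(1) refl, of 1 x] by simp

lemma proj_pc_uminus: "proj (pc (- c) * x) = proj (- (pc c * x))"
  using proj_mult_cong[OF proj_pure_uminus(1)[of 1 c] refl, of x] by simp

lemma proj_pc_m1: "proj (pc (- 1) * x) = proj (- x)"
  using proj_pc_uminus[of 1 x] by simp

lemma proj_pc_cancel: "c \<noteq> 0 \<Longrightarrow> proj (pc c * x) = proj y \<Longrightarrow> proj x = proj (pc (inverse c) * y)"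
  using proj_mult_cong[of "pc (inverse c)" "pc (inverse c)" "pc c * x" y] by (simp add: pc_pc)

text \<open>An integral scalar that crosses the tensor sign becomes its value at
  \<open>\<zeta>\<close>; this is how identities with quantum coefficients descend.\<close>

lemma proj_scl:
  assumes "r \<in> integral_ratfun" "Rep_UA u = scl r (Rep_UA v)"
  shows "proj (pure u c) = proj (pc (sp \<zeta> r) * pure v c)"
proof -
  obtain p where p: "r = laurent_eval p qvar" using assms(1) by (auto simp: integral_ratfun_def)
  have "u = UA_smult p v"
    using assms(2) by (simp add: p scl_def UA_smult.rep_eq flip: Rep_UA_inject)
  then show ?thesis using proj_pure_smult[of p v c] by (simp add: pc_pure p)
qed

abbreviation pH :: "'k pre_tensor" where "pH \<equiv> pkb 0 l"

lemma pK_pkb: "pK * pkb c t = pkb c t * pK"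
proof -
  have "UA_K * UA_kb c t = UA_kb c t * UA_K"
    by (simp add: times_UA.rep_eq UA_K.rep_eq UA_kb.rep_eq K_kb flip: Rep_UA_inject)
  then show ?thesis by (simp add: pure_mult)
qed

lemma pKi: "proj pKi = proj (pK ^ (l - 1))"
proof -
  have "UA_Ki * UA_K = 1" by (simp add: times_UA.rep_eq UA_K.rep_eq UA_Ki.rep_eq one_UA.rep_eq flip: Rep_UA_inject)
  then have "pKi * pK = (1 :: 'k pre_tensor)" by (simp add: pure_mult pure_one)
  moreover have "pK ^ l = (pK * pK ^ (l - 1) :: 'k pre_tensor)" using l_gt_1 by (cases l) auto
  then have "pKi * pK ^ l = (pKi * pK) * (pK ^ (l - 1) :: 'k pre_tensor)" by (simp only: mult.assoc)
  ultimately have "pKi * pK ^ l = (pK ^ (l - 1) :: 'k pre_tensor)" by simp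
  moreover have "proj (pKi * pK ^ l) = proj (pKi * 1)"
    by (rule proj_mult_cong) (simp_all add: proj_eq_iff K_nul)
  ultimately show ?thesis by simp
qed

text \<open>The span of the products \<open>K^i H^j\<close>, closed under equality of images so that
  membership is a property of elements of U_zeta.\<close>

inductive_set cart :: "'k pre_tensor set" where
  base: "pc c * pK ^ i * pH ^ j \<in> cart"
| add: "x \<in> cart \<Longrightarrow> y \<in> cart \<Longrightarrow> x + y \<in> cart"
| proj: "x \<in> cart \<Longrightarrow> proj x = proj y \<Longrightarrow> y \<in> cart"

lemma cart_pc: "pc c \<in> cart"
  using cart.base[of c 0 0] by simp

lemma cart_1: "1 \<in> cart"
  using cart_pc[of 1] by simp

lemma cart_pc_mult: "x \<in> cart \<Longrightarrow> pc c * x \<in> cart"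
proof (induction rule: cart.induct)
  case (base d i j)
  then show ?case using cart.base[of "c * d" i j] by (simp add: pc_pc mult.assoc)
next
  case (proj x y)
  then show ?case by (metis cart.proj proj_mult_cong)
qed (auto simp: distrib_left intro: cart.add)

lemma cart_pK_mult: "x \<in> cart \<Longrightarrow> pK * x \<in> cart"
proof (induction rule: cart.induct)
  case (base d i j)
  have "pK * (pc d * pK ^ i * pH ^ j) = pc d * pK ^ Suc i * pH ^ j"
    by (simp add: pc_commute[symmetric] mult.assoc)
  then show ?case by (metis cart.base)
next
  case (proj x y)
  then show ?case by (metis cart.proj proj_mult_cong)
qed (auto simp: distrib_left intro: cart.add)

lemma pH_pK_power: "pH * pK ^ i = pK ^ i * pH"
proof (induction i)
  case (Suc i)
  have "pH * pK ^ Suc i = (pH * pK) * pK ^ i" by (simp only: power_Suc mult.assoc)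
  also have "\<dots> = pK * (pH * pK ^ i)" by (simp only: pK_pkb[symmetric] mult.assoc)
  also have "\<dots> = pK ^ Suc i * pH" by (simp only: Suc power_Suc mult.assoc)
  finally show ?case .
qed simp

lemma cart_pH_mult: "x \<in> cart \<Longrightarrow> pH * x \<in> cart"
proof (induction rule: cart.induct)
  case (base d i j)
  have "pH * (pc d * pK ^ i * pH ^ j) = (pH * pc d) * pK ^ i * pH ^ j" by (simp only: mult.assoc)
  also have "\<dots> = pc d * (pH * pK ^ i) * pH ^ j" unfolding pc_commute[of pH] by (simp only: mult.assoc)
  also have "\<dots> = pc d * pK ^ i * pH ^ Suc j" by (simp only: pH_pK_power power_Suc mult.assoc)
  finally have "pH * (pc d * pK ^ i * pH ^ j) = pc d * pK ^ i * pH ^ Suc j" .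
  then show ?case by (metis cart.base)
next
  case (proj x y)
  then show ?case by (metis cart.proj proj_mult_cong)
qed (auto simp: distrib_left intro: cart.add)

lemma cart_uminus: "x \<in> cart \<Longrightarrow> - x \<in> cart"
  by (rule cart.proj[OF cart_pc_mult proj_pc_m1])

lemma cart_0: "0 \<in> cart"
  using cart.add[OF cart_1 cart_uminus[OF cart_1]] by simp

lemma cart_diff: "x \<in> cart \<Longrightarrow> y \<in> cart \<Longrightarrow> x - y \<in> cart"
  using cart.add[OF _ cart_uminus] by fastforce

lemma cart_mult: "x \<in> cart \<Longrightarrow> y \<in> cart \<Longrightarrow> x * y \<in> cart"
proof (induction rule: cart.induct)
  case (base c i j)
  have "pH ^ j * y \<in> cart"
    by (induction j) (auto simp: base mult.assoc cart_pH_mult)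
  then have "pK ^ i * (pH ^ j * y) \<in> cart"
    by (induction i) (auto simp: mult.assoc cart_pK_mult)
  then show ?case by (auto simp: mult.assoc cart_pc_mult)
next
  case (proj x x')
  then show ?case by (metis cart.proj proj_mult_cong)
qed (auto simp: distrib_right intro: cart.add)

lemma cart_pK: "pK \<in> cart"
  using cart_pK_mult[OF cart_1] by simp

lemma cart_pK_power: "pK ^ n \<in> cart"
  by (induction n) (auto simp: cart_1 cart_pK_mult)

lemma cart_pKi: "pKi \<in> cart"
  by (rule cart.proj[OF cart_pK_power pKi[symmetric]])

lemma UA_kb_Suc: "proj (pc (qi \<zeta> (int (Suc t))) * pkb c (Suc t)) = proj (pkb c t * pkb (c - int t) 1)"
proof -
  have "Rep_UA (UA_kb c t * UA_kb (c - int t) 1) = scl (qi qvar (int (Suc t))) (Rep_UA (UA_kb c (Suc t)))"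
    unfolding times_UA.rep_eq UA_kb.rep_eq kb_1 kb_Suc_scl ..
  then show ?thesis
    by (simp only: pure_mult mult_1_right proj_scl[OF integral_qi] sp_qi_zeta)
qed

lemma UA_kb_add: "proj (pc (zb (int (m + n)) n) * pkb c (m + n)) = proj (pkb c m * pkb (c - int m) n)"
proof -
  have "Rep_UA (UA_kb c m * UA_kb (c - int m) n) = scl (qb (int (m + n)) n) (Rep_UA (UA_kb c (m + n)))"
    unfolding times_UA.rep_eq UA_kb.rep_eq kb_add ..
  then show ?thesis
    by (simp only: pure_mult mult_1_right proj_scl[OF integral_qb])
qed

lemma UA_kb_Pascal:
  "proj (pkb (c + 1) (Suc t)) = proj (pc (\<zeta> powi (- int (Suc t))) * pkb c (Suc t)
      + pc (\<zeta> powi (c - int t)) * (pK * pkb c t))"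
proof -
  obtain p where p: "qvar powi (- int (Suc t)) = laurent_eval p qvar"
    using integral_powi[of "- int (Suc t)"] by (auto simp: integral_ratfun_def)
  obtain r where r: "qvar powi (c - int t) = laurent_eval r qvar"
    using integral_powi[of "c - int t"] by (auto simp: integral_ratfun_def)
  have "UA_kb (c + 1) (Suc t) = UA_smult p (UA_kb c (Suc t)) + UA_smult r (UA_K * UA_kb c t)"
    unfolding Rep_UA_inject[symmetric] plus_UA.rep_eq UA_smult.rep_eq times_UA.rep_eq UA_kb.rep_eq UA_K.rep_eq
    using kb_Pascal[of c t] unfolding p r by (simp only: scl_def)
  moreover have "laurent_eval p \<zeta> = \<zeta> powi (- int (Suc t))" "laurent_eval r \<zeta> = \<zeta> powi (c - int t)"
    using sp_powi[of \<zeta> "- int (Suc t)"] sp_powi[of \<zeta> "c - int t"] unfolding p r by simp_all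
  ultimately have "proj (pkb (c + 1) (Suc t))
      = proj (pure (UA_kb c (Suc t)) (\<zeta> powi (- int (Suc t)) * 1) + pure (UA_K * UA_kb c t) (\<zeta> powi (c - int t) * 1))"
    by (metis proj_pure_add_left proj_pure_smult proj_add_cong)
  then show ?thesis by (simp only: pc_pure pure_mult mult_1_left)
qed

text \<open>\<open>[K; c]\<close> is integral, but its expression by \<open>K\<close> and the
  inverse of \<open>K\<close> has a denominator. So the equation is multiplied by q - 1/q,
  specialised, and then divided by \<open>\<zeta> - 1/\<zeta>\<close>, which is nonzero.\<close>

lemma cart_pkb_1: "pkb c 1 \<in> cart"
proof -
  let ?d = "\<zeta> powi 1 - \<zeta> powi (-1)"
  obtain p where p: "qvar powi 1 - qvar powi (-1) = laurent_eval p qvar"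
    using integral_diff[OF integral_powi integral_powi, of 1 "-1"] by (auto simp: integral_ratfun_def)
  obtain r where r: "qvar powi c = laurent_eval r qvar"
    using integral_powi[of c] by (auto simp: integral_ratfun_def)
  obtain s where s: "qvar powi (- c) = laurent_eval s qvar"
    using integral_powi[of "- c"] by (auto simp: integral_ratfun_def)
  have nz: "qvar powi 1 - qvar powi (-1) \<noteq> 0"
    using qvar_neq_inverse by (simp add: power_int_minus)
  have "scl (qvar powi 1 - qvar powi (-1)) (Kb c) = scl (qvar powi c) uK - scl (qvar powi (- c)) uKi"
    using qvar_neq_inverse by (simp add: Kb_def power_int_minus)
  then have "UA_smult p (UA_kb c 1) = UA_smult r UA_K - UA_smult s UA_Ki"
    unfolding Rep_UA_inject[symmetric] minus_UA.rep_eq UA_smult.rep_eq UA_kb.rep_eq UA_K.rep_eq UA_Ki.rep_eq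
      kb_1 p r s scl_def .
  then have "UA_smult p (UA_kb c 1) + UA_smult s UA_Ki = UA_smult r UA_K" by simp
  moreover have "sp \<zeta> (qvar powi 1 - qvar powi (-1)) = ?d"
    by (simp only: sp_diff[OF integral_powi integral_powi] sp_powi)
  then have ev: "laurent_eval p \<zeta> = ?d" "laurent_eval r \<zeta> = \<zeta> powi c" "laurent_eval s \<zeta> = \<zeta> powi (- c)"
    using sp_powi[of \<zeta> c] sp_powi[of \<zeta> "- c"] unfolding p r s sp_laurent_eval .
  ultimately have "proj (pc ?d * pkb c 1 + pc (\<zeta> powi (- c)) * pKi) = proj (pc (\<zeta> powi c) * pK)"
    unfolding pc_pure ev[symmetric] by (metis proj_pure_add_left proj_pure_smult proj_add_cong)
  then have "proj (pc ?d * pkb c 1 + pc (\<zeta> powi (- c)) * pKi - pc (\<zeta> powi (- c)) * pKi)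
     = proj (pc (\<zeta> powi c) * pK - pc (\<zeta> powi (- c)) * pKi)" by (rule proj_diff_cong) simp
  moreover have "pc (\<zeta> powi c) * pK - pc (\<zeta> powi (- c)) * pKi \<in> cart"
    by (intro cart_diff cart_pc_mult cart_pK cart_pKi)
  moreover have "?d \<noteq> 0" using zeta_neq_inverse by (simp add: power_int_minus)
  ultimately show ?thesis
    by (metis add_diff_cancel_right' cart.proj cart_pc_mult proj_pc_cancel)
qed

text \<open>With first argument 0 the order t is lowered. If l does not divide t, one factor is
  split off and \<open>[t]\<close> is inverted; if t = l (r + 1) with r > 0, a factor of order l is
  split off and r + 1 is inverted, which is possible in characteristic 0. Pascal's rule then changes
  the first argument.\<close>

lemma cart_pkb: "pkb c t \<in> cart"
proof (induction t arbitrary: c rule: less_induct)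
  case (less t)
  have 0: "pkb 0 t \<in> cart"
  proof (cases "l dvd t")
    case False
    then obtain s where t: "t = Suc s" by (cases t) auto
    have "qi \<zeta> (int (Suc s)) \<noteq> 0" using False by (simp only: qi_zeta_eq_0_iff t int_dvd_int_iff not_False_eq_True)
    from proj_pc_cancel[OF this UA_kb_Suc]
    have "proj (pkb 0 t) = proj (pc (inverse (qi \<zeta> (int (Suc s)))) * (pkb 0 s * pkb (0 - int s) 1))"
      by (simp only: t)
    moreover have "pc (inverse (qi \<zeta> (int (Suc s)))) * (pkb 0 s * pkb (0 - int s) 1) \<in> cart"
      by (intro cart_pc_mult cart_mult cart_pkb_1 less) (simp add: t)
    ultimately show ?thesis by (metis cart.proj)
  next
    case True
    then obtain s where s: "t = l * s" by blast
    consider "s = 0" | "s = 1" | r where "s = Suc r" "r > 0" by (metis One_nat_def not0_implies_Suc neq0_conv)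
    then show ?thesis
    proof cases
      case 1
      have "UA_kb 0 0 = 1" by (simp add: UA_kb.rep_eq one_UA.rep_eq flip: Rep_UA_inject)
      then show ?thesis using s 1 cart_1 by (simp add: pure_one)
    next
      case 2
      then show ?thesis using s cart_pH_mult[OF cart_1] by simp
    next
      case 3
      let ?m = "l * r"
      have t: "t = ?m + l" "?m < t" "l < t" using s 3 l_gt_1 by (auto simp: algebra_simps)
      have "zb (int (?m + l)) l = of_nat s"
        unfolding zb_l using l_gt_1 s t(1) by (simp add: zdiv_int[symmetric] flip: of_nat_add of_nat_mult)
      moreover have "of_nat s \<noteq> (0 :: 'k)" using 3 by (simp only: of_nat_eq_0_iff)
      ultimately have nz: "zb (int (?m + l)) l \<noteq> 0" by simp
      from proj_pc_cancel[OF nz UA_kb_add[of ?m l 0]]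
      have "proj (pkb 0 t) = proj (pc (inverse (zb (int (?m + l)) l)) * (pkb 0 ?m * pkb (0 - int ?m) l))"
        unfolding t(1) .
      moreover have "pc (inverse (zb (int (?m + l)) l)) * (pkb 0 ?m * pkb (0 - int ?m) l) \<in> cart"
        using t by (intro cart_pc_mult cart_mult less) auto
      ultimately show ?thesis by (metis cart.proj)
    qed
  qed
  show ?case
  proof (cases t)
    case 0
    have "UA_kb c 0 = 1" by (simp add: UA_kb.rep_eq one_UA.rep_eq flip: Rep_UA_inject)
    then show ?thesis using 0 cart_1 by (simp add: pure_one)
  next
    case (Suc s)
    have IH: "pkb c s \<in> cart" for c using less Suc by simp
    show ?thesis unfolding Suc
    proof (induction c rule: int_induct[of _ 0])
      case base
      then show ?case using 0 Suc by simp
    next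
      case (step1 i)
      show ?case
        by (rule cart.proj[OF _ UA_kb_Pascal[symmetric]])
          (intro cart.add cart_pc_mult cart_pK_mult IH step1)
    next
      case (step2 i)
      let ?y = "pc (\<zeta> powi (i - 1 - int s)) * (pK * pkb (i - 1) s)"
      have "proj (pkb i (Suc s) - ?y) = proj (pc (\<zeta> powi (- int (Suc s))) * pkb (i - 1) (Suc s) + ?y - ?y)"
        using UA_kb_Pascal[of "i - 1" s] by (intro proj_diff_cong refl) simp
      then have "proj (pc (\<zeta> powi (- int (Suc s))) * pkb (i - 1) (Suc s)) = proj (pkb i (Suc s) - ?y)" by simp
      from proj_pc_cancel[OF _ this] 
      have "proj (pkb (i - 1) (Suc s)) = proj (pc (inverse (\<zeta> powi (- int (Suc s)))) * (pkb i (Suc s) - ?y))"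
        by simp
      moreover have "pc (inverse (\<zeta> powi (- int (Suc s)))) * (pkb i (Suc s) - ?y) \<in> cart"
        using step2 by (intro cart_pc_mult cart_diff cart_pK_mult IH)
      ultimately show ?case by (metis cart.proj)
    qed
  qed
qed

lemma cart_cartan: "z \<in> cartan \<Longrightarrow> Rep_UA u = z \<Longrightarrow> pure u c \<in> cart"
proof (induction arbitrary: u rule: cartan.induct)
  case one
  then have "u = 1" by (simp add: one_UA.rep_eq flip: Rep_UA_inject)
  then show ?case by (simp add: cart_pc)
next
  case (K z)
  define v where "v = Abs_UA z"
  have v: "Rep_UA v = z" using K(1) by (simp add: v_def cartan_UA Abs_UA_inverse)
  then have "u = UA_K * v" using K.prems by (simp add: times_UA.rep_eq UA_K.rep_eq flip: Rep_UA_inject)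
  then show ?case using cart_pK_mult[OF K.IH[OF v]] by (simp add: pure_mult)
next
  case (Kinv z)
  define v where "v = Abs_UA z"
  have v: "Rep_UA v = z" using Kinv(1) by (simp add: v_def cartan_UA Abs_UA_inverse)
  then have "u = UA_Ki * v" using Kinv.prems by (simp add: times_UA.rep_eq UA_Ki.rep_eq flip: Rep_UA_inject)
  then show ?case using cart_mult[OF cart_pKi Kinv.IH[OF v]] by (simp add: pure_mult)
next
  case (kb z d t)
  define v where "v = Abs_UA z"
  have v: "Rep_UA v = z" using kb(1) by (simp add: v_def cartan_UA Abs_UA_inverse)
  then have "u = UA_kb d t * v" using kb.prems by (simp add: times_UA.rep_eq UA_kb.rep_eq flip: Rep_UA_inject)
  then show ?case using cart_mult[OF cart_pkb kb.IH[OF v]] by (simp add: pure_mult)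
next
  case (scl r z)
  define v where "v = Abs_UA z"
  have v: "Rep_UA v = z" using scl(2) by (simp add: v_def cartan_UA Abs_UA_inverse)
  have "proj (pure u c) = proj (pc (sp \<zeta> r) * pure v c)"
    using scl v by (intro proj_scl) auto
  then show ?case by (metis cart.proj cart_pc_mult scl.IH[OF v])
qed

lemma pK_power_mod: "proj (pK ^ i) = proj (pK ^ (i mod l))"
proof -
  have "proj (pK ^ l) = proj 1" by (simp add: proj_eq_iff K_nul)
  then have "proj ((pK ^ l) ^ (i div l) * pK ^ (i mod l)) = proj (1 ^ (i div l) * pK ^ (i mod l))"
    by (intro proj_mult_cong proj_power_cong refl)
  then show ?thesis by (simp flip: power_mult power_add)
qed

text \<open>The form is claimed for all large \<open>N\<close>, so that two of them can be added
  over a common range.\<close>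

lemma cart_normal_form:
  assumes "x \<in> cart"
  shows "\<exists>c N0. \<forall>N\<ge>N0. proj x = proj (\<Sum>i<l. \<Sum>j<N. pc (c i j) * pK ^ i * pH ^ j)"
  using assms
proof induction
  case (base d i j)
  define c where "c = (\<lambda>i' j'. if i' = i mod l \<and> j' = j then d else 0)"
  have "proj (pc d * pK ^ i * pH ^ j) = proj (\<Sum>i'<l. \<Sum>j'<N. pc (c i' j') * pK ^ i' * pH ^ j')"
    if N: "N \<ge> Suc j" for N
  proof -
    let ?t = "pc d * pK ^ (i mod l) * pH ^ j"
    have "proj (\<Sum>i'<l. \<Sum>j'<N. pc (c i' j') * pK ^ i' * pH ^ j')
      = proj (\<Sum>i'<l. \<Sum>j'<N. if j' = j then if i' = i mod l then ?t else 0 else 0)"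
    proof (intro proj_sum_cong)
      fix i' j'
      show "proj (pc (c i' j') * pK ^ i' * pH ^ j') = proj (if j' = j then if i' = i mod l then ?t else 0 else 0)"
        using proj_pc_0[of "pK ^ i' * pH ^ j'"] by (auto simp: c_def mult.assoc)
    qed
    also have "(\<Sum>i'<l. \<Sum>j'<N. if j' = j then if i' = i mod l then ?t else 0 else 0) = ?t"
      using N l_gt_1 by simp
    also have "proj ?t = proj (pc d * pK ^ i * pH ^ j)"
      by (intro proj_mult_cong pK_power_mod[symmetric] refl)
    finally show ?thesis by simp
  qed
  then show ?case by blast
next
  case (add x y)
  then obtain c M d N where
    c: "\<forall>n\<ge>M. proj x = proj (\<Sum>i<l. \<Sum>j<n. pc (c i j) * pK ^ i * pH ^ j)" and
    d: "\<forall>n\<ge>N. proj y = proj (\<Sum>i<l. \<Sum>j<n. pc (d i j) * pK ^ i * pH ^ j)" by blast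
  have "proj (x + y) = proj (\<Sum>i<l. \<Sum>j<n. pc (c i j + d i j) * pK ^ i * pH ^ j)" if "n \<ge> max M N" for n
  proof -
    have "proj (\<Sum>i<l. \<Sum>j<n. pc (c i j + d i j) * pK ^ i * pH ^ j)
       = proj (\<Sum>i<l. \<Sum>j<n. pc (c i j) * pK ^ i * pH ^ j + pc (d i j) * pK ^ i * pH ^ j)"
      unfolding mult.assoc by (intro proj_sum_cong proj_pc_add)
    also have "\<dots> = proj (x + y)"
      unfolding sum.distrib using c d that by (intro proj_add_cong) auto
    finally show ?thesis by simp
  qed
  then show ?case by (intro exI[of _ "\<lambda>i j. c i j + d i j"]) blast
next
  case (proj x y)
  then show ?case by auto
qed

lemma th_pK_power: "th (pK ^ i * x) a b L = \<zeta> powi (int i * (L - 2 * int a)) * th x a b L"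
proof (induction i)
  case (Suc i)
  have "th (pK ^ Suc i * x) a b L = \<zeta> powi (L - 2 * int a) * \<zeta> powi (int i * (L - 2 * int a)) * th x a b L"
    by (simp only: power_Suc mult.assoc th_pK Suc)
  also have "\<dots> = \<zeta> powi (int (Suc i) * (L - 2 * int a)) * th x a b L"
    unfolding powi_shift[OF zeta_nonzero] by (simp add: algebra_simps)
  finally show ?case .
qed simp

lemma th_pH_power: "th (pH ^ j * x) a b L = of_int ((L - 2 * int a) div int l) ^ j * th x a b L"
  by (induction j) (simp_all add: mult.assoc th_pkb zb_l)

lemma th_base: "th (pc c * pK ^ i * pH ^ j * x) a b L
    = c * \<zeta> powi (int i * (L - 2 * int a)) * of_int ((L - 2 * int a) div int l) ^ j * th x a b L"
  by (simp add: mult.assoc th_pc th_pK_power th_pH_power)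

text \<open>A Cartan element sees \<open>F^(a) 1_L\<close> only through its weight
  \<open>L - 2 * a\<close>.\<close>

lemma th_cart_mult: "x \<in> cart \<Longrightarrow> th (x * y) a b L = th x 0 0 (L - 2 * int a) * th y a b L"
proof (induction rule: cart.induct)
  case (base c i j)
  show ?case using th_base[of c i j y a b L] th_base[of c i j 1 0 0 "L - 2 * int a"] by (simp add: th_1)
next
  case (add x x')
  then show ?case by (simp add: distrib_right theta_add)
next
  case (proj x x')
  then show ?case by (metis th_cong proj_mult_cong)
qed

lemma th_cart: "x \<in> cart \<Longrightarrow> th x a b L = (if a = 0 \<and> b = 0 then th x 0 0 L else 0)"
  using th_cart_mult[of x 1 a b L] by (auto simp: th_1)

text \<open>On L = l m + r the coordinate is a polynomial in m whose coefficients are polynomials in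
  \<open>\<zeta>^r\<close>. The root count applies twice: to the values of m, distinct in
  characteristic 0, and to the powers \<open>\<zeta>^r\<close>, distinct for r < l.\<close>

lemma cart_nul:
  assumes "x \<in> cart" "\<And>L. th x 0 0 L = 0"
  shows "proj x = proj 0"
proof -
  obtain c N where x: "proj x = proj (\<Sum>i<l. \<Sum>j<N. pc (c i j) * pK ^ i * pH ^ j)"
    using cart_normal_form[OF assms(1)] by blast
  have "(\<Sum>i<l. \<Sum>j<N. c i j * \<zeta> powi (int i * L) * of_int (L div int l) ^ j) = 0" for L
  proof -
    have "th x 0 0 L = (\<Sum>i<l. \<Sum>j<N. th (pc (c i j) * pK ^ i * pH ^ j) 0 0 L)"
      by (simp add: th_cong[OF x] theta_sum)
    also have "\<dots> = (\<Sum>i<l. \<Sum>j<N. c i j * \<zeta> powi (int i * L) * of_int (L div int l) ^ j)"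
      using th_base[of _ _ _ 1 0 0 L] by (intro sum.cong refl) (simp add: th_1)
    finally show ?thesis using assms(2) by simp
  qed
  note zero = this
  have d0: "(\<Sum>i<l. c i j * (\<zeta> ^ r) ^ i) = 0" if "r < l" "j < N" for r j
  proof (rule sum_monomials_eq_0[of "(of_nat :: nat \<Rightarrow> 'k) ` {..<N}" N "\<lambda>j. \<Sum>i<l. c i j * (\<zeta> ^ r) ^ i"])
    show "card ((of_nat :: nat \<Rightarrow> 'k) ` {..<N}) \<ge> N"
      by (subst card_image) (auto simp: inj_on_def)
    fix y :: 'k assume "y \<in> of_nat ` {..<N}"
    then obtain m :: nat where y: "y = of_nat m" by blast
    let ?L = "int l * int m + int r"
    have div: "?L div int l = int m" using that l_gt_1 by simp
    have pw: "\<zeta> powi (int i * ?L) = (\<zeta> ^ r) ^ i" for i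
    proof -
      have "\<zeta> powi (int i * ?L) = \<zeta> powi (int (r * i))" by (rule zeta_cong) (simp add: algebra_simps)
      then show ?thesis by (simp add: power_mult del: of_nat_mult)
    qed
    have "(\<Sum>j<N. (\<Sum>i<l. c i j * (\<zeta> ^ r) ^ i) * y ^ j) = (\<Sum>j<N. \<Sum>i<l. c i j * (\<zeta> ^ r) ^ i * y ^ j)"
      by (simp add: sum_distrib_right)
    also have "\<dots> = (\<Sum>i<l. \<Sum>j<N. c i j * (\<zeta> ^ r) ^ i * y ^ j)" by (rule sum.swap)
    also have "\<dots> = 0" using zero[of ?L] unfolding div pw y by simp
    finally show "(\<Sum>j<N. (\<Sum>i<l. c i j * (\<zeta> ^ r) ^ i) * y ^ j) = 0" .
  qed (use that in auto)
  have c0: "c i j = 0" if "i < l" "j < N" for i j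
  proof (rule sum_monomials_eq_0[of "(\<lambda>r. \<zeta> ^ r) ` {..<l}" l "\<lambda>i. c i j"])
    have "r = s" if "r < l" "s < l" "\<zeta> ^ r = \<zeta> ^ s" for r s
    proof -
      have "\<zeta> powi (int r - int s) = 1" using that by (simp add: power_int_diff)
      then have "int l dvd int r - int s" by (simp only: zeta_powi_eq_1_iff)
      then have "int r mod int l = int s mod int l" by (simp only: mod_eq_dvd_iff)
      then show "r = s" using that by simp
    qed
    then have "inj_on (\<lambda>r. \<zeta> ^ r) {..<l}" by (auto simp: inj_on_def)
    then show "l \<le> card ((\<lambda>r. \<zeta> ^ r) ` {..<l})" by (simp add: card_image)
  qed (use that d0 in auto)
  have "proj (\<Sum>i<l. \<Sum>j<N. pc (c i j) * pK ^ i * pH ^ j) = proj (\<Sum>i<l. \<Sum>j<N. 0)"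
  proof (intro proj_sum_cong)
    fix i j assume "i \<in> {..<l}" "j \<in> {..<N}"
    then show "proj (pc (c i j) * pK ^ i * pH ^ j) = proj 0"
      using c0 proj_pc_0 by (simp add: mult.assoc)
  qed
  then show ?thesis using x by simp
qed

section \<open>Triangular decomposition of U_zeta and faithfulness of the coordinates\<close>

inductive_set pbw :: "'k pre_tensor set" where
  base: "z \<in> cart \<Longrightarrow> pF a * z * pE b \<in> pbw"
| add: "x \<in> pbw \<Longrightarrow> y \<in> pbw \<Longrightarrow> x + y \<in> pbw"
| proj: "x \<in> pbw \<Longrightarrow> proj x = proj y \<Longrightarrow> y \<in> pbw"

lemma UA_span_UA: "x \<in> UA_span \<Longrightarrow> x \<in> UA_set"
  by (induction rule: UA_span.induct)
    (auto intro: UA_set.intros UA_set_add UA_set_scl cartan_UA)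

lemma pbw_pc_mult: "x \<in> pbw \<Longrightarrow> pc c * x \<in> pbw"
proof (induction rule: pbw.induct)
  case (base z a b)
  have "pc c * (pF a * z * pE b) = pF a * (pc c * z) * pE b"
    by (simp only: pc_commute[of "pF a" c, symmetric] mult.assoc[symmetric])
  moreover have "pF a * (pc c * z) * pE b \<in> pbw"
    by (rule pbw.base[OF cart_pc_mult[OF base]])
  ultimately show ?case by simp
next
  case (proj x y)
  then show ?case by (metis pbw.proj proj_mult_cong)
qed (auto simp: distrib_left intro: pbw.add)

lemma pbw_pure: "x \<in> UA_span \<Longrightarrow> Rep_UA u = x \<Longrightarrow> pure u c \<in> pbw"
proof (induction arbitrary: u rule: UA_span.induct)
  case (base z a b)
  define v where "v = Abs_UA z"
  have v: "Rep_UA v = z" using base by (simp add: v_def cartan_UA Abs_UA_inverse)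
  then have "u = UA_dF a * v * UA_dE b"
    using base.prems by (simp add: times_UA.rep_eq UA_dF.rep_eq UA_dE.rep_eq flip: Rep_UA_inject)
  then have "pure u c = pF a * pure v c * pE b" by (simp add: pure_mult)
  then show ?case using pbw.base[OF cart_cartan[OF base(1) v]] by simp
next
  case (add x y)
  have r: "Rep_UA (Abs_UA x) = x" "Rep_UA (Abs_UA y) = y"
    using add by (simp_all add: UA_span_UA Abs_UA_inverse)
  then have "u = Abs_UA x + Abs_UA y" using add.prems by (simp add: plus_UA.rep_eq flip: Rep_UA_inject)
  then have "proj (pure (Abs_UA x) c + pure (Abs_UA y) c) = proj (pure u c)"
    by (simp add: proj_pure_add_left)
  then show ?case by (rule pbw.proj[OF pbw.add[OF add.IH(1)[OF r(1)] add.IH(2)[OF r(2)]]])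
next
  case (scl d x)
  have r: "Rep_UA (Abs_UA x) = x" using scl by (simp add: UA_span_UA Abs_UA_inverse)
  have "proj (pure u c) = proj (pc (sp \<zeta> d) * pure (Abs_UA x) c)"
    by (rule proj_scl) (use scl r in auto)
  then show ?case by (metis pbw.proj pbw_pc_mult scl.IH[OF r])
qed

lemma pbw_all: "x \<in> pbw"
proof (induction x rule: pre_tensor_induct)
  case zero
  then show ?case using pbw.base[OF cart_0, of 0 0] by simp
next
  case (pure u c)
  then show ?case using pbw_pure[OF UA_set_span refl] Rep_UA by blast
next
  case (uminus x)
  then show ?case by (metis pbw.proj pbw_pc_mult proj_pc_m1)
qed (rule pbw.add)

lemma pbw_normal_form:
  "\<exists>s N0. (\<forall>a b. s a b \<in> cart) \<and> (\<forall>N\<ge>N0. proj x = proj (\<Sum>a<N. \<Sum>b<N. pF a * s a b * pE b))"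
  using pbw_all[of x]
proof (induction rule: pbw.induct)
  case (base z m n)
  define s where "s = (\<lambda>a b. if a = m \<and> b = n then z else 0)"
  have "(\<Sum>a<N. \<Sum>b<N. pF a * s a b * pE b) = pF m * z * pE n" if "N \<ge> max (Suc m) (Suc n)" for N
  proof -
    have "(\<Sum>a<N. \<Sum>b<N. pF a * s a b * pE b) = (\<Sum>a<N. \<Sum>b<N. if b = n then if a = m then pF m * z * pE n else 0 else 0)"
      by (intro sum.cong) (auto simp: s_def)
    moreover have "m < N" "n < N" using that by auto
    ultimately show ?thesis by simp
  qed
  then show ?case using base cart_0 by (intro exI[of _ s] exI[of _ "max (Suc m) (Suc n)"]) (auto simp: s_def)
next
  case (add x y)
  then obtain s M t N where s: "\<forall>a b. s a b \<in> cart" "\<forall>a b. t a b \<in> cart" and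
    x: "\<forall>n\<ge>M. proj x = proj (\<Sum>a<n. \<Sum>b<n. pF a * s a b * pE b)" and
    y: "\<forall>n\<ge>N. proj y = proj (\<Sum>a<n. \<Sum>b<n. pF a * t a b * pE b)" by blast
  have "proj (x + y) = proj (\<Sum>a<n. \<Sum>b<n. pF a * (s a b + t a b) * pE b)" if "n \<ge> max M N" for n
    unfolding distrib_left distrib_right sum.distrib using x y that by (intro proj_add_cong) auto
  then show ?case using s
    by (intro exI[of _ "\<lambda>a b. s a b + t a b"] exI[of _ "max M N"]) (auto intro: cart.add)
next
  case (proj x y)
  then show ?case by auto
qed

lemma th_basis:
  assumes "s \<in> cart"
  shows "th (pF a * s * pE b) a' b' L = (if a' = a \<and> b' = b then th s 0 0 L else 0)"
proof -
  have "th (pF a * s * pE b) a' b' L = zb (int b') b * zb (int a') a * th s (a' - a) (b' - b) L"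
    by (simp add: th_mult_pE th_pF mult.assoc)
  \<comment> \<open>For \<open>a' < a\<close> or \<open>b' < b\<close> the truncated difference is 0
    and would suggest a match; the vanishing binomial excludes it.\<close>
  moreover have "zb (int a') a = 0 \<or> zb (int b') b = 0" if "a' < a \<or> b' < b"
    using that by (auto simp: qb_eq_0)
  ultimately show ?thesis
    using th_cart[OF assms, of "a' - a" "b' - b" L]
    by (cases "a' < a \<or> b' < b") (auto simp: not_less)
qed

text \<open>The coordinates at \<open>(a, b)\<close> isolate the Cartan coefficient between
  \<open>F^(a)\<close> and \<open>E^(b)\<close>, which they determine by \<open>cart_nul\<close>.
  From here on, equations in U_zeta may be checked on coordinates.\<close>

theorem proj_eq_iff_th: "proj x = proj y \<longleftrightarrow> (\<forall>a b L. th x a b L = th y a b L)"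
proof
  assume "\<forall>a b L. th x a b L = th y a b L"
  then have z: "th (x - y) a b L = 0" for a b L by (simp add: theta_diff)
  obtain s N where s: "\<And>a b. s a b \<in> cart" "proj (x - y) = proj (\<Sum>a<N. \<Sum>b<N. pF a * s a b * pE b)"
    using pbw_normal_form[of "x - y"] by blast
  have "proj (pF a * s a b * pE b) = proj 0" if "a < N" "b < N" for a b
  proof -
    have "th (s a b) 0 0 L = 0" for L
    proof -
      have "0 = th (\<Sum>a<N. \<Sum>b<N. pF a * s a b * pE b) a b L"
        using th_cong[OF s(2), of a b L] z by simp
      also have "\<dots> = (\<Sum>a'<N. \<Sum>b'<N. if b' = b then if a' = a then th (s a b) 0 0 L else 0 else 0)"
        by (simp only: theta_sum th_basis[OF s(1)]) (intro sum.cong, auto)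
      also have "\<dots> = th (s a b) 0 0 L" using that by simp
      finally show ?thesis by simp
    qed
    then have "proj (s a b) = proj 0" using s(1) cart_nul by blast
    then have "proj (pF a * s a b * pE b) = proj (pF a * 0 * pE b)" by (intro proj_mult_cong refl)
    then show ?thesis by simp
  qed
  then have "proj (\<Sum>a<N. \<Sum>b<N. pF a * s a b * pE b) = proj (\<Sum>a<N. \<Sum>b<N. 0)"
    by (intro proj_sum_cong) auto
  then have "proj (x - y) = proj 0" using s(2) by simp
  then show "proj x = proj y" unfolding proj_eq_iff by simp
qed (auto intro: th_cong)

end

section \<open>Central elements\<close>

text \<open>Column 0 at weight \<open>n - 1\<close> is the Verma module of that highest weight.
  There \<open>F^(n)\<close> gives a singular vector, killed by every \<open>E^(b)\<close> with b >
  0.\<close>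

lemma coords_dE_dF: "coords (dE b * dF n) k 0 (int n - 1) = (if b = 0 \<and> k = n then 1 else 0)"
proof (cases "b = 0")
  case True
  have "coords (dF n) k 0 (int n - 1) = qb (int k) n * arr_one (k - n) 0 (int n - 1)"
    by (simp add: coords_def uact_dF)
  then show ?thesis using True by (auto simp: arr_one_def qb_eq_0)
next
  case False
  have cs: "coords (sum f A) x y L = (\<Sum>i\<in>A. coords (f i) x y L)" for f :: "nat \<Rightarrow> Uq" and A x y L
  proof (induction A rule: infinite_finite_induct)
    case (infinite A)
    then show ?case using coords_scl[of 0 0] by (simp add: azero_def)
  next
    case empty
    then show ?case using coords_scl[of 0 0] by (simp add: azero_def)
  qed (simp add: coords_add aadd_def)
  have "coords (dFi (int n - int t) * kb (2 * int t - int b - int n) t * dE (b - t)) k 0 (int n - 1) = 0"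
    if "t \<le> b" for t
  proof (cases "t < b")
    case True
    then obtain r where "b - t = Suc r" by (metis Suc_diff_Suc)
    then show ?thesis by (simp add: coords_mult_dE)
  next
    case t: False
    then have t: "t = b" using that by simp
    show ?thesis
    proof (cases "b \<le> n")
      case True
      then obtain m where n: "n = m + b" by (metis le_add_diff_inverse2)
      have "coords (dF m * kb (int b - int n) b) k 0 (int n - 1)
          = qb (int k) m * (qb (int n - 1 - 2 * int (k - m) + (int b - int n)) b * arr_one (k - m) 0 (int n - 1))"
        by (simp add: coords_mult uact_dF) (simp add: coords_def uact_kb)
      also have "\<dots> = 0"
      proof (cases "k = m")
        case True
        obtain r where r: "b = Suc r" using \<open>b \<noteq> 0\<close> by (cases b) auto
        \<comment> \<open>The weight n - 1 and the shift b - n add up to b - 1 = r, and the binomial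
          of r over r + 1 vanishes.\<close>
        have "qb (int n - 1 - 2 * int (k - m) + (int b - int n)) b = qb (int r) (Suc r)"
          using True r by simp
        then show ?thesis by (simp add: qb_eq_0)
      qed (auto simp: arr_one_def qb_eq_0 not_less)
      finally show ?thesis using t n by (simp add: dFi_def)
    next
      case False
      then show ?thesis using t coords_scl[of 0 0] by (simp add: dFi_def azero_def)
    qed
  qed
  then show ?thesis using False by (simp add: dE_dF cs)
qed

text \<open>The usual Casimir element multiplied by the square of q - 1/q: in this scaling it is
  integral and has the value q^(L+1) + q^(-L-1) at highest weight \<open>L\<close>.\<close>

definition casimir :: Uq where
  "casimir = scl ((qvar - inverse qvar)^2) (uF * uE) + scl (qvar powi 1) uK + scl (qvar powi (-1)) uKi"

lemma casimir_Kb: "scl ((qvar - inverse qvar)^2) (Kb c)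
    = scl (qvar powi (c + 1) - qvar powi (c - 1)) uK - scl (qvar powi (- c + 1) - qvar powi (- c - 1)) uKi"
proof -
  have "(qvar - inverse qvar)^2 * inverse (qvar - inverse qvar) = qvar powi 1 - qvar powi (-1)"
    using qvar_neq_inverse by (simp add: power2_eq_square power_int_minus)
  then have "scl ((qvar - inverse qvar)^2) (Kb c)
    = scl (qvar powi 1 - qvar powi (-1)) (scl (qvar powi c) uK - scl (qvar powi (- c)) uKi)"
    by (simp only: Kb_def scl.scale_scale)
  also have "\<dots> = scl ((qvar powi 1 - qvar powi (-1)) * qvar powi c) uK - scl ((qvar powi 1 - qvar powi (-1)) * qvar powi (- c)) uKi"
    by (simp only: scl.scale_right_diff_distrib scl.scale_scale)
  moreover have "1 + c = c + 1" "- 1 + c = c - 1" "1 + - c = - c + 1" "- 1 + - c = - c - 1" by auto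
  ultimately show ?thesis
    by (simp only: left_diff_distrib powi_shift[OF qvar_nonzero])
qed

lemma casimir_E: "uE * casimir = casimir * uE"
proof -
  let ?d = "(qvar - inverse qvar)^2"
  have "uE * casimir = scl ?d (uE * uF * uE) + scl (qvar powi 1) (uE * uK) + scl (qvar powi (-1)) (uE * uKi)"
    by (simp add: casimir_def distrib_left mult.assoc)
  also have "scl ?d (uE * uF * uE) = scl ?d (uF * uE * uE) + uE * scl ?d (Kb 2)"
    unfolding EF distrib_right Kb_E by (simp add: scl.scale_right_distrib mult.assoc)
  also have "uE * scl ?d (Kb 2) = scl (qvar powi 3 - qvar powi 1) (uE * uK) - scl (qvar powi (-1) - qvar powi (-3)) (uE * uKi)"
    unfolding casimir_Kb by (simp add: right_diff_distrib del: power_int_numeral)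
  also have "scl ?d (uF * uE * uE) + (scl (qvar powi 3 - qvar powi 1) (uE * uK) - scl (qvar powi (-1) - qvar powi (-3)) (uE * uKi))
      + scl (qvar powi 1) (uE * uK) + scl (qvar powi (-1)) (uE * uKi)
      = scl ?d (uF * uE * uE) + scl (qvar powi 3) (uE * uK) + scl (qvar powi (-3)) (uE * uKi)"
    by (simp only: scl.scale_left_diff_distrib) (simp add: algebra_simps)
  also have "\<dots> = casimir * uE"
    by (simp only: casimir_def distrib_right scl_mult_left KE KiE scl.scale_scale powi_shift[OF qvar_nonzero]) simp
  finally show ?thesis .
qed

lemma casimir_F: "uF * casimir = casimir * uF"
proof -
  let ?d = "(qvar - inverse qvar)^2"
  have "casimir * uF = scl ?d (uF * (uE * uF)) + scl (qvar powi 1) (uK * uF) + scl (qvar powi (-1)) (uKi * uF)"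
    by (simp add: casimir_def distrib_right mult.assoc)
  also have "scl ?d (uF * (uE * uF)) = scl ?d (uF * uF * uE) + uF * scl ?d (Kb 0)"
    unfolding EF distrib_left by (simp add: scl.scale_right_distrib mult.assoc)
  also have "uF * scl ?d (Kb 0) = scl (qvar powi 1 - qvar powi (-1)) (uF * uK) - scl (qvar powi 1 - qvar powi (-1)) (uF * uKi)"
    unfolding casimir_Kb by (simp add: right_diff_distrib del: power_int_1_right)
  also have "scl (qvar powi 1) (uK * uF) = scl (qvar powi (-1)) (uF * uK)"
    by (simp only: KF scl.scale_scale powi_shift[OF qvar_nonzero]) simp
  also have "scl (qvar powi (-1)) (uKi * uF) = scl (qvar powi 1) (uF * uKi)"
    by (simp only: KiF scl.scale_scale powi_shift[OF qvar_nonzero]) simp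
  also have "scl ?d (uF * uF * uE) + (scl (qvar powi 1 - qvar powi (-1)) (uF * uK) - scl (qvar powi 1 - qvar powi (-1)) (uF * uKi))
     + scl (qvar powi (-1)) (uF * uK) + scl (qvar powi 1) (uF * uKi)
     = scl ?d (uF * uF * uE) + scl (qvar powi 1) (uF * uK) + scl (qvar powi (-1)) (uF * uKi)"
    by (simp only: scl.scale_left_diff_distrib) (simp add: algebra_simps)
  also have "\<dots> = uF * casimir"
    by (simp add: casimir_def distrib_left mult.assoc)
  finally show ?thesis by simp
qed

lemma casimir_K: "uK * casimir = casimir * uK" "uKi * casimir = casimir * uKi"
proof -
  have "uK * (uF * uE) = uK * uF * uE" by (simp add: mult.assoc)
  also have "\<dots> = scl (qvar powi (-2)) (uF * (uK * uE))" unfolding KF by (simp add: mult.assoc)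
  also have "\<dots> = uF * uE * uK"
    by (simp only: KE scl_mult_right scl.scale_scale powi_shift[OF qvar_nonzero] mult.assoc) simp
  finally have FE: "uK * (uF * uE) = uF * uE * uK" .
  then show 1: "uK * casimir = casimir * uK" by (simp add: casimir_def distrib_left distrib_right)
  have "uKi * casimir = uKi * (casimir * (uK * uKi))" by simp
  also have "\<dots> = uKi * (uK * casimir * uKi)" unfolding 1 by (simp only: mult.assoc)
  also have "\<dots> = casimir * uKi" by (simp add: mult.assoc)
  finally show "uKi * casimir = casimir * uKi" .
qed

lemma casimir_power: "x * casimir = casimir * x \<Longrightarrow> x ^ n * casimir = casimir * x ^ n"
  by (induction n) (auto, metis mult.assoc)

lemma casimir_commute: "x \<in> UA_set \<Longrightarrow> x * casimir = casimir * x"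
proof (induction rule: UA_set.induct)
  case (mult x y)
  then show ?case by (metis mult.assoc)
qed (simp_all add: casimir_E casimir_F casimir_K casimir_power divided_power_scl
    left_diff_distrib right_diff_distrib flip: scl_def)

lemma integral_d2: "(qvar - inverse qvar)^2 \<in> integral_ratfun"
proof -
  have "(qvar - inverse qvar)^2 = (qvar powi 1 - qvar powi (-1)) * (qvar powi 1 - qvar powi (-1))"
    by (simp add: power2_eq_square power_int_minus)
  then show ?thesis by (simp only:) (intro integral_mult integral_diff integral_powi)
qed

lemma casimir_UA: "casimir \<in> UA_set"
  unfolding casimir_def
  using UA_set.divided_E[of 1] UA_set.divided_F[of 1] unfolding divided_power_1
  by (intro UA_set_add UA_set_scl integral_d2 integral_powi UA_set.mult UA_set.K UA_set.Kinv)

lift_definition UA_C :: UA is casimir by (rule casimir_UA)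

lemma coords_casimir: "coords casimir 0 0 L = qvar powi (L + 1) + qvar powi (- (L + 1))"
  by (simp add: casimir_def coords_add coords_scl aadd_def ascl_def)
    (simp add: coords_def uact_mult uact_gen arr_one_def power_int_add power_int_minus power_int_diff field_simps)

lemma interpolation:
  fixes g :: "'a::field \<Rightarrow> 'a"
  assumes "finite A"
  shows "\<exists>p. \<forall>x\<in>A. poly p x = g x"
  using assms
proof induction
  case (insert a A)
  then obtain p where p: "\<forall>x\<in>A. poly p x = g x" by blast
  define r where "r = (\<Prod>y\<in>A. [:- y, 1:])"
  have r: "poly r a \<noteq> 0" "\<And>x. x \<in> A \<Longrightarrow> poly r x = 0"
    using insert by (auto simp: r_def poly_prod)
  have "\<forall>x\<in>insert a A. poly (p + smult ((g a - poly p a) / poly r a) r) x = g x"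
    using p r by auto
  then show ?case by blast
qed simp

lemma add_inverse_eq:
  fixes x y :: "'a::field"
  assumes "x \<noteq> 0" "y \<noteq> 0" "x + inverse x = y + inverse y"
  shows "x = y \<or> x * y = 1"
proof -
  have "(x - y) * (x * y - 1) = x * y * ((x + inverse x) - (y + inverse y))"
    using assms(1,2) by (simp add: field_simps)
  then have "(x - y) * (x * y - 1) = 0" using assms(3) by simp
  then show ?thesis by auto
qed

lemma UA_E_eq: "UA_E = UA_dE 1" and UA_F_eq: "UA_F = UA_dF 1"
  using divided_power_1[of uE] divided_power_1[of uF]
  by (simp_all add: UA_E.rep_eq UA_dE.rep_eq UA_F.rep_eq UA_dF.rep_eq flip: Rep_UA_inject)

context root_of_unity
begin

section \<open>Central elements and the Harish-Chandra map\<close>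

definition central :: "'k pre_tensor \<Rightarrow> bool" where
  "central x \<longleftrightarrow> (\<forall>y. proj (x * y) = proj (y * x))"

abbreviation phi :: "'k pre_tensor \<Rightarrow> int \<Rightarrow> 'k" where
  "phi x L \<equiv> th x 0 0 L"

lemma centralD: "central x \<Longrightarrow> proj (x * y) = proj (y * x)"
  by (simp add: central_def)

lemma central_add: "central x \<Longrightarrow> central y \<Longrightarrow> central (x + y)"
  unfolding central_def distrib_left distrib_right by (intro allI proj_add_cong; simp)

lemma central_diff: "central x \<Longrightarrow> central y \<Longrightarrow> central (x - y)"
  unfolding central_def left_diff_distrib right_diff_distrib by (intro allI proj_diff_cong; simp)

lemma central_mult:
  assumes "central x" "central y"
  shows "central (x * y)"
  unfolding central_def
proof
  fix w
  have "proj (x * (y * w)) = proj (x * (w * y))" by (intro proj_mult_cong refl centralD assms)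
  also have "\<dots> = proj ((w * x) * y)"
    unfolding mult.assoc[symmetric] by (intro proj_mult_cong refl centralD assms)
  finally show "proj (x * y * w) = proj (w * (x * y))" by (simp only: mult.assoc)
qed

lemma central_pc: "central (pc c)"
  unfolding central_def by (simp add: pc_commute)

text \<open>\<open>f\<close> is moved between \<open>s\<close> and \<open>E^(m)\<close>, because
  left multiplication by \<open>F^(n) s\<close> and right multiplication by \<open>E^(m)\<close> are
  known on coordinates.\<close>

lemma th_central_mult:
  assumes "central f" "s \<in> cart"
  shows "th (f * (pF n * s * pE m)) k k' L
    = zb (int k') m * (zb (int k) n * (phi s (L - 2 * int (k - n)) * th f (k - n) (k' - m) L))"
proof -
  have "proj (f * (pF n * s) * pE m) = proj (pF n * s * f * pE m)"
    by (intro proj_mult_cong refl centralD assms)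
  then have "th (f * (pF n * s) * pE m) k k' L = th (pF n * s * f * pE m) k k' L" by (rule th_cong)
  then have "th (f * (pF n * s * pE m)) k k' L = th (pF n * (s * f) * pE m) k k' L"
    by (simp only: mult.assoc)
  then show ?thesis
    by (simp add: th_mult_pE th_pF th_cart_mult[OF assms(2)])
qed

text \<open>\<open>0 < N\<close> ensures that \<open>s 0 0\<close>, which carries
  \<open>phi g\<close>, is among the coefficients read off from \<open>g\<close>.\<close>

lemma expansion:
  obtains s N where "\<And>a b. s a b \<in> cart" "0 < N"
    "proj g = proj (\<Sum>a<N. \<Sum>b<N. pF a * s a b * pE b)"
    "\<And>a b L. a < N \<Longrightarrow> b < N \<Longrightarrow> phi (s a b) L = th g a b L"
proof -
  obtain s N0 where s: "\<And>a b. s a b \<in> cart"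
    "\<And>N. N0 \<le> N \<Longrightarrow> proj g = proj (\<Sum>a<N. \<Sum>b<N. pF a * s a b * pE b)"
    using pbw_normal_form[of g] by blast
  define N where "N = Suc N0"
  have g: "proj g = proj (\<Sum>a<N. \<Sum>b<N. pF a * s a b * pE b)" by (rule s(2)) (simp add: N_def)
  have "phi (s a b) L = th g a b L" if "a < N" "b < N" for a b L
  proof -
    have "th g a b L = (\<Sum>a'<N. \<Sum>b'<N. if b' = b then if a' = a then phi (s a b) L else 0 else 0)"
      unfolding th_cong[OF g] by (simp only: theta_sum th_basis[OF s(1)]) (intro sum.cong, auto)
    also have "\<dots> = phi (s a b) L" using that by simp
    finally show ?thesis by simp
  qed
  moreover have "0 < N" by (simp add: N_def)
  ultimately show ?thesis using that s(1) g by blast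
qed

text \<open>The first premise keeps the link between the Cartan coefficient and the coordinates of
  \<open>g\<close>; the filtration argument depends on it.\<close>

lemma th_mult_induct:
  assumes "\<And>s n m. s \<in> cart \<Longrightarrow> (\<And>L. phi s L = th g n m L) \<Longrightarrow> Q (f * (pF n * s * pE m))"
    and "\<And>x y. Q x \<Longrightarrow> Q y \<Longrightarrow> Q (x + y)" "\<And>x y. Q x \<Longrightarrow> proj x = proj y \<Longrightarrow> Q y" "Q 0"
  shows "Q (f * g)"
proof -
  obtain s N where s: "\<And>a b. s a b \<in> cart" "proj g = proj (\<Sum>a<N. \<Sum>b<N. pF a * s a b * pE b)"
    and val: "\<And>a b L. a < N \<Longrightarrow> b < N \<Longrightarrow> phi (s a b) L = th g a b L"
    by (rule expansion[of g]) blast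
  have sum: "Q (\<Sum>i\<in>A. h i)" if "\<And>i. i \<in> A \<Longrightarrow> Q (h i)" for h :: "nat \<Rightarrow> 'k pre_tensor" and A
    using that by (induction A rule: infinite_finite_induct) (auto intro: assms)
  have "Q (\<Sum>a<N. \<Sum>b<N. f * (pF a * s a b * pE b))"
    by (intro sum assms(1) s(1) val) auto
  moreover have "proj (\<Sum>a<N. \<Sum>b<N. f * (pF a * s a b * pE b)) = proj (f * g)"
    unfolding sum_distrib_left[symmetric] by (intro proj_mult_cong refl s(2)[symmetric])
  ultimately show ?thesis by (rule assms(3))
qed

text \<open>At a = b = 0 only the term of \<open>g\<close> without \<open>E\<close> and
  \<open>F\<close> contributes, since a binomial with 0 on top and a positive lower entry
  vanishes.\<close>

lemma phi_mult:
  assumes "central f"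
  shows "phi (f * g) L = phi f L * phi g L"
proof -
  obtain s N where s: "\<And>a b. s a b \<in> cart" and N: "0 < N"
    and g: "proj g = proj (\<Sum>a<N. \<Sum>b<N. pF a * s a b * pE b)"
    and val: "\<And>a b L. a < N \<Longrightarrow> b < N \<Longrightarrow> phi (s a b) L = th g a b L"
    by (rule expansion[of g]) blast
  have z0: "zb 0 n = (if n = 0 then 1 else 0)" for n by (cases n) auto
  have "phi (f * g) L = phi (\<Sum>a<N. \<Sum>b<N. f * (pF a * s a b * pE b)) L"
    unfolding sum_distrib_left[symmetric] by (intro th_cong proj_mult_cong refl g)
  also have "\<dots> = (\<Sum>a<N. \<Sum>b<N. if b = 0 then if a = 0 then phi f L * phi (s 0 0) L else 0 else 0)"
    by (simp only: theta_sum th_central_mult[OF assms s]) (intro sum.cong, auto simp: z0)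
  also have "\<dots> = phi f L * phi g L" using N val by simp
  finally show ?thesis .
qed

section \<open>The filtration by total degree \<open>a + b\<close>, and rigidity of central
  idempotents\<close>

definition filt :: "nat \<Rightarrow> 'k pre_tensor \<Rightarrow> bool" where
  "filt m x \<longleftrightarrow> (\<forall>a b L. a + b < m \<longrightarrow> th x a b L = 0)"

lemma filt_cong:
  assumes "filt m x" "proj x = proj y"
  shows "filt m y"
  using assms(1) unfolding filt_def th_cong[OF assms(2)] .

text \<open>A nonzero contribution to the coordinate \<open>(a, b)\<close> takes
  \<open>(i, j)\<close> from \<open>g\<close> and \<open>(a - i, b - j)\<close> from
  \<open>f\<close>, so orders add.\<close>

lemma filt_mult:
  assumes "central f" "filt m f" "filt n g"
  shows "filt (m + n) (f * g)"
proof (rule th_mult_induct)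
  fix s i j assume s: "s \<in> cart" "\<And>L. phi s L = th g i j L"
  show "filt (m + n) (f * (pF i * s * pE j))"
    unfolding filt_def
  proof (intro allI impI)
    fix a b L assume ab: "a + b < m + n"
    consider "a < i \<or> b < j" | "i + j < n" | "a - i + (b - j) < m" using ab by linarith
    then show "th (f * (pF i * s * pE j)) a b L = 0"
      unfolding th_central_mult[OF assms(1) s(1)] s(2)
      by cases (use assms(2,3) in \<open>auto simp: filt_def qb_eq_0\<close>)
  qed
next
  show "filt k x \<Longrightarrow> filt k y \<Longrightarrow> filt k (x + y)" for k x y by (simp add: filt_def theta_add)
qed (rule filt_cong, assumption+, simp add: filt_def)

lemma filt_1: "(\<And>L. phi x L = 0) \<Longrightarrow> filt 1 x"
  by (auto simp: filt_def)

lemma filt_0: "filt 0 x"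
  by (simp add: filt_def)

text \<open>Squaring doubles the order and leaves the class of \<open>f\<close> unchanged, so every
  coordinate of \<open>f\<close> vanishes.\<close>

lemma central_idempotent_eq_0:
  assumes "central f" "proj (f * f) = proj f" "\<And>L. phi f L = 0"
  shows "proj f = proj 0"
proof -
  have "filt (Suc m) f" for m
  proof (induction m)
    case 0
    then show ?case using filt_1 assms(3) by simp
  next
    case (Suc m)
    have "filt (Suc m + Suc m) f" by (rule filt_cong[OF filt_mult[OF assms(1) Suc Suc] assms(2)])
    then show ?case by (auto simp: filt_def)
  qed
  then have "th f a b L = 0" for a b L by (auto simp: filt_def)
  then show ?thesis by (simp add: proj_eq_iff_th)
qed

text \<open>The elements e - e f and f - f e are central idempotents on which \<open>phi\<close>
  vanishes.\<close>

lemma central_idempotents_eq: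
  assumes e: "central e" "proj (e * e) = proj e" and f: "central f" "proj (f * f) = proj f"
    and "\<And>L. phi e L = phi f L"
  shows "proj e = proj f"
proof -
  have *: "proj x = proj (x * y)"
    if x: "central x" "proj (x * x) = proj x" and y: "central y" "proj (y * y) = proj y"
      and xy: "\<And>L. phi x L = phi y L" for x y
  proof -
    have xyx: "proj (x * y * x) = proj (x * y)"
    proof -
      have "proj (x * y * x) = proj (x * (x * y))" using centralD[OF x(1), of "x * y"] by simp
      also have "\<dots> = proj (x * y)" unfolding mult.assoc[symmetric] by (intro proj_mult_cong x refl)
      finally show ?thesis .
    qed
    have xyxy: "proj (x * y * (x * y)) = proj (x * y)"
    proof -
      have "proj (x * y * (x * y)) = proj (x * y * y)"
        unfolding mult.assoc[symmetric] by (intro proj_mult_cong xyx refl)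
      also have "\<dots> = proj (x * y)" unfolding mult.assoc by (intro proj_mult_cong y refl)
      finally show ?thesis .
    qed
    have xxy: "proj (x * (x * y)) = proj (x * y)"
      unfolding mult.assoc[symmetric] by (intro proj_mult_cong x refl)
    let ?h = "x - x * y"
    have "?h * ?h = x * x - x * (x * y) - (x * y * x - x * y * (x * y))"
      by (simp add: algebra_simps)
    also have "proj \<dots> = proj (x - x * y - (x * y - x * y))"
      by (intro proj_diff_cong x xyx xyxy xxy)
    finally have "proj (?h * ?h) = proj ?h" by simp
    moreover have "central ?h" by (intro central_diff central_mult x y)
    moreover have "phi ?h L = 0" for L
    proof -
      have "phi x L = phi x L * phi x L" using th_cong[OF x(2), of 0 0 L] phi_mult[OF x(1), of x L] by simp
      then show ?thesis by (simp add: theta_diff phi_mult[OF x(1)] xy[symmetric])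
    qed
    ultimately have "proj ?h = proj 0" by (intro central_idempotent_eq_0)
    then show ?thesis unfolding proj_eq_iff by simp
  qed
  have "proj e = proj (e * f)" by (rule *) (use assms in auto)
  also have "\<dots> = proj (f * e)" by (rule centralD[OF e(1)])
  also have "\<dots> = proj f" by (rule *[symmetric]) (use assms in auto)
  finally show ?thesis .
qed

text \<open>On a residue class \<open>phi f\<close> is a polynomial p in m with p (p - 1) zero at
  all integers, so p is 0 or 1.\<close>

lemma phi_periodic:
  assumes "central f" "proj (f * f) = proj f"
  shows "phi f L = 0 \<or> phi f L = 1" "int l dvd L - M \<Longrightarrow> phi f L = phi f M"
proof -
  have sq: "phi f L * phi f L = phi f L" for L
    using th_cong[OF assms(2), of 0 0 L] phi_mult[OF assms(1), of f L] by simp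
  then have "phi f L * (phi f L - 1) = 0" for L by (simp add: right_diff_distrib)
  then show "phi f L = 0 \<or> phi f L = 1" by auto
  obtain s N where s: "\<And>a b. s a b \<in> cart" and N: "0 < N"
    and val: "\<And>a b L. a < N \<Longrightarrow> b < N \<Longrightarrow> phi (s a b) L = th f a b L"
    by (rule expansion[of f]) blast
  \<comment> \<open>This reduces the question to Cartan elements, for which polynomiality follows by
    induction on \<open>cart\<close>.\<close>
  have phi: "phi f L = phi (s 0 0) L" for L using val N by simp
  have polynomial: "\<exists>p. \<forall>m. phi x (int l * m + r) = poly p (of_int m)" if "x \<in> cart" "0 \<le> r" "r < int l" for x r
    using that(1)
  proof induction
    case (base c i j)
    have "phi (pc c * pK ^ i * pH ^ j) (int l * m + r)
      = poly (monom (c * \<zeta> powi (int i * r)) j) (of_int m)" for m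
    proof -
      have "\<zeta> powi (int i * (int l * m + r)) = \<zeta> powi (int i * r)"
        by (rule zeta_cong) (simp add: algebra_simps)
      moreover have "(int l * m + r) div int l = m" using that by (simp add: div_pos_pos_trivial)
      ultimately show ?thesis
        using th_base[of c i j 1 0 0 "int l * m + r"] by (simp add: th_1 poly_monom)
    qed
    then show ?case by blast
  next
    case (add x y)
    then obtain p q where "\<forall>m. phi x (int l * m + r) = poly p (of_int m)"
      "\<forall>m. phi y (int l * m + r) = poly q (of_int m)" by blast
    then have "\<forall>m. phi (x + y) (int l * m + r) = poly (p + q) (of_int m)" by (simp add: theta_add)
    then show ?case by blast
  next
    case (proj x y)
    then show ?case unfolding th_cong[OF proj(2)] by blast
  qed
  have const: "phi f (int l * m + r) = phi f r" if r: "0 \<le> r" "r < int l" for r m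
  proof -
    obtain p where p: "\<And>m. phi f (int l * m + r) = poly p (of_int m)"
      using polynomial[OF s r] unfolding phi by blast
    have "poly (p * (p - 1)) x = 0" if "x \<in> range of_int" for x
    proof -
      from that obtain m where "x = of_int m" by blast
      with p[of m] have "poly p x = phi f (int l * m + r)" by simp
      then show ?thesis using sq[of "int l * m + r"] by (simp only: poly_mult poly_diff poly_1 right_diff_distrib) simp
    qed
    moreover have "infinite (range (of_int :: int \<Rightarrow> 'k))"
      using infinite_UNIV_int by (simp add: finite_image_iff inj_on_def)
    ultimately have "infinite {x. poly (p * (p - 1)) x = 0}"
      by (meson infinite_super mem_Collect_eq subsetI)
    then have "p * (p - 1) = 0" using poly_roots_finite by blast
    then have "p = 0 \<or> p = 1" by auto
    then have "poly p (of_int m) = poly p (of_int 0)" by auto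
    then show ?thesis using p[of m] p[of 0] by simp
  qed
  have mod: "phi f L = phi f (L mod int l)" for L
    using const[of "L mod int l" "L div int l"] l_gt_1 by simp
  assume "int l dvd L - M"
  then have "L mod int l = M mod int l" by (simp only: mod_eq_dvd_iff)
  then show "phi f L = phi f M" using mod by metis
qed

text \<open>By \<open>coords_dE_dF\<close> only the term of \<open>x\<close> without
  \<open>E\<close> and \<open>F\<close> contributes, and its Cartan part meets a vector of weight n
  - 1 - 2 n = - n - 1.\<close>

lemma th_mult_pF: "th (x * pF n) n 0 (int n - 1) = phi x (- int n - 1)"
  using pbw_all[of x]
proof (induction rule: pbw.induct)
  case (base z a b)
  have *: "th (pE b * pF n) k 0 (int n - 1) = (if b = 0 \<and> k = n then 1 else 0)" for k
    by (simp add: pure_mult theta_pure times_UA.rep_eq UA_dE.rep_eq UA_dF.rep_eq coords_dE_dF)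
  have "th (pF a * z * pE b * pF n) n 0 (int n - 1)
    = zb (int n) a * (phi z (int n - 1 - 2 * int (n - a)) * th (pE b * pF n) (n - a) 0 (int n - 1))"
    by (simp only: mult.assoc th_pF th_cart_mult[OF base])
  also have "\<dots> = (if a = 0 \<and> b = 0 then phi z (- int n - 1) else 0)"
  proof (cases "a = 0")
    case False
    then have "n - a \<noteq> n \<or> zb (int n) a = 0" by (cases "n < a") (auto simp: qb_eq_0)
    then show ?thesis using False by (auto simp: *)
  qed (auto simp: * intro!: arg_cong[of _ _ "phi z"])
  finally show ?case by (simp add: th_basis[OF base])
next
  case (add x y)
  then show ?case by (simp add: distrib_right theta_add)
next
  case (proj x y)
  have "proj (x * pF n) = proj (y * pF n)" by (intro proj_mult_cong proj refl)
  from th_cong[OF this] th_cong[OF proj(2)] proj.IH show ?case by simp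
qed

text \<open>A central element acts by one scalar on a Verma module, hence has the same value at the
  highest weight \<open>n - 1\<close> and at the singular vector.\<close>

lemma phi_linkage: "central f \<Longrightarrow> phi f (int n - 1) = phi f (- int n - 1)"
  using th_cong[OF centralD[of f "pF n"], of n 0 "int n - 1"] by (simp add: th_mult_pF th_pF)

text \<open>Representatives of the elements of the small quantum group, as
  \<open>carrier_small_u\<close> confirms; the inverse of \<open>K\<close> enters as a power of
  \<open>K\<close>.\<close>

inductive_set small :: "'k pre_tensor set" where
  pc: "pc c \<in> small"
| E: "pure UA_E 1 \<in> small"
| F: "pure UA_F 1 \<in> small"
| K: "pK \<in> small"
| add: "x \<in> small \<Longrightarrow> y \<in> small \<Longrightarrow> x + y \<in> small"
| mult: "x \<in> small \<Longrightarrow> y \<in> small \<Longrightarrow> x * y \<in> small"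
| proj: "x \<in> small \<Longrightarrow> proj x = proj y \<Longrightarrow> y \<in> small"

lemma small_uminus: "x \<in> small \<Longrightarrow> - x \<in> small"
  by (rule small.proj[OF small.mult[OF small.pc] proj_pc_m1])

lemma small_diff: "x \<in> small \<Longrightarrow> y \<in> small \<Longrightarrow> x - y \<in> small"
  using small.add[OF _ small_uminus] by fastforce

lemma small_power: "x \<in> small \<Longrightarrow> x ^ n \<in> small"
  using small.pc[of 1] by (induction n) (auto intro: small.mult)

lemma small_pKi: "pKi \<in> small"
  by (rule small.proj[OF small_power[OF small.K] pKi[symmetric]])

text \<open>Arrays supported on a, b < l are stable under \<open>E\<close>, \<open>F\<close> and
  \<open>K\<close>, because the step from l - 1 to l carries the factor \<open>[l] = 0\<close>; and
  the unit has such an array.\<close>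

lemma small_bounded:
  assumes "x \<in> small" "a \<ge> l \<or> b \<ge> l"
  shows "th x a b L = 0"
proof -
  define B where "B = {y. \<forall>a b L. a \<ge> l \<or> b \<ge> l \<longrightarrow> th y a b L = 0}"
  have qi_l: "qi \<zeta> (int l) = 0" by (simp add: qi_zeta_eq_0_iff)
  have "x * y \<in> B" if "y \<in> B" for y
    using assms(1) that
  proof (induction arbitrary: y)
    case (pc c)
    then show ?case by (auto simp: B_def th_pc)
  next
    case E
    have "th (pure UA_E 1 * y) a b L = 0" if "a \<ge> l \<or> b \<ge> l" for a b L
    proof -
      have "qi \<zeta> (int b) * th y a (b - 1) (L - 2) = 0"
        using that E qi_l by (cases "b = l") (auto simp: B_def)
      moreover have "th y (Suc a) b L = 0" using that E by (auto simp: B_def)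
      ultimately show ?thesis by (simp add: th_pE1)
    qed
    then show ?case by (simp add: B_def)
  next
    case F
    have "th (pF 1 * y) a b L = 0" if "a \<ge> l \<or> b \<ge> l" for a b L
    proof -
      have "zb (int a) 1 = qi \<zeta> (int a)"
        using zb_Suc[of "int a" 0] by (simp add: qi_1[OF zeta_neq_inverse])
      then have "zb (int a) 1 * th y (a - 1) b L = 0"
        using that F qi_l by (cases "a = l") (auto simp: B_def)
      then show ?thesis by (simp only: th_pF)
    qed
    then show ?case by (simp add: B_def UA_F_eq)
  next
    case K
    then show ?case by (auto simp: B_def th_pK)
  next
    case (add x x')
    then show ?case by (auto simp: B_def distrib_right theta_add)
  next
    case (mult x x')
    then show ?case by (simp add: mult.assoc)
  next
    case (proj x x')
    have h: "proj (x * y) = proj (x' * y)" by (intro proj_mult_cong proj refl)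
    show ?case using proj.IH[OF proj.prems] unfolding B_def mem_Collect_eq th_cong[OF h] .
  qed
  from this[of 1] have "x \<in> B" using l_gt_1 by (auto simp: B_def th_1)
  then show ?thesis using assms(2) unfolding B_def by blast
qed

text \<open>The central character of the Casimir element at highest weight \<open>L\<close>.\<close>

definition chi :: "int \<Rightarrow> 'k" where
  "chi L = \<zeta> powi (L + 1) + \<zeta> powi (- (L + 1))"

abbreviation pC :: "'k pre_tensor" where "pC \<equiv> pure UA_C 1"

lemma phi_pC: "phi pC L = chi L"
  by (simp only: theta_pure UA_C.rep_eq coords_casimir chi_def sp_add[OF integral_powi integral_powi] sp_powi mult_1_left)

lemma central_pC: "central pC"
  unfolding central_def
proof
  fix y
  have "UA_C * u = u * UA_C" for u
    using casimir_commute[OF Rep_UA, of u] by (simp add: times_UA.rep_eq UA_C.rep_eq flip: Rep_UA_inject)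
  then have "pC * y = y * pC"
    by (induction y rule: pre_tensor_induct) (simp_all add: pure_mult distrib_left distrib_right)
  then show "proj (pC * y) = proj (y * pC)" by simp
qed

lemma small_pC: "pC \<in> small"
proof -
  \<comment> \<open>The summands are named as elements of the integral form, because only sums
    formed there split under the tensor sign.\<close>
  define t1 t2 t3 where "t1 = Abs_UA (scl ((qvar - inverse qvar)^2) (uF * uE))"
    and "t2 = Abs_UA (scl (qvar powi 1) uK)" and "t3 = Abs_UA (scl (qvar powi (-1)) uKi)"
  have FE: "uF * uE \<in> UA_set"
    using UA_set.divided_E[of 1] UA_set.divided_F[of 1] unfolding divided_power_1 by (rule UA_set.mult[rotated])
  have t: "Rep_UA t1 = scl ((qvar - inverse qvar)^2) (Rep_UA (UA_F * UA_E))"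
    "Rep_UA t2 = scl (qvar powi 1) (Rep_UA UA_K)" "Rep_UA t3 = scl (qvar powi (-1)) (Rep_UA UA_Ki)"
    unfolding t1_def t2_def t3_def times_UA.rep_eq UA_F.rep_eq UA_E.rep_eq UA_K.rep_eq UA_Ki.rep_eq
    by (rule Abs_UA_inverse[OF UA_set_scl[OF integral_d2 FE]] Abs_UA_inverse[OF UA_set_scl[OF integral_powi UA_set.K]]
        Abs_UA_inverse[OF UA_set_scl[OF integral_powi UA_set.Kinv]])+
  have "UA_C = t1 + t2 + t3"
    unfolding Rep_UA_inject[symmetric] plus_UA.rep_eq t UA_C.rep_eq casimir_def
    by (simp only: times_UA.rep_eq UA_F.rep_eq UA_E.rep_eq UA_K.rep_eq UA_Ki.rep_eq)
  then have 1: "proj pC = proj (pure t1 1 + pure t2 1 + pure t3 1)"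
    by (metis proj_pure_add_left proj_add_cong)
  have "pure (UA_F * UA_E) 1 \<in> small"
    using small.mult[OF small.F small.E] by (simp add: pure_mult)
  then have "pure t1 1 \<in> small"
    by (rule small.proj[OF small.mult[OF small.pc] proj_scl[OF integral_d2 t(1), symmetric]])
  moreover have "pure t2 1 \<in> small"
    by (rule small.proj[OF small.mult[OF small.pc small.K] proj_scl[OF integral_powi t(2), symmetric]])
  moreover have "pure t3 1 \<in> small"
    by (rule small.proj[OF small.mult[OF small.pc small_pKi] proj_scl[OF integral_powi t(3), symmetric]])
  ultimately show ?thesis by (metis 1 small.add small.proj)
qed

text \<open>Horner's scheme in the Casimir element, with \<open>phi\<close> multiplicative in each
  step.\<close>

lemma poly_pC: "\<exists>s\<in>small. central s \<and> (\<forall>L. phi s L = poly p (chi L))"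
proof (induction p)
  case 0
  have "0 \<in> small" by (rule small.proj[OF small.pc[of 0]]) (rule proj_pure_0)
  moreover have "central 0" by (simp add: central_def)
  ultimately show ?case by force
next
  case (pCons a p)
  then obtain s where s: "s \<in> small" "central s" "\<forall>L. phi s L = poly p (chi L)" by blast
  have "phi (pc a + pC * s) L = poly (pCons a p) (chi L)" for L
  proof -
    have "phi (pc a) L = a" using th_pc[of a 1 0 0 L] by (simp add: th_1)
    then show ?thesis using s(3) by (simp add: theta_add phi_mult[OF central_pC] phi_pC)
  qed
  moreover have "pc a + pC * s \<in> small" by (intro small.add small.mult small.pc small_pC s)
  moreover have "central (pc a + pC * s)" by (intro central_add central_mult central_pc central_pC s)
  ultimately show ?case by blast
qed

text \<open>The Casimir element separates all weights except those that \<open>phi_periodic\<close>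
  and \<open>phi_linkage\<close> identify; so \<open>phi f\<close> is a function of
  \<open>chi\<close>.\<close>

lemma chi_eq:
  assumes "chi L = chi M"
  shows "int l dvd L - M \<or> int l dvd L - (- M - 2)"
proof -
  let ?x = "\<zeta> powi (L + 1)" and ?y = "\<zeta> powi (M + 1)"
  have nz: "?x \<noteq> 0" "?y \<noteq> 0" by simp_all
  have "?x + inverse ?x = ?y + inverse ?y" using assms unfolding chi_def power_int_minus .
  then consider "?x = ?y" | "?x * ?y = 1" using add_inverse_eq[OF nz] by blast
  then show ?thesis
  proof cases
    case 1
    have "\<zeta> powi (L - M) = ?x / ?y" using nz by (simp add: power_int_diff[symmetric])
    then have "int l dvd L - M" using 1 nz by (simp add: zeta_powi_eq_1_iff)
    then show ?thesis ..
  next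
    case 2
    then have "\<zeta> powi (L + 1 + (M + 1)) = 1" by (simp only: powi_shift[OF zeta_nonzero])
    then have "int l dvd L + 1 + (M + 1)" by (simp only: zeta_powi_eq_1_iff)
    then show ?thesis by (simp add: algebra_simps)
  qed
qed

lemma central_idempotent_interpolation:
  assumes "central f" "proj (f * f) = proj f"
  shows "\<exists>s\<in>small. central s \<and> (\<forall>L. phi s L = phi f L)"
proof -
  note per = phi_periodic(2)[OF assms]
  \<comment> \<open>\<open>0 \<le> M\<close> since linkage is available for the natural number n = M
    + 1; each residue class contains such an \<open>M\<close>.\<close>
  have eq: "phi f L = phi f M" if "chi L = chi M" "0 \<le> M" for L M
    using chi_eq[OF that(1)]
  proof
    assume "int l dvd L - (- M - 2)"
    then have "phi f L = phi f (- M - 2)" by (rule per)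
    also have "\<dots> = phi f M"
      using phi_linkage[OF assms(1), of "nat (M + 1)"] that(2) by (simp add: algebra_simps)
    finally show ?thesis .
  qed (rule per)
  \<comment> \<open>The common value of \<open>phi f\<close> on a fibre of \<open>chi\<close>, read
    off at some nonnegative weight.\<close>
  define g where "g v = phi f (SOME M. 0 \<le> M \<and> chi M = v)" for v
  have g: "g (chi M) = phi f M" if "0 \<le> M" for M
  proof -
    have "0 \<le> (SOME N. 0 \<le> N \<and> chi N = chi M) \<and> chi (SOME N. 0 \<le> N \<and> chi N = chi M) = chi M"
      by (rule someI[of "\<lambda>N. 0 \<le> N \<and> chi N = chi M"]) (use that in auto)
    then show ?thesis unfolding g_def using eq that by metis
  qed
  obtain p where p: "\<forall>v\<in>chi ` {0..<int l}. poly p v = g v"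
    using interpolation[of "chi ` {0..<int l}" g] by auto
  obtain s where s: "s \<in> small" "central s" "\<forall>L. phi s L = poly p (chi L)" using poly_pC by blast
  have "phi s L = phi f L" for L
  proof -
    let ?M = "L mod int l"
    have M: "?M \<in> {0..<int l}" using l_gt_1 by simp
    have d: "int l dvd L - ?M" by (simp add: minus_mod_eq_mult_div)
    have "int l dvd (L + 1) - (?M + 1)" "int l dvd - (L + 1) - (- (?M + 1))"
      using d by (simp_all add: dvd_diff_commute)
    from this[THEN zeta_cong] have "chi L = chi ?M" unfolding chi_def by (simp only:)
    then have "phi s L = phi f ?M" using s(3) p g M by auto
    then show ?thesis using per[OF d] by simp
  qed
  then show ?thesis using s by blast
qed

text \<open>The step \<open>s \<mapsto> 3s\<^sup>2 - 2s\<^sup>3\<close> squares the defect \<open>s\<^sup>2 - s\<close> up to a factor.\<close>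

lemma idempotent_lifting:
  assumes "s \<in> small" "central s" "\<And>L. phi s L = 0 \<or> phi s L = 1"
  shows "\<exists>e\<in>small. central e \<and> (\<forall>L. phi e L = phi s L) \<and> proj (e * e) = proj e"
proof -
  have "\<exists>e\<in>small. central e \<and> (\<forall>L. phi e L = phi s L) \<and> filt (Suc k) (e * e - e)" for k
  proof (induction k)
    case 0
    have "phi (s * s - s) L = 0" for L
      using assms(3)[of L] by (auto simp: theta_diff phi_mult[OF assms(2)])
    then show ?case using assms filt_1 by auto
  next
    case (Suc k)
    then obtain e where e: "e \<in> small" "central e" "\<forall>L. phi e L = phi s L" "filt (Suc k) (e * e - e)"
      by blast
    let ?d = "e * e - e" and ?e' = "e * e + e * e + e * e - e * e * e - e * e * e"
    have d: "central ?d" by (intro central_diff central_mult e)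
    \<comment> \<open>The factor d d doubles the order, while the cofactor 4 d - 3 contributes order
      0.\<close>
    have "filt (Suc k + Suc k + 0) (?d * ?d * (?d + ?d + ?d + ?d - 1 - 1 - 1))"
      by (intro filt_mult central_mult d e filt_0)
    moreover have "?d * ?d * (?d + ?d + ?d + ?d - 1 - 1 - 1) = ?e' * ?e' - ?e'"
      by (simp add: algebra_simps)
    ultimately have "filt (Suc (Suc k)) (?e' * ?e' - ?e')" by (auto simp: filt_def)
    moreover have "phi ?e' L = phi s L" for L
    proof -
      have "phi e L = 0 \<or> phi e L = 1" using e(3) assms(3) by simp
      then show ?thesis
        using e(3) by (auto simp: theta_add theta_diff phi_mult[OF e(2)] phi_mult[OF central_mult[OF e(2,2)]])
    qed
    moreover have "?e' \<in> small" by (intro small_diff small.add small.mult e)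
    moreover have "central ?e'" by (intro central_diff central_add central_mult e)
    ultimately show ?case by blast
  qed
  \<comment> \<open>A coordinate with a + b > 2 l has a >= l or b >= l and vanishes on
    \<open>small\<close>, so this order makes the defect zero.\<close>
  from this[of "2 * l"] obtain e where e: "e \<in> small" "central e" "\<forall>L. phi e L = phi s L"
    "filt (Suc (2 * l)) (e * e - e)" by blast
  have "th (e * e - e) a b L = 0" for a b L
  proof (cases "a + b < Suc (2 * l)")
    case False
    then have "a \<ge> l \<or> b \<ge> l" by linarith
    then show ?thesis by (intro small_bounded small_diff small.mult e)
  qed (use e(4) in \<open>simp add: filt_def\<close>)
  then have "proj (e * e) = proj e" by (simp add: proj_eq_iff_th theta_diff)
  then show ?thesis using e by blast
qed

theorem central_idempotent_small:
  assumes "central f" "proj (f * f) = proj f"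
  shows "f \<in> small"
proof -
  obtain s where s: "s \<in> small" "central s" "\<forall>L. phi s L = phi f L"
    using central_idempotent_interpolation[OF assms] by blast
  obtain e where e: "e \<in> small" "central e" "\<forall>L. phi e L = phi s L" "proj (e * e) = proj e"
    using idempotent_lifting[OF s(1,2)] s(3) phi_periodic(1)[OF assms] by auto
  have "proj e = proj f"
    by (rule central_idempotents_eq) (use e s assms in auto)
  then show ?thesis using e(1) small.proj by blast
qed

end

section \<open>Central idempotents of the small quantum group\<close>

lemma dE_F: "dE (Suc n) * uF = uF * dE (Suc n) + kb (- int n) 1 * dE n"
proof -
  let ?f = "\<lambda>t. dFi (1 - int t) * kb (2 * int t - int (Suc n) - 1) t * dE (Suc n - t)"
  have "dE (Suc n) * dF 1 = (\<Sum>t\<le>Suc n. ?f t)"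
    using dE_dF[of "Suc n" 1] by simp
  also have "\<dots> = (\<Sum>t\<in>{0, 1}. ?f t)"
    by (rule sum.mono_neutral_right) (auto simp: dFi_def)
  also have "\<dots> = dF 1 * dE (Suc n) + kb (- int n) 1 * dE n"
    by (simp add: dFi_def)
  finally show ?thesis unfolding divided_power_1 .
qed

context root_of_unity
begin

lemma zb_1: "zb L 1 = qi \<zeta> L"
  using zb_Suc[of L 0] by (simp add: qi_1[OF zeta_neq_inverse])

text \<open>A comparison of coordinates, with \<open>K^(l-1)\<close> in the place of the inverse of
  \<open>K\<close>.\<close>

lemma small_pkb_1: "pkb c 1 \<in> small"
proof -
  let ?i = "inverse (\<zeta> - inverse \<zeta>)"
  let ?y = "pc ?i * (pc (\<zeta> powi c) * pK ^ 1 - pc (\<zeta> powi (- c)) * pK ^ (l - 1))"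
  have "th (pkb c 1 * 1) a b L = th (?y * 1) a b L" for a b L
  proof -
    let ?m = "L - 2 * int a"
    have "int (l - 1) * ?m - (- ?m) = int l * ?m" using l_gt_1 by (simp add: of_nat_diff algebra_simps)
    then have "\<zeta> powi (int (l - 1) * ?m) = \<zeta> powi (- ?m)" by (intro zeta_cong) (simp only: dvd_triv_left)
    then have "th (?y * 1) a b L = ?i * (\<zeta> powi c * \<zeta> powi ?m - \<zeta> powi (- c) * \<zeta> powi (- ?m)) * th 1 a b L"
      by (simp only: mult.assoc left_diff_distrib th_pc theta_diff th_pK_power of_nat_1 mult_1_left)
    also have "?i * (\<zeta> powi c * \<zeta> powi ?m - \<zeta> powi (- c) * \<zeta> powi (- ?m)) = zb (?m + c) 1"
      unfolding zb_1 qi_def powi_shift[OF zeta_nonzero] by (simp add: divide_inverse add.commute)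
    finally show ?thesis by (simp only: th_pkb)
  qed
  then have "proj (pkb c 1) = proj ?y" by (simp add: proj_eq_iff_th)
  moreover have "?y \<in> small" by (intro small.mult small_diff small.pc small_power small.K)
  ultimately show ?thesis by (metis small.proj)
qed

section \<open>Divided powers at \<open>\<zeta>\<close> and their commutators with the small
  algebra\<close>

lemma proj_divided_power_mult:
  assumes "\<And>n. Rep_UA (u n) = divided_power x n"
  shows "proj (pure (u m) 1 * pure (u n) 1) = proj (pc (zb (int (m + n)) n) * pure (u (m + n)) 1)"
proof -
  have "Rep_UA (u m * u n) = scl (qb (int (m + n)) n) (Rep_UA (u (m + n)))"
    unfolding times_UA.rep_eq assms divided_power_mult ..
  then show ?thesis by (simp only: pure_mult mult_1_right proj_scl[OF integral_qb])
qed

lemmas pE_mult = proj_divided_power_mult[OF UA_dE.rep_eq]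
lemmas pF_mult = proj_divided_power_mult[OF UA_dF.rep_eq]

text \<open>Orders 1 and l generate: if l does not divide n, the product of \<open>p (n - 1)\<close>
  and \<open>p 1\<close> has the nonzero coefficient \<open>[n]\<close>; for n = l (s + 1) the
  product of \<open>p (l * s)\<close> and \<open>p l\<close> has the coefficient s + 1. The premise
  on \<open>p l\<close> is conditional, so that the lemma serves both the orders below l in the
  small algebra and all orders in U_zeta.\<close>

lemma divided_powers_closed:
  assumes one: "p 0 \<in> S" and p: "p 1 \<in> S" and pl: "n \<ge> l \<Longrightarrow> p l \<in> S"
    and mult: "\<And>m n. proj (p m * p n) = proj (pc (zb (int (m + n)) n) * p (m + n))"
    and S: "\<And>x y. x \<in> S \<Longrightarrow> y \<in> S \<Longrightarrow> x * y \<in> S" "\<And>c x. x \<in> S \<Longrightarrow> pc c * x \<in> S"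
      "\<And>x y. x \<in> S \<Longrightarrow> proj x = proj y \<Longrightarrow> y \<in> S"
  shows "p n \<in> S"
  using pl
proof (induction n rule: less_induct)
  case (less n)
  have step: "p (m + k) \<in> S" if "p m \<in> S" "p k \<in> S" "zb (int (m + k)) k \<noteq> 0" for m k
    using S(3)[OF S(2)[OF S(1)[OF that(1,2)]] proj_pc_cancel[OF that(3) mult[symmetric], symmetric]] .
  consider "n = 0" | "\<not> l dvd n" | s where "n = l * Suc s"
    by (metis dvd_def mult_0_right not0_implies_Suc)
  then show ?case
  proof cases
    case 2
    then obtain m where n: "n = m + 1" by (metis dvd_0_right add.commute not0_implies_Suc plus_1_eq_Suc)
    have "p m \<in> S" using less n by simp
    moreover have "zb (int (m + 1)) 1 \<noteq> 0" using 2 by (simp only: n zb_1 qi_zeta_eq_0_iff int_dvd_int_iff not_False_eq_True)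
    ultimately show ?thesis using step[of m 1] p n by simp
  next
    case 3
    have n: "n = l * s + l" "l * s < n" using 3 l_gt_1 by simp_all
    have "p (l * s) \<in> S" using less n by simp
    moreover have "zb (int (l * s + l)) l \<noteq> 0"
    proof -
      have "zb (int (l * s + l)) l = of_nat (Suc s)"
        unfolding zb_l using l_gt_1 n(1) 3 by (simp add: zdiv_int[symmetric] flip: of_nat_add of_nat_mult)
      moreover have "of_nat (Suc s) \<noteq> (0 :: 'k)" by (simp only: of_nat_eq_0_iff)
      ultimately show ?thesis by simp
    qed
    ultimately show ?thesis using step[of "l * s" l] less.prems n by simp
  qed (use one in simp)
qed

lemma small_1: "1 \<in> small"
  using small.pc[of 1] by simp

lemma small_0: "0 \<in> small"
  using small_diff[OF small_1 small_1] by simp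

lemma pE_0: "pE 0 = (1 :: 'k pre_tensor)" and pF_0: "pF 0 = (1 :: 'k pre_tensor)"
proof -
  have "UA_dE 0 = 1" "UA_dF 0 = 1"
    by (simp_all add: UA_dE.rep_eq UA_dF.rep_eq one_UA.rep_eq flip: Rep_UA_inject)
  then show "pE 0 = (1 :: 'k pre_tensor)" "pF 0 = (1 :: 'k pre_tensor)" by (simp_all add: pure_one)
qed

lemma small_pE_1: "pE 1 \<in> small" and small_pF_1: "pF 1 \<in> small"
  using small.E small.F by (simp_all only: UA_E_eq UA_F_eq)

lemma small_pE: "n < l \<Longrightarrow> pE n \<in> small"
  by (rule divided_powers_closed[OF _ small_pE_1 _ pE_mult])
    (auto simp: pE_0 small_1 intro: small.mult small.pc small.proj)

lemma small_pF: "n < l \<Longrightarrow> pF n \<in> small"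
  by (rule divided_powers_closed[OF _ small_pF_1 _ pF_mult])
    (auto simp: pF_0 small_1 intro: small.mult small.pc small.proj)

text \<open>The commutator with \<open>w\<close> is a derivation, so the generators decide;
  \<open>w\<close> itself may lie outside \<open>small\<close>.\<close>

lemma commutator_small:
  assumes "x \<in> small"
    and gens: "w * pure UA_E 1 - pure UA_E 1 * w \<in> small" "w * pure UA_F 1 - pure UA_F 1 * w \<in> small"
      "w * pK - pK * w \<in> small"
  shows "w * x - x * w \<in> small"
  using assms(1)
proof induction
  case (pc c)
  then show ?case by (simp add: pc_commute small_0)
next
  case (add x y)
  have "w * (x + y) - (x + y) * w = (w * x - x * w) + (w * y - y * w)" by (simp add: algebra_simps)
  then show ?case using add by (simp add: small.add)
next
  case (mult x y)
  have "w * (x * y) - (x * y) * w = (w * x - x * w) * y + x * (w * y - y * w)" by (simp add: algebra_simps)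
  then show ?case using mult by (simp add: small.add small.mult)
next
  case (proj x y)
  have "proj (w * x - x * w) = proj (w * y - y * w)"
    by (intro proj_diff_cong proj_mult_cong proj refl)
  then show ?case by (rule small.proj[OF proj.IH])
qed (use gens in auto)

lemma pure_diff_small:
  assumes "u = v + t" "pure t c \<in> small"
  shows "pure u c - pure v c \<in> small"
proof -
  have "proj (pure v c + pure t c - pure v c) = proj (pure u c - pure v c)"
    unfolding assms(1) by (intro proj_diff_cong proj_pure_add_left[symmetric] refl)
  then show ?thesis using small.proj[OF assms(2), of "pure u c - pure v c"] by simp
qed

lemma K_divided_power_l:
  assumes "uK * x = scl (qvar powi c) (x * uK)" "Rep_UA u = divided_power x l"
  shows "proj (pK * pure u 1) = proj (pure u 1 * pK)"
proof -
  have "Rep_UA (UA_K * u) = scl (qvar powi (int l * c)) (Rep_UA (u * UA_K))"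
    using K_power_divided_power[OF assms(1), of 1 l] by (simp add: times_UA.rep_eq UA_K.rep_eq assms(2))
  from proj_scl[OF integral_powi this, of 1] show ?thesis
    by (simp add: pure_mult zeta_powi_l)
qed

lemma proj_diff_small: "proj x = proj y \<Longrightarrow> x - y \<in> small"
  using proj_diff_cong[of x y y y] small.proj[OF small_0, of "x - y"] by simp

text \<open>The commutator of \<open>E^(l)\<close> with \<open>F\<close> is
  \<open>[K; 1 - l] E^(l-1)\<close>, where the divided power has order below l. With
  \<open>E\<close> it commutes anyway, and with \<open>K\<close> because
  \<open>\<zeta>^(2 l) = 1\<close>.\<close>

lemma commutator_pE_l: "x \<in> small \<Longrightarrow> pE l * x - x * pE l \<in> small"
proof (erule commutator_small)
  have "UA_dE l * UA_E = UA_E * UA_dE l"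
    by (simp add: times_UA.rep_eq UA_dE.rep_eq UA_E.rep_eq divided_power_scl power_commutes flip: Rep_UA_inject)
  then show "pE l * pure UA_E 1 - pure UA_E 1 * pE l \<in> small" by (simp add: pure_mult small_0)
  have "UA_dE l * UA_F = UA_F * UA_dE l + UA_kb (- int (l - 1)) 1 * UA_dE (l - 1)"
    using dE_F[of "l - 1"] l_gt_1
    by (simp add: times_UA.rep_eq plus_UA.rep_eq UA_dE.rep_eq UA_F.rep_eq UA_kb.rep_eq flip: Rep_UA_inject)
  moreover have "pure (UA_kb (- int (l - 1)) 1 * UA_dE (l - 1)) 1 \<in> small"
    using small.mult[OF small_pkb_1[of "- int (l - 1)"] small_pE[of "l - 1"]] l_gt_1 by (simp add: pure_mult)
  ultimately show "pE l * pure UA_F 1 - pure UA_F 1 * pE l \<in> small"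
    unfolding pure_mult mult_1_right by (rule pure_diff_small)
  show "pE l * pK - pK * pE l \<in> small" by (intro proj_diff_small K_divided_power_l[OF KE UA_dE.rep_eq, symmetric])
qed

lemma commutator_pF_l: "x \<in> small \<Longrightarrow> pF l * x - x * pF l \<in> small"
proof (erule commutator_small)
  have "UA_dF l * UA_F = UA_F * UA_dF l"
    by (simp add: times_UA.rep_eq UA_dF.rep_eq UA_F.rep_eq divided_power_scl power_commutes flip: Rep_UA_inject)
  then show "pF l * pure UA_F 1 - pure UA_F 1 * pF l \<in> small" by (simp add: pure_mult small_0)
  have "UA_E * UA_dF l = UA_dF l * UA_E + UA_dF (l - 1) * UA_kb (- int (l - 1)) 1"
    using E_dF[of "l - 1"] l_gt_1 unfolding kb_1[symmetric]
    by (simp add: times_UA.rep_eq plus_UA.rep_eq UA_dF.rep_eq UA_E.rep_eq UA_kb.rep_eq flip: Rep_UA_inject)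
  moreover have "pure (UA_dF (l - 1) * UA_kb (- int (l - 1)) 1) 1 \<in> small"
    using small.mult[OF small_pF[of "l - 1"] small_pkb_1[of "- int (l - 1)"]] l_gt_1 by (simp add: pure_mult)
  ultimately have "pure UA_E 1 * pF l - pF l * pure UA_E 1 \<in> small"
    unfolding pure_mult mult_1_right by (rule pure_diff_small)
  from small_uminus[OF this] show "pF l * pure UA_E 1 - pure UA_E 1 * pF l \<in> small" by simp
  show "pF l * pK - pK * pF l \<in> small" by (intro proj_diff_small K_divided_power_l[OF KF UA_dF.rep_eq, symmetric])
qed

text \<open>
  A derivation that preserves an algebra kills the central idempotents \<open>e\<close> of that algebra:
  \<open>D e = 2 e (D e)\<close>, and multiplying by \<open>e\<close> gives \<open>e (D e) = 0\<close>.
\<close>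

lemma idempotent_commutes:
  assumes e: "e \<in> small" "proj (e * e) = proj e" "\<And>y. y \<in> small \<Longrightarrow> proj (e * y) = proj (y * e)"
    and w: "w * e - e * w \<in> small"
  shows "proj (e * w) = proj (w * e)"
proof -
  define d where "d = w * e - e * w"
  have ed: "proj (d * e) = proj (e * d)" unfolding d_def by (rule e(3)[OF w, symmetric])
  have "proj d = proj (w * (e * e) - (e * e) * w)"
    unfolding d_def by (intro proj_diff_cong proj_mult_cong e(2)[symmetric] refl)
  also have "w * (e * e) - (e * e) * w = d * e + e * d" by (simp add: d_def algebra_simps)
  also have "proj (d * e + e * d) = proj (e * d + e * d)" by (intro proj_add_cong ed refl)
  finally have d: "proj d = proj (e * d + e * d)" .
  have eed: "proj (e * (e * d)) = proj (e * d)"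
    unfolding mult.assoc[symmetric] by (intro proj_mult_cong e(2) refl)
  have "proj (e * d) = proj (e * (e * d + e * d))" by (intro proj_mult_cong d refl)
  also have "\<dots> = proj (e * d + e * d)" unfolding distrib_left by (intro proj_add_cong eed)
  finally have "proj (0 + e * d) = proj (e * d + e * d)" by simp
  from proj_cancel[OF this] have "proj (e * d) = proj 0" by simp
  then have "proj (e * d + e * d) = proj (0 + 0)" by (intro proj_add_cong)
  then have "proj d = proj 0" using d by simp
  then show ?thesis unfolding proj_eq_iff[of "e * w"] using proj_uminus_cong[of d 0]
    by (simp add: d_def proj_eq_iff)
qed

text \<open>The commutant \<open>S\<close> of \<open>e\<close> is an algebra containing
  \<open>small\<close> and, by \<open>idempotent_commutes\<close>, also \<open>E^(l)\<close> and
  \<open>F^(l)\<close>; so it contains all divided powers, hence everything.\<close>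

lemma small_central_idempotent:
  assumes e: "e \<in> small" "proj (e * e) = proj e" "\<And>y. y \<in> small \<Longrightarrow> proj (e * y) = proj (y * e)"
  shows "central e"
proof -
  define S where "S = {x. proj (e * x) = proj (x * e)}"
  have S_mult: "x * y \<in> S" if "x \<in> S" "y \<in> S" for x y
  proof -
    have "proj (e * x) = proj (x * e)" "proj (e * y) = proj (y * e)" using that by (simp_all add: S_def)
    note * = proj_mult_cong[OF this(1) refl, of y] proj_mult_cong[OF refl this(2), of x]
    have "proj (e * x * y) = proj (x * e * y)" by (rule *(1))
    also have "\<dots> = proj (x * (y * e))" unfolding mult.assoc by (rule *(2))
    finally show ?thesis by (simp add: S_def mult.assoc)
  qed
  have S_small: "x \<in> S" if "x \<in> small" for x using e(3)[OF that] by (simp add: S_def)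
  have S_pc: "pc c * x \<in> S" if "x \<in> S" for c x using S_mult[OF S_small[OF small.pc] that] .
  have S_proj: "y \<in> S" if "x \<in> S" "proj x = proj y" for x y
  proof -
    have "proj (e * y) = proj (e * x)" by (intro proj_mult_cong that(2)[symmetric] refl)
    also have "\<dots> = proj (x * e)" using that(1) by (simp add: S_def)
    also have "\<dots> = proj (y * e)" by (intro proj_mult_cong that(2) refl)
    finally show ?thesis by (simp add: S_def)
  qed
  have S_add: "x + y \<in> S" if "x \<in> S" "y \<in> S" for x y
    using that unfolding S_def mem_Collect_eq distrib_left distrib_right by (intro proj_add_cong)
  have S_uminus: "- x \<in> S" if "x \<in> S" for x
    by (rule S_proj[OF S_pc[OF that] proj_pc_m1])
  have pE: "pE n \<in> S" for n
  proof (rule divided_powers_closed[OF _ S_small[OF small_pE_1] _ pE_mult S_mult S_pc S_proj])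
    show "pE l \<in> S"
      using idempotent_commutes[OF e commutator_pE_l[OF e(1)]] by (simp add: S_def)
  qed (simp add: pE_0 S_small small_1)
  have pF: "pF n \<in> S" for n
  proof (rule divided_powers_closed[OF _ S_small[OF small_pF_1] _ pF_mult S_mult S_pc S_proj])
    show "pF l \<in> S"
      using idempotent_commutes[OF e commutator_pF_l[OF e(1)]] by (simp add: S_def)
  qed (simp add: pF_0 S_small small_1)
  have gen: "pure u c \<in> S" if "pure u 1 \<in> S" for u c
    using S_pc[OF that, of c] by (simp add: pure_mult)
  have all: "Rep_UA u = x \<Longrightarrow> pure u 1 \<in> S" if "x \<in> UA_set" for u x
    using that
  proof (induction arbitrary: u rule: UA_set.induct)
    case one
    then have "u = 1" by (simp add: one_UA.rep_eq flip: Rep_UA_inject)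
    then show ?case using S_small[OF small_1] by (simp add: pure_one)
  next
    case (divided_E n)
    then have "u = UA_dE n" by (simp add: UA_dE.rep_eq flip: Rep_UA_inject)
    then show ?case using pE by simp
  next
    case (divided_F n)
    then have "u = UA_dF n" by (simp add: UA_dF.rep_eq flip: Rep_UA_inject)
    then show ?case using pF by simp
  next
    case K
    then have "u = UA_K" by (simp add: UA_K.rep_eq flip: Rep_UA_inject)
    then show ?case using S_small[OF small.K] by simp
  next
    case Kinv
    then have "u = UA_Ki" by (simp add: UA_Ki.rep_eq flip: Rep_UA_inject)
    then show ?case using S_small[OF small_pKi] by simp
  next
    case (diff x y)
    have r: "Rep_UA (Abs_UA x) = x" "Rep_UA (Abs_UA y) = y" using diff by (simp_all add: Abs_UA_inverse)
    then have "u = Abs_UA x + - Abs_UA y"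
      using diff.prems by (simp add: plus_UA.rep_eq uminus_UA.rep_eq minus_UA.rep_eq flip: Rep_UA_inject)
    then have "proj (pure (Abs_UA x) 1 + - pure (Abs_UA y) 1) = proj (pure u 1)"
      using proj_pure_add_left[of "Abs_UA x" "- Abs_UA y" 1]
        proj_add_cong[OF refl proj_pure_uminus(2)[of "Abs_UA y" 1], of "pure (Abs_UA x) 1"] by simp
    then show ?case by (rule S_proj[OF S_add[OF diff.IH(1)[OF r(1)] S_uminus[OF diff.IH(2)[OF r(2)]]]])
  next
    case (mult x y)
    have r: "Rep_UA (Abs_UA x) = x" "Rep_UA (Abs_UA y) = y" using mult by (simp_all add: Abs_UA_inverse)
    then have "u = Abs_UA x * Abs_UA y"
      using mult.prems by (simp add: times_UA.rep_eq flip: Rep_UA_inject)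
    then show ?case using S_mult[OF mult.IH(1)[OF r(1)] mult.IH(2)[OF r(2)]] by (simp add: pure_mult)
  next
    case (smult x p)
    have r: "Rep_UA (Abs_UA x) = x" using smult by (simp add: Abs_UA_inverse)
    then have "u = UA_smult p (Abs_UA x)"
      using smult.prems by (simp add: UA_smult.rep_eq flip: Rep_UA_inject)
    then have "proj (pure (Abs_UA x) (laurent_eval p \<zeta> * 1)) = proj (pure u 1)"
      by (simp only: proj_pure_smult)
    then show ?case by (rule S_proj[OF gen[OF smult.IH[OF r]]])
  qed
  have "x \<in> S" for x
  proof (induction x rule: pre_tensor_induct)
    case zero
    then show ?case by (rule S_small[OF small_0])
  next
    case (pure u c)
    show ?case by (rule gen[OF all[OF Rep_UA refl]])
  qed (simp_all add: S_add S_uminus)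
  then show ?thesis by (auto simp: central_def S_def)
qed

section \<open>Indecomposability\<close>

abbreviation u_small where "u_small \<equiv> small_u l \<zeta>"

lemma u_small_simps [simp]:
  "monoid.mult u_small = monoid.mult U" "one u_small = one U" "zero u_small = zero U" "add u_small = add U"
  by (simp_all add: small_u_def del: U_simps)

lemma proj_in_U [simp]: "proj x \<in> carrier U"
  by (simp only: carrier_U rangeI)

lemma carrier_small_u: "carrier u_small = proj ` small"
proof -
  let ?G = "{a \<odot>\<^bsub>U\<^esub> \<one>\<^bsub>U\<^esub> | a. a \<in> carrier (ring_of_type_algebra :: 'k ring)} \<union>
    {Uzeta_tensor l \<zeta> UA_E 1, Uzeta_tensor l \<zeta> UA_F 1, Uzeta_tensor l \<zeta> UA_K 1}"
  have car: "carrier u_small = generate_ring U ?G"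
    by (simp add: small_u_def subalgebra_generated_def del: U_simps)
  have one: "a \<odot>\<^bsub>U\<^esub> \<one>\<^bsub>U\<^esub> = proj (pc a)" for a
    using smult_proj[of a 1] by (simp only: proj_hom(3) mult_1_right)
  have "x \<in> proj ` small" if "x \<in> generate_ring U ?G" for x
    using that
  proof induction
    case one
    show ?case using small_1 proj_hom(3) by (metis imageI)
  next
    case (incl h)
    then consider a where "h = proj (pc a)" | "h = proj (pure UA_E 1)" | "h = proj (pure UA_F 1)" | "h = proj pK"
      unfolding one Uzeta_tensor_eq by blast
    then show ?case by cases (auto intro: small.intros)
  next
    case (a_inv h)
    then obtain x where x: "x \<in> small" "h = proj x" by blast
    show ?case unfolding x(2) proj_uminus[symmetric] by (rule imageI[OF small_uminus[OF x(1)]])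
  next
    case (eng_add h1 h2)
    then obtain x y where x: "x \<in> small" "h1 = proj x" and y: "y \<in> small" "h2 = proj y" by blast
    show ?case unfolding x(2) y(2) proj_hom(1)[symmetric] by (rule imageI[OF small.add[OF x(1) y(1)]])
  next
    case (eng_mult h1 h2)
    then obtain x y where x: "x \<in> small" "h1 = proj x" and y: "y \<in> small" "h2 = proj y" by blast
    show ?case unfolding x(2) y(2) proj_hom(2)[symmetric] by (rule imageI[OF small.mult[OF x(1) y(1)]])
  qed
  moreover have "proj x \<in> generate_ring U ?G" if "x \<in> small" for x
    using that
  proof induction
    case (pc c)
    have "proj (pc c) \<in> ?G" unfolding one[symmetric] by auto
    then show ?case by (rule generate_ring.incl)
  next
    case (add x y)
    then show ?case unfolding proj_hom(1) by (intro generate_ring.eng_add)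
  next
    case (mult x y)
    then show ?case unfolding proj_hom(2) by (intro generate_ring.eng_mult)
  next
    case (proj x y)
    then show ?case by simp
  qed (auto intro!: generate_ring.incl simp: Uzeta_tensor_eq)
  ultimately show ?thesis unfolding car by blast
qed

lemma center_simps:
  "carrier (ring_center u_small) = {z \<in> proj ` small. \<forall>x\<in>proj ` small. z \<otimes>\<^bsub>U\<^esub> x = x \<otimes>\<^bsub>U\<^esub> z}"
  "monoid.mult (ring_center u_small) = monoid.mult U" "zero (ring_center u_small) = zero U"
  "add (ring_center u_small) = add U"
  by (simp_all add: ring_center_def carrier_small_u del: U_simps)

text \<open>Primitivity speaks about the centre of the small algebra, while a decomposition yields
  idempotents central in U_zeta; \<open>central_idempotent_small\<close> bridges the gap.\<close>

lemma idempotent_in_center: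
  assumes f: "f \<in> carrier U" "f \<otimes>\<^bsub>U\<^esub> f = f" and c: "\<And>x. x \<in> carrier U \<Longrightarrow> f \<otimes>\<^bsub>U\<^esub> x = x \<otimes>\<^bsub>U\<^esub> f"
  shows "idempotent_in (ring_center u_small) f"
proof -
  obtain f0 where f0: "f = proj f0" using f(1) unfolding carrier_U by blast
  have "central f0" unfolding central_def using c f0 by (simp add: proj_hom del: U_simps)
  moreover have "proj (f0 * f0) = proj f0" using f(2) f0 by (simp add: proj_hom del: U_simps)
  ultimately have "f0 \<in> small" by (rule central_idempotent_small)
  then have "f \<in> proj ` small" using f0 by blast
  moreover have "f \<otimes>\<^bsub>U\<^esub> proj x = proj x \<otimes>\<^bsub>U\<^esub> f" for x by (rule c[OF proj_in_U])
  ultimately show ?thesis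
    unfolding idempotent_in_def center_simps using f(2) by blast
qed

end

section \<open>Algebras cut out by a central idempotent, and direct products\<close>

lemma ring_cut_algebra:
  assumes "ring A" and e: "e \<in> carrier A" "e \<otimes>\<^bsub>A\<^esub> e = e"
    and c: "\<And>x. x \<in> carrier A \<Longrightarrow> e \<otimes>\<^bsub>A\<^esub> x = x \<otimes>\<^bsub>A\<^esub> e"
  shows "ring (cut_algebra e A)" "ideal (e <#\<^bsub>A\<^esub> carrier A) A"
    "e <#\<^bsub>A\<^esub> carrier A = {x \<in> carrier A. e \<otimes>\<^bsub>A\<^esub> x = x}"
proof -
  interpret A: ring A by fact
  let ?C = "{x \<in> carrier A. e \<otimes>\<^bsub>A\<^esub> x = x}"
  show C: "e <#\<^bsub>A\<^esub> carrier A = ?C"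
    using e by (auto simp: l_coset_def A.m_assoc[symmetric])
  have simps: "carrier (cut_algebra e A) = ?C" "monoid.mult (cut_algebra e A) = monoid.mult A"
    "one (cut_algebra e A) = e" "zero (cut_algebra e A) = zero A" "add (cut_algebra e A) = add A"
    by (simp_all add: cut_algebra_def C)
  have neg: "\<ominus>\<^bsub>A\<^esub> x \<in> ?C" if "x \<in> ?C" for x using that e by (simp add: A.r_minus)
  have inv: "\<exists>y\<in>?C. y \<oplus>\<^bsub>A\<^esub> x = \<zero>\<^bsub>A\<^esub>" if "x \<in> ?C" for x
    using neg[OF that] that A.l_neg by blast
  have ml: "e \<otimes>\<^bsub>A\<^esub> (x \<otimes>\<^bsub>A\<^esub> y) = x \<otimes>\<^bsub>A\<^esub> y" if "x \<in> ?C" "y \<in> carrier A" for x y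
    using that e by (simp add: A.m_assoc[symmetric])
  have mr: "e \<otimes>\<^bsub>A\<^esub> (y \<otimes>\<^bsub>A\<^esub> x) = y \<otimes>\<^bsub>A\<^esub> x" if "x \<in> ?C" "y \<in> carrier A" for x y
  proof -
    have "e \<otimes>\<^bsub>A\<^esub> (y \<otimes>\<^bsub>A\<^esub> x) = y \<otimes>\<^bsub>A\<^esub> e \<otimes>\<^bsub>A\<^esub> x" using that e c[of y] by (simp add: A.m_assoc[symmetric])
    then show ?thesis using that e by (simp add: A.m_assoc)
  qed
  have er: "x \<otimes>\<^bsub>A\<^esub> e = x" if "x \<in> ?C" for x
    using that c[of x] by simp
  show "ring (cut_algebra e A)"
  proof (rule ringI)
    show "abelian_group (cut_algebra e A)"
      by (rule abelian_groupI) (use e inv in \<open>auto simp: simps A.r_distr A.a_ac\<close>)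
    show "Group.monoid (cut_algebra e A)"
      by (rule monoidI) (use e ml er in \<open>auto simp: simps A.m_assoc\<close>)
  qed (auto simp: simps A.l_distr A.r_distr)
  have "subgroup ?C (add_monoid A)"
  proof (rule subgroup.intro)
    show "inv\<^bsub>add_monoid A\<^esub> x \<in> ?C" if "x \<in> ?C" for x
      using neg[OF that] by (simp only: a_inv_def)
  qed (use e in \<open>auto simp: A.r_distr\<close>)
  then show "ideal (e <#\<^bsub>A\<^esub> carrier A) A"
    unfolding C by (rule idealI[OF A.ring_axioms]) (use ml mr in auto)
qed

lemma algebra_prod_simps:
  "carrier (algebra_prod A B) = carrier A \<times> carrier B"
  "(a, b) \<otimes>\<^bsub>algebra_prod A B\<^esub> (c, d) = (a \<otimes>\<^bsub>A\<^esub> c, b \<otimes>\<^bsub>B\<^esub> d)"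
  "(a, b) \<oplus>\<^bsub>algebra_prod A B\<^esub> (c, d) = (a \<oplus>\<^bsub>A\<^esub> c, b \<oplus>\<^bsub>B\<^esub> d)"
  "\<one>\<^bsub>algebra_prod A B\<^esub> = (\<one>\<^bsub>A\<^esub>, \<one>\<^bsub>B\<^esub>)"
  by (simp_all add: algebra_prod_def RDirProd_def DirProd_def monoid.defs ring.defs)

text \<open>The idempotents are the preimages of (1, 0) and (0, 1); they are nonzero because both
  factors are.\<close>

lemma algebra_prod_idempotents:
  assumes C: "ring C" and A: "ring A" "carrier A \<noteq> {\<zero>\<^bsub>A\<^esub>}" and B: "ring B" "carrier B \<noteq> {\<zero>\<^bsub>B\<^esub>}"
    and h: "h \<in> ring_iso C (algebra_prod A B)"
  obtains f g where "f \<in> carrier C" "g \<in> carrier C" "f \<noteq> \<zero>\<^bsub>C\<^esub>" "g \<noteq> \<zero>\<^bsub>C\<^esub>" "f \<oplus>\<^bsub>C\<^esub> g = \<one>\<^bsub>C\<^esub>"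
    "f \<otimes>\<^bsub>C\<^esub> f = f" "g \<otimes>\<^bsub>C\<^esub> g = g" "f \<otimes>\<^bsub>C\<^esub> g = \<zero>\<^bsub>C\<^esub>" "g \<otimes>\<^bsub>C\<^esub> f = \<zero>\<^bsub>C\<^esub>"
    "\<And>x. x \<in> carrier C \<Longrightarrow> f \<otimes>\<^bsub>C\<^esub> x = x \<otimes>\<^bsub>C\<^esub> f" "\<And>x. x \<in> carrier C \<Longrightarrow> g \<otimes>\<^bsub>C\<^esub> x = x \<otimes>\<^bsub>C\<^esub> g"
proof -
  interpret C: ring C by fact
  interpret A: ring A by fact
  interpret B: ring B by fact
  have hom: "h (x \<otimes>\<^bsub>C\<^esub> y) = h x \<otimes>\<^bsub>algebra_prod A B\<^esub> h y" "h (x \<oplus>\<^bsub>C\<^esub> y) = h x \<oplus>\<^bsub>algebra_prod A B\<^esub> h y"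
    if "x \<in> carrier C" "y \<in> carrier C" for x y
    using ring_iso_memE[OF h] that by auto
  have one: "h \<one>\<^bsub>C\<^esub> = (\<one>\<^bsub>A\<^esub>, \<one>\<^bsub>B\<^esub>)" using ring_iso_memE(4)[OF h] by (simp add: algebra_prod_simps)
  have bij: "bij_betw h (carrier C) (carrier A \<times> carrier B)"
    using ring_iso_memE(5)[OF h] by (simp add: algebra_prod_simps)
  then have inj: "x = y" if "x \<in> carrier C" "y \<in> carrier C" "h x = h y" for x y
    using that by (auto simp: bij_betw_def inj_on_def)
  have surj: "\<exists>x\<in>carrier C. h x = p" if "p \<in> carrier A \<times> carrier B" for p
    using bij that by (auto simp: bij_betw_def image_iff) (metis (no_types) imageE that)
  have img: "\<exists>a b. h x = (a, b) \<and> a \<in> carrier A \<and> b \<in> carrier B" if "x \<in> carrier C" for x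
    using bij that by (metis bij_betw_apply mem_Sigma_iff prod.collapse)
  have zero: "h \<zero>\<^bsub>C\<^esub> = (\<zero>\<^bsub>A\<^esub>, \<zero>\<^bsub>B\<^esub>)"
  proof -
    \<comment> \<open>A ring isomorphism is only required to respect products, sums and the unit;
      zero is recognised as the element equal to its own double.\<close>
    obtain z where z: "z \<in> carrier C" "h z = (\<zero>\<^bsub>A\<^esub>, \<zero>\<^bsub>B\<^esub>)" using surj by blast
    have "h (z \<oplus>\<^bsub>C\<^esub> z) = h z" using z by (simp add: hom algebra_prod_simps)
    then have "z \<oplus>\<^bsub>C\<^esub> z = z" using z(1) by (intro inj) auto
    then have "z = \<zero>\<^bsub>C\<^esub>" using z(1) C.add.l_cancel_one by blast
    then show ?thesis using z(2) by simp
  qed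
  obtain f where f: "f \<in> carrier C" "h f = (\<one>\<^bsub>A\<^esub>, \<zero>\<^bsub>B\<^esub>)" using surj by blast
  obtain g where g: "g \<in> carrier C" "h g = (\<zero>\<^bsub>A\<^esub>, \<one>\<^bsub>B\<^esub>)" using surj by blast
  have nz: "\<one>\<^bsub>A\<^esub> \<noteq> \<zero>\<^bsub>A\<^esub>" "\<one>\<^bsub>B\<^esub> \<noteq> \<zero>\<^bsub>B\<^esub>"
    using A(2) B(2) A.one_zeroD B.one_zeroD by auto
  show ?thesis
  proof
    show "f \<noteq> \<zero>\<^bsub>C\<^esub>" "g \<noteq> \<zero>\<^bsub>C\<^esub>" using f g zero nz by auto
    show "f \<oplus>\<^bsub>C\<^esub> g = \<one>\<^bsub>C\<^esub>" "f \<otimes>\<^bsub>C\<^esub> f = f" "g \<otimes>\<^bsub>C\<^esub> g = g" "f \<otimes>\<^bsub>C\<^esub> g = \<zero>\<^bsub>C\<^esub>" "g \<otimes>\<^bsub>C\<^esub> f = \<zero>\<^bsub>C\<^esub>"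
      by (rule inj; use f g in \<open>simp add: hom algebra_prod_simps one zero\<close>)+
    show "f \<otimes>\<^bsub>C\<^esub> x = x \<otimes>\<^bsub>C\<^esub> f" "g \<otimes>\<^bsub>C\<^esub> x = x \<otimes>\<^bsub>C\<^esub> g" if "x \<in> carrier C" for x
      by (rule inj; use img[OF that] that f g in \<open>auto simp add: hom algebra_prod_simps\<close>)+
  qed (use f g in auto)
qed

lemma cring_type_algebra: "cring (ring_of_type_algebra :: 'a::comm_ring_1 ring)"
proof -
  interpret R: ring "ring_of_type_algebra :: 'a ring" by (rule ring_ring_of_type_algebra)
  show ?thesis
    by (intro cring.intro comm_monoid.intro comm_monoid_axioms.intro R.ring_axioms R.monoid_axioms)
      (simp add: mult.commute)
qed

lemma (in root_of_unity) assoc_algebra_cut: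
  assumes e: "e \<in> carrier U" "e \<otimes>\<^bsub>U\<^esub> e = e" and c: "\<And>x. x \<in> carrier U \<Longrightarrow> e \<otimes>\<^bsub>U\<^esub> x = x \<otimes>\<^bsub>U\<^esub> e"
  shows "assoc_algebra (ring_of_type_algebra :: 'k ring) (cut_algebra e U)"
proof -
  note cut = ring_cut_algebra[OF ring_U e c]
  interpret C: ring "cut_algebra e U" by (rule cut(1))
  have simps: "carrier (cut_algebra e U) = {x \<in> carrier U. e \<otimes>\<^bsub>U\<^esub> x = x}"
    "monoid.mult (cut_algebra e U) = monoid.mult U" "add (cut_algebra e U) = add U"
    "module.smult (cut_algebra e U) = module.smult U"
    by (simp_all add: cut_algebra_def cut(3) del: U_simps)
  obtain e0 where e0: "e = proj e0" using e(1) unfolding carrier_U by blast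
  have smult: "c \<odot>\<^bsub>U\<^esub> x \<in> carrier U" "e \<otimes>\<^bsub>U\<^esub> (c \<odot>\<^bsub>U\<^esub> x) = c \<odot>\<^bsub>U\<^esub> (e \<otimes>\<^bsub>U\<^esub> x)"
    "(c + d) \<odot>\<^bsub>U\<^esub> x = c \<odot>\<^bsub>U\<^esub> x \<oplus>\<^bsub>U\<^esub> d \<odot>\<^bsub>U\<^esub> x" "(c * d) \<odot>\<^bsub>U\<^esub> x = c \<odot>\<^bsub>U\<^esub> (d \<odot>\<^bsub>U\<^esub> x)" "1 \<odot>\<^bsub>U\<^esub> x = x"
    if x: "x \<in> carrier U" for c d x
  proof -
    obtain x0 where x0: "x = proj x0" using x unfolding carrier_U by blast
    show "c \<odot>\<^bsub>U\<^esub> x \<in> carrier U" unfolding x0 smult_proj by (rule proj_in_U)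
    show "e \<otimes>\<^bsub>U\<^esub> (c \<odot>\<^bsub>U\<^esub> x) = c \<odot>\<^bsub>U\<^esub> (e \<otimes>\<^bsub>U\<^esub> x)"
      unfolding x0 e0 smult_proj proj_hom(2)[symmetric] mult.assoc[symmetric] pc_commute[of e0 c] ..
    show "(c + d) \<odot>\<^bsub>U\<^esub> x = c \<odot>\<^bsub>U\<^esub> x \<oplus>\<^bsub>U\<^esub> d \<odot>\<^bsub>U\<^esub> x"
      unfolding x0 smult_proj proj_hom(1)[symmetric] by (rule proj_pc_add)
    show "(c * d) \<odot>\<^bsub>U\<^esub> x = c \<odot>\<^bsub>U\<^esub> (d \<odot>\<^bsub>U\<^esub> x)" unfolding x0 smult_proj pc_pc ..
    show "1 \<odot>\<^bsub>U\<^esub> x = x" unfolding x0 smult_proj by simp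
  qed
  have smult2: "c \<odot>\<^bsub>U\<^esub> (x \<oplus>\<^bsub>U\<^esub> y) = c \<odot>\<^bsub>U\<^esub> x \<oplus>\<^bsub>U\<^esub> c \<odot>\<^bsub>U\<^esub> y"
    "(c \<odot>\<^bsub>U\<^esub> x) \<otimes>\<^bsub>U\<^esub> y = c \<odot>\<^bsub>U\<^esub> (x \<otimes>\<^bsub>U\<^esub> y)" "x \<otimes>\<^bsub>U\<^esub> (c \<odot>\<^bsub>U\<^esub> y) = c \<odot>\<^bsub>U\<^esub> (x \<otimes>\<^bsub>U\<^esub> y)"
    if x: "x \<in> carrier U" "y \<in> carrier U" for c x y
  proof -
    obtain x0 y0 where xy: "x = proj x0" "y = proj y0" using x unfolding carrier_U by blast
    show "c \<odot>\<^bsub>U\<^esub> (x \<oplus>\<^bsub>U\<^esub> y) = c \<odot>\<^bsub>U\<^esub> x \<oplus>\<^bsub>U\<^esub> c \<odot>\<^bsub>U\<^esub> y"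
      unfolding xy smult_proj proj_hom(1)[symmetric] distrib_left ..
    show "(c \<odot>\<^bsub>U\<^esub> x) \<otimes>\<^bsub>U\<^esub> y = c \<odot>\<^bsub>U\<^esub> (x \<otimes>\<^bsub>U\<^esub> y)"
      unfolding xy smult_proj proj_hom(2)[symmetric] mult.assoc ..
    show "x \<otimes>\<^bsub>U\<^esub> (c \<odot>\<^bsub>U\<^esub> y) = c \<odot>\<^bsub>U\<^esub> (x \<otimes>\<^bsub>U\<^esub> y)"
      unfolding xy smult_proj proj_hom(2)[symmetric] mult.assoc[symmetric] pc_commute[of x0 c] ..
  qed
  show ?thesis
    by (intro assoc_algebra.intro module.intro module_axioms.intro assoc_algebra_axioms.intro
        cring_type_algebra C.ring_axioms C.abelian_group_axioms)
      (auto simp: simps smult smult2 simp del: U_simps)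
qed

theorem mainTheorem6:
  fixes \<zeta> :: "'k::field_char_0" and l :: nat
    and \<epsilon> :: "'k pre_tensor set set"
  assumes "l > 1" and "odd l"
    and "primitive_root_of_unity l \<zeta>"
    and "primitive_central_idempotent (small_u l \<zeta>) \<epsilon>"
  shows "ideal (\<epsilon> <#\<^bsub>Uzeta l \<zeta>\<^esub> carrier (Uzeta l \<zeta>)) (Uzeta l \<zeta>)
    \<and> assoc_algebra (ring_of_type_algebra :: 'k ring) (cut_algebra \<epsilon> (Uzeta l \<zeta>))
    \<and> \<not> (\<exists>(A :: ('k, 'a) module) (B :: ('k, 'b) module).
          assoc_algebra (ring_of_type_algebra :: 'k ring) A \<and> carrier A \<noteq> {\<zero>\<^bsub>A\<^esub>} \<and>
          assoc_algebra (ring_of_type_algebra :: 'k ring) B \<and> carrier B \<noteq> {\<zero>\<^bsub>B\<^esub>} \<and>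
          algebra_iso (ring_of_type_algebra :: 'k ring)
            (cut_algebra \<epsilon> (Uzeta l \<zeta>)) (algebra_prod A B) \<noteq> {})"
proof -
  interpret root_of_unity \<zeta> l by unfold_locales (use assms in auto)
  interpret U: ring U by (rule ring_U)
  have prim: "primitive_idempotent (ring_center u_small) \<epsilon>"
    using assms(4) by (simp only: primitive_central_idempotent_def)
  then have idem: "idempotent_in (ring_center u_small) \<epsilon>" by (simp only: primitive_idempotent_def)
  then obtain e0 where e0: "\<epsilon> = proj e0" "e0 \<in> small" unfolding idempotent_in_def center_simps by blast
  have ee: "\<epsilon> \<otimes>\<^bsub>U\<^esub> \<epsilon> = \<epsilon>" using idem unfolding idempotent_in_def center_simps by blast
  \<comment> \<open>The hypothesis gives commutation within the small algebra only, whereas a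
    two-sided ideal calls for it in all of U_zeta.\<close>
  have "central e0"
  proof (rule small_central_idempotent[OF e0(2)])
    show "proj (e0 * e0) = proj e0" using ee unfolding e0(1) proj_hom(2) .
    show "proj (e0 * y) = proj (y * e0)" if "y \<in> small" for y
      using idem that unfolding idempotent_in_def center_simps e0(1) proj_hom(2) by blast
  qed
  then have comm: "\<epsilon> \<otimes>\<^bsub>U\<^esub> x = x \<otimes>\<^bsub>U\<^esub> \<epsilon>" if x: "x \<in> carrier U" for x
  proof -
    obtain x0 where "x = proj x0" using x unfolding carrier_U by blast
    then show ?thesis using centralD[OF \<open>central e0\<close>, of x0] unfolding e0(1) proj_hom(2) by simp
  qed
  have eU: "\<epsilon> \<in> carrier U" unfolding e0(1) by (rule proj_in_U)
  have cut: "ring (cut_algebra \<epsilon> U)" "ideal (\<epsilon> <#\<^bsub>U\<^esub> carrier U) U"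
    "\<epsilon> <#\<^bsub>U\<^esub> carrier U = {x \<in> carrier U. \<epsilon> \<otimes>\<^bsub>U\<^esub> x = x}"
    by (rule ring_cut_algebra[OF ring_U eU ee], erule comm)+
  have simps: "carrier (cut_algebra \<epsilon> U) = {x \<in> carrier U. \<epsilon> \<otimes>\<^bsub>U\<^esub> x = x}"
    "monoid.mult (cut_algebra \<epsilon> U) = monoid.mult U" "add (cut_algebra \<epsilon> U) = add U"
    "one (cut_algebra \<epsilon> U) = \<epsilon>" "zero (cut_algebra \<epsilon> U) = zero U"
    by (simp_all add: cut_algebra_def cut(3) del: U_simps)
  have indecomposable: False
    if A: "assoc_algebra (ring_of_type_algebra :: 'k ring) A" "carrier A \<noteq> {\<zero>\<^bsub>A\<^esub>}"
      and B: "assoc_algebra (ring_of_type_algebra :: 'k ring) B" "carrier B \<noteq> {\<zero>\<^bsub>B\<^esub>}"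
      and h: "h \<in> algebra_iso (ring_of_type_algebra :: 'k ring) (cut_algebra \<epsilon> U) (algebra_prod A B)"
    for A :: "('k, 'a) module" and B :: "('k, 'b) module" and h
  proof -
    have rings: "ring A" "ring B" using A(1) B(1) by (auto simp: assoc_algebra_def)
    have h': "h \<in> ring_iso (cut_algebra \<epsilon> U) (algebra_prod A B)" using h by (simp add: algebra_iso_def)
    let ?C = "{x \<in> carrier U. \<epsilon> \<otimes>\<^bsub>U\<^esub> x = x}"
    obtain f g where fg: "f \<in> ?C" "g \<in> ?C" "f \<noteq> \<zero>\<^bsub>U\<^esub>" "g \<noteq> \<zero>\<^bsub>U\<^esub>" "f \<oplus>\<^bsub>U\<^esub> g = \<epsilon>"
      "f \<otimes>\<^bsub>U\<^esub> f = f" "g \<otimes>\<^bsub>U\<^esub> g = g" "f \<otimes>\<^bsub>U\<^esub> g = \<zero>\<^bsub>U\<^esub>" "g \<otimes>\<^bsub>U\<^esub> f = \<zero>\<^bsub>U\<^esub>"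
      and c: "\<And>x. x \<in> ?C \<Longrightarrow> f \<otimes>\<^bsub>U\<^esub> x = x \<otimes>\<^bsub>U\<^esub> f" "\<And>x. x \<in> ?C \<Longrightarrow> g \<otimes>\<^bsub>U\<^esub> x = x \<otimes>\<^bsub>U\<^esub> g"
      by (rule algebra_prod_idempotents[OF cut(1) rings(1) A(2) rings(2) B(2) h', unfolded simps]) (rule that)
    have carr: "f \<in> carrier U" "g \<in> carrier U" using fg(1,2) by simp_all
    \<comment> \<open>Centrality extends from \<open>\<epsilon> U\<close> to U_zeta: as
      \<open>\<epsilon>\<close> fixes y, one has y x = y (\<epsilon> x) = (\<epsilon> x) y = x
      y.\<close>
    have central: "y \<otimes>\<^bsub>U\<^esub> x = x \<otimes>\<^bsub>U\<^esub> y"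
      if y: "y \<in> ?C" and c: "\<And>x. x \<in> ?C \<Longrightarrow> y \<otimes>\<^bsub>U\<^esub> x = x \<otimes>\<^bsub>U\<^esub> y" and x: "x \<in> carrier U" for x y
    proof -
      let ?ex = "\<epsilon> \<otimes>\<^bsub>U\<^esub> x"
      have yU: "y \<in> carrier U" and ye: "\<epsilon> \<otimes>\<^bsub>U\<^esub> y = y" using y by blast+
      have "\<epsilon> \<otimes>\<^bsub>U\<^esub> ?ex = ?ex" using U.m_assoc[OF eU eU x] by (simp only: ee)
      then have ex: "?ex \<in> ?C" using U.m_closed[OF eU x] by blast
      have "y \<otimes>\<^bsub>U\<^esub> x = (y \<otimes>\<^bsub>U\<^esub> \<epsilon>) \<otimes>\<^bsub>U\<^esub> x" unfolding comm[OF yU, symmetric] ye ..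
      also have "\<dots> = y \<otimes>\<^bsub>U\<^esub> ?ex" by (rule U.m_assoc[OF yU eU x])
      also have "\<dots> = ?ex \<otimes>\<^bsub>U\<^esub> y" by (rule c[OF ex])
      also have "\<dots> = x \<otimes>\<^bsub>U\<^esub> (\<epsilon> \<otimes>\<^bsub>U\<^esub> y)" unfolding comm[OF x] by (rule U.m_assoc[OF x eU yU])
      finally show ?thesis unfolding ye .
    qed
    have "idempotent_in (ring_center u_small) f"
      by (rule idempotent_in_center[OF carr(1) fg(6) central[OF fg(1) c(1)]])
    moreover have "idempotent_in (ring_center u_small) g"
      by (rule idempotent_in_center[OF carr(2) fg(7) central[OF fg(2) c(2)]])
    ultimately have "f = \<zero>\<^bsub>U\<^esub> \<or> g = \<zero>\<^bsub>U\<^esub>"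
      using prim fg(5,8,9) unfolding primitive_idempotent_def center_simps by metis
    then show False using fg(3,4) by blast
  qed
  show ?thesis
    using cut(2) assoc_algebra_cut[OF eU ee comm] indecomposable by blast
qed

end
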